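(* Let $\Sigma$ be a compact, smooth, oriented, closed surface of genus $g\ge2$ and let $\rho$ be a canonical metric on $\Sigma$. Let $\sigma(s)$, with parameter $s=(s^a,s^b)$, $|s|<\epsilon$ small, be a family of canonical metrics on $\Sigma$ with $\sigma(0)=\rho$, and let $w(s):(\Sigma,\sigma(s))\to(\Sigma,\rho)$ be the family of harmonic maps in the homotopy class of the identity, where $w(s)$ varies real analytically in $s$ (so that $w(0)$ is the identity map). Let $\phi(s)dz(s)^2=\rho\,w_z(s)\,\bar w_z(s)\,dz(s)^2$ be the associated Hopf differentials, where $z(s)$ is a conformal coordinate for $\sigma(s)$, so that $\phi(0)=0$, and let $\phi_a=\frac{\partial\phi(s)}{\partial s^a}\big|_{s=0}$ and $\phi_b=\frac{\partial\phi(s)}{\partial s^b}\big|_{s=0}$ be the infinitesimal holomorphic quadratic differentials. Let $E(s)$ be the total energy of $w(s)$. Then the second variation of the energy functional of $w(s)$ at $s=0$ is given, up to a constant, by the $L^2$-Bergman metric of the infinitesimal holomorphic quadratic differentials; explicitly, $$\frac{\partial^2}{\partial s^a\,\overline{\partial s^b}}\Big|_{s=0}E(s)=2\,\langle\phi_a,\phi_b\rangle_B ,$$ where $\langle\cdot,\cdot\rangle_B$ is the $L^2$-Bergman inner product on holomorphic quadratic differentials on $(\Sigma,\rho)$.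
   Context: Canonical metric: for a conformal structure on $\Sigma$, let $\omega_1,\dots,\omega_g$ be the basis of holomorphic one-forms normalized by $\int_{A_i}\omega_j=\delta_{ij}$ for a symplectic homology basis $\{A_i,B_i\}_{1\le i\le g}$, and let $\Omega_{ij}=\int_{B_i}\omega_j$ be the period matrix (symmetric with positive definite imaginary part). The canonical metric $\rho_B$ is the conformal metric associated to the $(1,1)$-form $\frac{\sqrt{-1}}{2}\sum_{i,j=1}^{g}(\mathrm{Im}\,\Omega)^{-1}_{ij}\,\omega_i(z)\,\bar{\omega}_j(\bar z)$; each conformal structure carries exactly one. It has total area $g$ and nonpositive Gaussian curvature with at most finitely many flat points, and between canonical metrics on $\Sigma$ there is a unique harmonic map in the homotopy class of the identity, which is a diffeomorphism. Energy: for $w:(\Sigma,\sigma|dz|^2)\to(\Sigma,\rho|dw|^2)$, put $\mathcal{H}=\frac{\rho(w(z))}{\sigma(z)}|w_z|^2$ and $\mathcal{L}=\frac{\rho(w(z))}{\sigma(z)}|w_{\bar z}|^2$. The total energy is $E(w,\sigma,\rho)=\int_\Sigma(\mathcal{H}+\mathcal{L})\,\sigma\,dx\,dy$ with $z=x+iy$, and $w$ is harmonic if it is a critical point of $E$. The Hopf differential is the $(2,0)$-part $\rho(w(z))\,w_z\bar w_z\,dz^2$ of $w^*\rho$ (where $\bar w_z=\partial_z\bar w$), which is a holomorphic quadratic differential on the domain when $w$ is harmonic. Here $E(s)=E(w(s),\sigma(s),\rho)$. $L^2$-Bergman inner product: for holomorphic quadratic differentials $\phi\,dz^2,\psi\,dz^2$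 on a Riemann surface with canonical metric $\rho_B|dz|^2$, $\langle\phi,\psi\rangle_B=\int_\Sigma\frac{\phi\bar\psi}{\rho_B}\,dx\,dy$, so that $\|\phi\|_B^2=\int_\Sigma\frac{|\phi|^2}{\rho_B}\,dx\,dy$. The $L^2$-Bergman metric on Teichmüller space is defined from it by duality.
   Formalization: The parameters s^a, s^b are taken complex, and φ(s) is assumed complex differentiable in s^a and in s^b at s=0 (its derivatives in the conjugate parameters vanish there); otherwise the identity has an extra term and fails, e.g. for σ(s̄). *)

theory Defs
  imports "HOL-Analysis.Analysis" "HOL-Homology.Homology"
begin

section \<open>Smooth functions and Wirtinger derivatives\<close>

text \<open>Only used for open \<open>S\<close>.\<close>

primrec Ck_on :: "nat \<Rightarrow> 'a::real_normed_vector set \<Rightarrow> ('a \<Rightarrow> 'b::real_normed_vector) \<Rightarrow> bool" where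
  "Ck_on 0 S f \<longleftrightarrow> continuous_on S f"
| "Ck_on (Suc k) S f \<longleftrightarrow>
     f differentiable_on S \<and> (\<forall>v. Ck_on k S (\<lambda>x. frechet_derivative f (at x) v))"

definition smooth_on :: "'a::real_normed_vector set \<Rightarrow> ('a \<Rightarrow> 'b::real_normed_vector) \<Rightarrow> bool" where
  "smooth_on S f \<longleftrightarrow> (\<forall>k. Ck_on k S f)"

definition pd_z :: "(complex \<Rightarrow> complex) \<Rightarrow> complex \<Rightarrow> complex" where
  "pd_z f z = (frechet_derivative f (at z) 1 - \<i> * frechet_derivative f (at z) \<i>) / 2"

definition pd_zbar :: "(complex \<Rightarrow> complex) \<Rightarrow> complex \<Rightarrow> complex" where
  "pd_zbar f z = (frechet_derivative f (at z) 1 + \<i> * frechet_derivative f (at z) \<i>) / 2"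

definition jacobian :: "(complex \<Rightarrow> complex) \<Rightarrow> complex \<Rightarrow> real" where
  "jacobian f z = Im (cnj (frechet_derivative f (at z) 1) * frechet_derivative f (at z) \<i>)"

text \<open>\<open>\<partial>\<^sup>2E / \<partial>u \<partial>(cnj v)\<close> at \<open>(0,0)\<close> exists and equals \<open>D\<close>.\<close>

definition has_mixed_wirtinger_derivative :: "(complex \<times> complex \<Rightarrow> complex) \<Rightarrow> complex \<Rightarrow> bool" where
  "has_mixed_wirtinger_derivative E D \<longleftrightarrow>
     (\<forall>\<^sub>F u in nhds 0. (\<lambda>v. E (u, v)) differentiable (at 0)) \<and>
     (\<lambda>u. pd_zbar (\<lambda>v. E (u, v)) 0) differentiable (at 0) \<and>
     pd_z (\<lambda>u. pd_zbar (\<lambda>v. E (u, v)) 0) 0 = D"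

text \<open>A real analytic function of two complex variables: locally a convergent power series in
  the variables and their conjugates, i.e. in the four real coordinates.\<close>

definition real_analytic_at :: "(complex \<times> complex \<Rightarrow> complex) \<Rightarrow> complex \<times> complex \<Rightarrow> bool" where
  "real_analytic_at f s0 \<longleftrightarrow>
     (\<exists>r>0. \<exists>a :: nat \<times> nat \<times> nat \<times> nat \<Rightarrow> complex. \<forall>s\<in>ball s0 r.
        ((\<lambda>(i, j, k, l). a (i, j, k, l) *
            (fst s - fst s0) ^ i * cnj (fst s - fst s0) ^ j *
            (snd s - snd s0) ^ k * cnj (snd s - snd s0) ^ l) has_sum f s) UNIV)"


section \<open>Closed oriented smooth surfaces\<close>

text \<open>The surface is the whole type \<open>'a\<close>. A chart is an open domain with a coordinate function,
  whose values outside the domain are irrelevant.\<close>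

type_synonym 'a chart = "'a set \<times> ('a \<Rightarrow> complex)"

definition is_chart :: "'a::topological_space chart \<Rightarrow> bool" where
  "is_chart c \<longleftrightarrow> open (fst c) \<and> open (snd c ` fst c) \<and>
     (\<exists>h. homeomorphism (fst c) (snd c ` fst c) (snd c) h)"

definition chart_inv :: "'a chart \<Rightarrow> complex \<Rightarrow> 'a" where
  "chart_inv c = inv_into (fst c) (snd c)"

definition transition :: "'a chart \<Rightarrow> 'a chart \<Rightarrow> complex \<Rightarrow> complex" where
  "transition c d = snd d \<circ> chart_inv c"

definition oriented_compatible :: "'a chart \<Rightarrow> 'a chart \<Rightarrow> bool" where
  "oriented_compatible c d \<longleftrightarrow>
     smooth_on (snd c ` (fst c \<inter> fst d)) (transition c d) \<and>
     (\<forall>z\<in>snd c ` (fst c \<inter> fst d). jacobian (transition c d) z > 0)"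

definition oriented_atlas :: "'a::topological_space chart set \<Rightarrow> bool" where
  "oriented_atlas \<A> \<longleftrightarrow> (\<forall>c\<in>\<A>. is_chart c) \<and> (\<Union>c\<in>\<A>. fst c) = UNIV \<and>
     (\<forall>c\<in>\<A>. \<forall>d\<in>\<A>. oriented_compatible c d)"

text \<open>The maximal oriented smooth atlas containing \<open>\<A>\<close>.\<close>

definition oriented_charts :: "'a::topological_space chart set \<Rightarrow> 'a chart set" where
  "oriented_charts \<A> =
     {c. is_chart c \<and> (\<forall>d\<in>\<A>. oriented_compatible c d \<and> oriented_compatible d c)}"

text \<open>Compact, connected, oriented, without boundary; genus \<open>g\<close> means that \<open>H\<^sub>1\<close> is free abelian
  of rank \<open>2 g\<close>.\<close>

definition closed_oriented_surface :: "'a::t2_space chart set \<Rightarrow> nat \<Rightarrow> bool" where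
  "closed_oriented_surface \<A> g \<longleftrightarrow>
     compact (UNIV :: 'a set) \<and> connected (UNIV :: 'a set) \<and> oriented_atlas \<A> \<and>
     homology_group 1 (euclidean :: 'a topology) \<cong> free_Abelian_group {..<2 * g}"

text \<open>A family of self-maps of the surface, jointly smooth in the parameter and the point.\<close>

definition smooth_family ::
    "'a::topological_space chart set \<Rightarrow> 'p::real_normed_vector set \<Rightarrow> ('p \<Rightarrow> 'a \<Rightarrow> 'a) \<Rightarrow> bool" where
  "smooth_family \<A> P F \<longleftrightarrow>
     continuous_on (P \<times> UNIV) (\<lambda>(s, p). F s p) \<and>
     (\<forall>c\<in>\<A>. \<forall>d\<in>\<A>.
        smooth_on {(s, z). s \<in> P \<and> z \<in> snd c ` fst c \<and> F s (chart_inv c z) \<in> fst d}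
          (\<lambda>(s, z). snd d (F s (chart_inv c z))))"

definition smooth_map :: "'a::topological_space chart set \<Rightarrow> ('a \<Rightarrow> 'a) \<Rightarrow> bool" where
  "smooth_map \<A> w \<longleftrightarrow> continuous_on UNIV w \<and>
     (\<forall>c\<in>\<A>. \<forall>d\<in>\<A>. smooth_on {z \<in> snd c ` fst c. w (chart_inv c z) \<in> fst d}
        (snd d \<circ> w \<circ> chart_inv c))"


section \<open>Loops and symplectic homology bases\<close>

text \<open>Smooth loops are 1-periodic smooth maps \<open>\<gamma>\<close> on the line.\<close>

definition smooth_loop :: "'a::topological_space chart set \<Rightarrow> (real \<Rightarrow> 'a) \<Rightarrow> bool" where
  "smooth_loop \<A> \<gamma> \<longleftrightarrow> (\<forall>t. \<gamma> (t + 1) = \<gamma> t) \<and> continuous_on UNIV \<gamma> \<and>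
     (\<forall>c\<in>\<A>. smooth_on {t. \<gamma> t \<in> fst c} (snd c \<circ> \<gamma>))"

definition chart_at :: "'a chart set \<Rightarrow> 'a \<Rightarrow> 'a chart" where
  "chart_at C p = (SOME c. c \<in> C \<and> p \<in> fst c)"

definition crossings :: "(real \<Rightarrow> 'a) \<Rightarrow> (real \<Rightarrow> 'a) \<Rightarrow> (real \<times> real) set" where
  "crossings \<alpha> \<beta> = {(s, t). s \<in> {0..<1} \<and> t \<in> {0..<1} \<and> \<alpha> s = \<beta> t}"

text \<open>Determinant of the two velocities at a crossing, in an oriented chart.\<close>

definition crossing_det ::
    "'a chart set \<Rightarrow> (real \<Rightarrow> 'a) \<Rightarrow> (real \<Rightarrow> 'a) \<Rightarrow> real \<times> real \<Rightarrow> real" where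
  "crossing_det \<A> \<alpha> \<beta> = (\<lambda>(s, t). let z = snd (chart_at \<A> (\<alpha> s)) in
     Im (cnj (vector_derivative (z \<circ> \<alpha>) (at s)) * vector_derivative (z \<circ> \<beta>) (at t)))"

definition transverse_loops :: "'a chart set \<Rightarrow> (real \<Rightarrow> 'a) \<Rightarrow> (real \<Rightarrow> 'a) \<Rightarrow> bool" where
  "transverse_loops \<A> \<alpha> \<beta> \<longleftrightarrow>
     finite (crossings \<alpha> \<beta>) \<and> (\<forall>x\<in>crossings \<alpha> \<beta>. crossing_det \<A> \<alpha> \<beta> x \<noteq> 0)"

definition intersection_number :: "'a chart set \<Rightarrow> (real \<Rightarrow> 'a) \<Rightarrow> (real \<Rightarrow> 'a) \<Rightarrow> real" where
  "intersection_number \<A> \<alpha> \<beta> = (\<Sum>x\<in>crossings \<alpha> \<beta>. sgn (crossing_det \<A> \<alpha> \<beta> x))"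

definition loop_chain :: "(real \<Rightarrow> 'a) \<Rightarrow> 'a chain" where
  "loop_chain \<gamma> = frag_of (restrict (\<lambda>x. \<gamma> (x 1)) (standard_simplex 1))"

definition homology_basis :: "nat \<Rightarrow> (nat \<Rightarrow> real \<Rightarrow> 'a::topological_space) \<Rightarrow> (nat \<Rightarrow> real \<Rightarrow> 'a) \<Rightarrow> bool" where
  "homology_basis g A B \<longleftrightarrow>
     (\<forall>c. singular_relcycle 1 (euclidean :: 'a topology) {} c \<longrightarrow>
        (\<exists>m n. homologous_rel 1 euclidean {} c
           (\<Sum>i<g. frag_cmul (m i) (loop_chain (A i)) + frag_cmul (n i) (loop_chain (B i))))) \<and>
     (\<forall>m n. homologous_rel 1 (euclidean :: 'a topology) {}
           (\<Sum>i<g. frag_cmul (m i) (loop_chain (A i)) + frag_cmul (n i) (loop_chain (B i))) 0 \<longrightarrow>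
        (\<forall>i<g. m i = 0 \<and> n i = 0))"

text \<open>Distinct basis loops are required to be transverse; the self-intersection numbers vanish by
  antisymmetry and need no condition.\<close>

definition symplectic_homology_basis ::
    "'a::topological_space chart set \<Rightarrow> nat \<Rightarrow> (nat \<Rightarrow> real \<Rightarrow> 'a) \<Rightarrow> (nat \<Rightarrow> real \<Rightarrow> 'a) \<Rightarrow> bool" where
  "symplectic_homology_basis \<A> g A B \<longleftrightarrow>
     (\<forall>i<g. smooth_loop \<A> (A i) \<and> smooth_loop \<A> (B i)) \<and>
     homology_basis g A B \<and>
     (\<forall>i<g. \<forall>j<g. transverse_loops \<A> (A i) (B j) \<and>
        intersection_number \<A> (A i) (B j) = (if i = j then 1 else 0)) \<and>
     (\<forall>i<g. \<forall>j<g. i \<noteq> j \<longrightarrow>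
        transverse_loops \<A> (A i) (A j) \<and> intersection_number \<A> (A i) (A j) = 0 \<and>
        transverse_loops \<A> (B i) (B j) \<and> intersection_number \<A> (B i) (B j) = 0)"


section \<open>Conformal structures and holomorphic one-forms\<close>

definition conformal_structure :: "'a::topological_space chart set \<Rightarrow> 'a chart set \<Rightarrow> bool" where
  "conformal_structure \<A> C \<longleftrightarrow> C \<subseteq> oriented_charts \<A> \<and> (\<Union>c\<in>C. fst c) = UNIV \<and>
     (\<forall>c\<in>C. \<forall>d\<in>C. transition c d holomorphic_on snd c ` (fst c \<inter> fst d))"

text \<open>A one-form is given by its coefficient in each chart: \<open>\<omega> c p\<close> is the coefficient of \<open>dz\<close>
  at \<open>p\<close>, where \<open>z = snd c\<close>.\<close>

definition holomorphic_one_form :: "'a chart set \<Rightarrow> ('a chart \<Rightarrow> 'a \<Rightarrow> complex) \<Rightarrow> bool" where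
  "holomorphic_one_form C \<omega> \<longleftrightarrow>
     (\<forall>c\<in>C. (\<omega> c \<circ> chart_inv c) holomorphic_on snd c ` fst c) \<and>
     (\<forall>c\<in>C. \<forall>d\<in>C. \<forall>p\<in>fst c \<inter> fst d. \<omega> c p = \<omega> d p * deriv (transition c d) (snd c p))"

definition one_form_basis ::
    "'a chart set \<Rightarrow> nat \<Rightarrow> (nat \<Rightarrow> 'a chart \<Rightarrow> 'a \<Rightarrow> complex) \<Rightarrow> bool" where
  "one_form_basis C g \<omega> \<longleftrightarrow>
     (\<forall>i<g. holomorphic_one_form C (\<omega> i)) \<and>
     (\<forall>\<eta>. holomorphic_one_form C \<eta> \<longrightarrow>
        (\<exists>a. \<forall>c\<in>C. \<forall>p\<in>fst c. \<eta> c p = (\<Sum>i<g. a i * \<omega> i c p))) \<and>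
     (\<forall>a. (\<forall>c\<in>C. \<forall>p\<in>fst c. (\<Sum>i<g. a i * \<omega> i c p) = 0) \<longrightarrow> (\<forall>i<g. a i = 0))"

definition period :: "'a chart set \<Rightarrow> (real \<Rightarrow> 'a) \<Rightarrow> ('a chart \<Rightarrow> 'a \<Rightarrow> complex) \<Rightarrow> complex" where
  "period C \<gamma> \<omega> = integral {0..1}
     (\<lambda>t. let c = chart_at C (\<gamma> t) in \<omega> c (\<gamma> t) * vector_derivative (snd c \<circ> \<gamma>) (at t))"


section \<open>Riemannian metrics and canonical metrics\<close>

text \<open>\<open>\<rho> c p v w\<close> is the inner product at \<open>p\<close> of the tangent vectors whose coordinates in the chart
  \<open>c\<close> are \<open>v\<close> and \<open>w\<close>.\<close>

type_synonym 'a metric = "'a chart \<Rightarrow> 'a \<Rightarrow> complex \<Rightarrow> complex \<Rightarrow> real"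

definition riemannian_metric :: "'a::topological_space chart set \<Rightarrow> 'a metric \<Rightarrow> bool" where
  "riemannian_metric \<A> \<rho> \<longleftrightarrow>
     (\<forall>c\<in>oriented_charts \<A>.
        (\<forall>p\<in>fst c. bilinear (\<rho> c p) \<and> (\<forall>v w. \<rho> c p v w = \<rho> c p w v) \<and>
           (\<forall>v. v \<noteq> 0 \<longrightarrow> \<rho> c p v v > 0)) \<and>
        (\<forall>v w. smooth_on (snd c ` fst c) (\<lambda>z. \<rho> c (chart_inv c z) v w))) \<and>
     (\<forall>c\<in>oriented_charts \<A>. \<forall>d\<in>oriented_charts \<A>. \<forall>p\<in>fst c \<inter> fst d. \<forall>v w.
        \<rho> c p v w = \<rho> d p (frechet_derivative (transition c d) (at (snd c p)) v)
                          (frechet_derivative (transition c d) (at (snd c p)) w))"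

definition smooth_metric_family ::
    "'a::topological_space chart set \<Rightarrow> 'p::real_normed_vector set \<Rightarrow> ('p \<Rightarrow> 'a metric) \<Rightarrow> bool" where
  "smooth_metric_family \<A> P \<sigma> \<longleftrightarrow>
     (\<forall>c\<in>\<A>. \<forall>v w. smooth_on (P \<times> snd c ` fst c) (\<lambda>(s, z). \<sigma> s c (chart_inv c z) v w))"

text \<open>Charts in which \<open>\<rho> = f |dz|\<^sup>2\<close>, and the factor \<open>f\<close>, also denoted \<open>\<rho>(z)\<close> below.\<close>

definition conformal_charts :: "'a::topological_space chart set \<Rightarrow> 'a metric \<Rightarrow> 'a chart set" where
  "conformal_charts \<A> \<rho> =
     {c \<in> oriented_charts \<A>. \<forall>p\<in>fst c. \<exists>f. \<forall>v w. \<rho> c p v w = f * (v \<bullet> w)}"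

definition conformal_factor :: "'a metric \<Rightarrow> 'a chart \<Rightarrow> 'a \<Rightarrow> real" where
  "conformal_factor \<rho> c p = \<rho> c p 1 1"

text \<open>\<open>\<rho>\<close> is the canonical metric of the conformal structure \<open>C\<close>; \<open>Y\<close> is the inverse of the imaginary
  part of the period matrix. The form \<open>(\<i>/2) \<Sum> Y\<^sub>i\<^sub>j \<omega>\<^sub>i \<and> cnj \<omega>\<^sub>j\<close> equals
  \<open>(\<Sum> Y\<^sub>i\<^sub>j \<omega>\<^sub>i cnj \<omega>\<^sub>j) dx dy\<close>, the area form of the metric with that conformal factor.\<close>

definition canonical_metric_of ::
    "'a::topological_space chart set \<Rightarrow> nat \<Rightarrow> 'a chart set \<Rightarrow> 'a metric \<Rightarrow> bool" where
  "canonical_metric_of \<A> g C \<rho> \<longleftrightarrow>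
     (\<exists>A B \<omega> \<Omega> Y.
        symplectic_homology_basis \<A> g A B \<and>
        one_form_basis C g \<omega> \<and>
        (\<forall>i<g. \<forall>j<g. period C (A i) (\<omega> j) = (if i = j then 1 else 0)) \<and>
        (\<forall>i<g. \<forall>j<g. period C (B i) (\<omega> j) = \<Omega> i j) \<and>
        (\<forall>i<g. \<forall>k<g. (\<Sum>j<g. Im (\<Omega> i j) * Y j k) = (if i = k then 1 else (0::real))) \<and>
        (\<forall>c\<in>C. \<forall>p\<in>fst c. \<forall>v w.
           complex_of_real (\<rho> c p v w) =
             (\<Sum>i<g. \<Sum>j<g. of_real (Y i j) * \<omega> i c p * cnj (\<omega> j c p)) * of_real (v \<bullet> w)))"

definition canonical_metric :: "'a::topological_space chart set \<Rightarrow> nat \<Rightarrow> 'a metric \<Rightarrow> bool" where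
  "canonical_metric \<A> g \<rho> \<longleftrightarrow> riemannian_metric \<A> \<rho> \<and>
     (\<exists>C. conformal_structure \<A> C \<and> canonical_metric_of \<A> g C \<rho>)"

text \<open>The measure given by \<open>f dx dy\<close>, with \<open>f\<close> the conformal factor, in every conformal chart.\<close>

definition area_measure :: "'a::topological_space chart set \<Rightarrow> 'a metric \<Rightarrow> 'a measure" where
  "area_measure \<A> \<rho> = (THE \<mu>. sets \<mu> = sets borel \<and>
     (\<forall>c\<in>conformal_charts \<A> \<rho>. \<forall>S\<in>sets borel. S \<subseteq> fst c \<longrightarrow>
        emeasure \<mu> S =
          (\<integral>\<^sup>+z\<in>snd c ` S. ennreal (conformal_factor \<rho> c (chart_inv c z)) \<partial>lborel)))"


section \<open>Energy, harmonic maps and Hopf differentials\<close>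

definition local_rep :: "('a \<Rightarrow> 'a) \<Rightarrow> 'a chart \<Rightarrow> 'a chart \<Rightarrow> complex \<Rightarrow> complex" where
  "local_rep w c d = snd d \<circ> w \<circ> chart_inv c"

text \<open>The densities \<open>\<rho>(w(z))/\<sigma>(z) |w\<^sub>z|\<^sup>2\<close> and \<open>\<rho>(w(z))/\<sigma>(z) |\<partial>w / \<partial>(cnj z)|\<^sup>2\<close>
  do not depend on the chosen conformal charts of \<open>\<sigma>\<close> and \<open>\<rho>\<close>.\<close>

definition H_density ::
    "'a::topological_space chart set \<Rightarrow> 'a metric \<Rightarrow> 'a metric \<Rightarrow> ('a \<Rightarrow> 'a) \<Rightarrow> 'a \<Rightarrow> real" where
  "H_density \<A> \<sigma> \<rho> w p =
     (let c = chart_at (conformal_charts \<A> \<sigma>) p; d = chart_at (conformal_charts \<A> \<rho>) (w p) in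
      conformal_factor \<rho> d (w p) / conformal_factor \<sigma> c p * (cmod (pd_z (local_rep w c d) (snd c p)))\<^sup>2)"

definition L_density ::
    "'a::topological_space chart set \<Rightarrow> 'a metric \<Rightarrow> 'a metric \<Rightarrow> ('a \<Rightarrow> 'a) \<Rightarrow> 'a \<Rightarrow> real" where
  "L_density \<A> \<sigma> \<rho> w p =
     (let c = chart_at (conformal_charts \<A> \<sigma>) p; d = chart_at (conformal_charts \<A> \<rho>) (w p) in
      conformal_factor \<rho> d (w p) / conformal_factor \<sigma> c p * (cmod (pd_zbar (local_rep w c d) (snd c p)))\<^sup>2)"

definition energy ::
    "'a::topological_space chart set \<Rightarrow> 'a metric \<Rightarrow> 'a metric \<Rightarrow> ('a \<Rightarrow> 'a) \<Rightarrow> real" where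
  "energy \<A> \<sigma> \<rho> w =
     (LINT p|area_measure \<A> \<sigma>. H_density \<A> \<sigma> \<rho> w p + L_density \<A> \<sigma> \<rho> w p)"

definition harmonic_map ::
    "'a::topological_space chart set \<Rightarrow> 'a metric \<Rightarrow> 'a metric \<Rightarrow> ('a \<Rightarrow> 'a) \<Rightarrow> bool" where
  "harmonic_map \<A> \<sigma> \<rho> w \<longleftrightarrow> smooth_map \<A> w \<and>
     (\<forall>\<delta>>0. \<forall>W :: real \<Rightarrow> 'a \<Rightarrow> 'a. smooth_family \<A> {-\<delta><..<\<delta>} W \<and> W 0 = w \<longrightarrow>
        ((\<lambda>t. energy \<A> \<sigma> \<rho> (W t)) has_real_derivative 0) (at 0))"

text \<open>The quadratic differential \<open>\<phi> dz\<^sup>2\<close>, \<open>\<phi> = \<rho>(w(z)) w\<^sub>z \<partial>\<^sub>z(cnj w)\<close>, with \<open>z\<close> a conformal coordinate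
  for \<open>\<sigma>\<close>, evaluated at \<open>p\<close> on the tangent vector with coordinates \<open>v\<close> in the chart \<open>e\<close>. This makes
  the Hopf differentials of maps from different conformal structures comparable: they are
  tensors on the one smooth surface.\<close>

definition hopf_coeff ::
    "'a metric \<Rightarrow> ('a \<Rightarrow> 'a) \<Rightarrow> 'a chart \<Rightarrow> 'a chart \<Rightarrow> 'a \<Rightarrow> complex" where
  "hopf_coeff \<rho> w c d p = of_real (conformal_factor \<rho> d (w p)) *
     pd_z (local_rep w c d) (snd c p) * pd_z (\<lambda>z. cnj (local_rep w c d z)) (snd c p)"

definition hopf_differential ::
    "'a::topological_space chart set \<Rightarrow> 'a metric \<Rightarrow> 'a metric \<Rightarrow> ('a \<Rightarrow> 'a) \<Rightarrow>
       'a chart \<Rightarrow> 'a \<Rightarrow> complex \<Rightarrow> complex" where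
  "hopf_differential \<A> \<sigma> \<rho> w e p v =
     (let c = chart_at (conformal_charts \<A> \<sigma>) p; d = chart_at (conformal_charts \<A> \<rho>) (w p) in
      hopf_coeff \<rho> w c d p * (frechet_derivative (transition e c) (at (snd e p)) v)\<^sup>2)"

text \<open>\<open>\<psi> dz\<^sup>2\<close>, with \<open>z\<close> ranging over the conformal coordinates of \<open>\<rho>\<close>, is the derivative at \<open>0\<close> of a
  family \<open>Q\<close> of quadratic differentials with respect to its complex parameter \<open>t\<close>. The derivative
  is a complex one: if \<open>Q\<close> also had a nonzero derivative with respect to \<open>cnj t\<close>, the mixed
  derivative of the energy would contain a further term, quadratic in the
  derivatives with respect to the conjugate parameters.\<close>

definition infinitesimal_differential ::
    "'a::topological_space chart set \<Rightarrow> 'a metric \<Rightarrow> (complex \<Rightarrow> 'a chart \<Rightarrow> 'a \<Rightarrow> complex \<Rightarrow> complex) \<Rightarrow>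
       ('a chart \<Rightarrow> 'a \<Rightarrow> complex) \<Rightarrow> bool" where
  "infinitesimal_differential \<A> \<rho> Q \<psi> \<longleftrightarrow>
     (\<forall>e\<in>conformal_charts \<A> \<rho>. \<forall>p\<in>fst e. \<forall>v.
        ((\<lambda>t. Q t e p v) has_field_derivative \<psi> e p * v\<^sup>2) (at 0))"

text \<open>\<open>\<integral> \<phi> cnj \<psi> / \<rho> dx dy\<close>, with \<open>dx dy\<close> written as area measure over \<open>\<rho>\<close>.\<close>

definition bergman_inner ::
    "'a::topological_space chart set \<Rightarrow> 'a metric \<Rightarrow>
       ('a chart \<Rightarrow> 'a \<Rightarrow> complex) \<Rightarrow> ('a chart \<Rightarrow> 'a \<Rightarrow> complex) \<Rightarrow> complex" where
  "bergman_inner \<A> \<rho> \<phi> \<psi> =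
     (LINT p|area_measure \<A> \<rho>. (let c = chart_at (conformal_charts \<A> \<rho>) p in
        \<phi> c p * cnj (\<psi> c p) / of_real (conformal_factor \<rho> c p) ^ 2))"

text \<open>Real analyticity in \<open>s\<close> at each point is tested in conformal charts of the target, since the
  smooth atlas does not carry a real analytic structure.\<close>

definition real_analytic_family ::
    "'a::topological_space chart set \<Rightarrow> 'a metric \<Rightarrow> (complex \<times> complex) set \<Rightarrow>
       (complex \<times> complex \<Rightarrow> 'a \<Rightarrow> 'a) \<Rightarrow> bool" where
  "real_analytic_family \<A> \<rho> P w \<longleftrightarrow> smooth_family \<A> P w \<and>
     (\<forall>s\<in>P. \<forall>p. \<forall>d\<in>conformal_charts \<A> \<rho>. w s p \<in> fst d \<longrightarrow>
        real_analytic_at (\<lambda>s'. snd d (w s' p)) s)"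

end

theory Submission
  imports Defs
begin

text \<open>The energy is \<open>E(s) = \<integral> (H - L) + 2 \<integral> L\<close>. The density \<open>H - L\<close> is the Jacobian of
  \<open>w(s)\<close>; for small \<open>s\<close> the map is \<open>C\<^sup>1\<close>-close to the identity, hence a diffeomorphism, and the first
  integral is the constant area of \<open>\<rho>\<close>. Since \<open>H L \<sigma>\<^sup>2 = \<bar>\<phi>\<bar>\<^sup>2\<close> pointwise, the density of the second
  integral with respect to the area of \<open>\<rho>\<close> is \<open>\<bar>\<phi>(s)\<bar>\<^sup>2 K(s)\<close> with \<open>\<phi>(0) = 0\<close> and \<open>K(0) = 1 / \<rho>\<^sup>2\<close>, so only
  the first derivatives of \<open>\<phi>\<close> enter its second derivative at \<open>0\<close>, which is taken under the integral.
  In charts that do not depend on \<open>s\<close>, the quantities \<open>E\<close>, \<open>L\<close> and \<open>\<phi>\<close> are algebraic in the coefficients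
  of \<open>\<sigma>(s)\<close> and of the pullback of \<open>\<rho>\<close>, hence smooth in \<open>s\<close>.\<close>

section \<open>Change of variables in the complex plane\<close>

text \<open>The energy densities and the Hopf differential are defined in conformal charts picked
  pointwise for each \<open>s\<close>, and nothing is known about how this choice varies with
  \<open>s\<close>, so no derivative can be taken there. The way out is linear algebra: half the
  trace and the (2,0)-part of the pulled back metric with respect to the domain metric have closed
  formulas in every oriented chart, so the charts of \<open>\<A>\<close> serve for all
  \<open>s\<close> at once. In the same way the area measure, characterised only by conformal charts
  of its own metric, is rebuilt from the Gram density in arbitrary charts; all integrals are then
  taken against the one area measure of \<open>\<rho>\<close>, and the parameter enters the
  integrand alone. Compactness turns radii that depend on a point into one common radius. The
  constant: at \<open>s = (x, y)\<close> the integrand of the second integral is \<open>\<bar>x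
  \<phi>\<^sub>a + y \<phi>\<^sub>b\<bar>\<^sup>2 / \<rho>\<^sup>2\<close> to second order, because
  the Hopf differentials are complex differentiable in each parameter. Its coefficient of
  \<open>x * cnj y\<close> is \<open>\<phi>\<^sub>a * cnj \<phi>\<^sub>b / \<rho>\<^sup>2\<close>,
  so the final 2 is the factor in front of that integral.\<close>

definition vec_complex :: "complex \<Rightarrow> real^2" where
  "vec_complex z = vector [Re z, Im z]"

definition complex_vec :: "real^2 \<Rightarrow> complex" where
  "complex_vec x = Complex (x $ 1) (x $ 2)"

lemma complex_vec_inverse [simp]: "vec_complex (complex_vec x) = x" "complex_vec (vec_complex z) = z"
  by (auto simp: vec_complex_def complex_vec_def vec_eq_iff forall_2 complex_eq_iff)

lemma vec_complex_image: "vec_complex ` T = complex_vec -` T"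
  by (auto simp: image_iff) (metis complex_vec_inverse(1))

lemma bounded_linear_vec_complex: "bounded_linear vec_complex"
  by (rule linear_conv_bounded_linear[THEN iffD1])
     (auto intro!: linearI simp: vec_complex_def vec_eq_iff forall_2)

lemma bounded_linear_complex_vec: "bounded_linear complex_vec"
  by (rule linear_conv_bounded_linear[THEN iffD1])
     (auto intro!: linearI simp: complex_vec_def complex_eq_iff)

lemma borel_measurable_complex_vec [measurable]: "complex_vec \<in> borel_measurable borel"
  by (intro borel_measurable_continuous_onI linear_continuous_on bounded_linear_complex_vec)

text \<open>Boxes pull back to boxes with the same side lengths, and \<open>lborel\<close> is
  determined by its values on boxes.\<close>

lemma distr_complex_vec: "distr lborel borel complex_vec = lborel"
proof (rule lborel_eqI[symmetric])
  fix l u :: complex assume le: "\<And>b. b \<in> Basis \<Longrightarrow> l \<bullet> b \<le> u \<bullet> b"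
  have B: "Basis = {axis 1 1, axis 2 1 :: real^2}"
    using exhaust_2 by (auto simp: Basis_vec_def) metis+
  have ne: "axis 1 1 \<noteq> (axis 2 1 :: real^2)"
    by (auto simp: axis_eq_axis)
  have "complex_vec -` box l u = box (vec_complex l) (vec_complex u)"
    by (auto simp: box_def B complex_vec_def vec_complex_def Basis_complex_def inner_axis)
  then have "emeasure (distr lborel borel complex_vec) (box l u)
      = emeasure lborel (box (vec_complex l) (vec_complex u))"
    by (subst emeasure_distr) auto
  also have "\<dots> = (\<Prod>b\<in>Basis. (vec_complex u - vec_complex l) \<bullet> b)"
    using le[of 1] le[of \<i>] by (intro emeasure_lborel_box) (auto simp: B vec_complex_def inner_axis)
  also have "(\<Prod>b\<in>Basis. (vec_complex u - vec_complex l) \<bullet> b) = (\<Prod>b\<in>Basis. (u - l) \<bullet> b)"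
    using ne by (simp add: B vec_complex_def inner_axis Basis_complex_def complex_eq_iff)
  finally show "emeasure (distr lborel borel complex_vec) (box l u) = (\<Prod>b\<in>Basis. (u - l) \<bullet> b)" .
qed simp

lemma emeasure_lborel_complex_vec:
  assumes "T \<in> sets borel"
  shows "emeasure lborel T = emeasure lborel (vec_complex ` T)"
proof -
  show ?thesis
    unfolding vec_complex_image by (subst distr_complex_vec[symmetric]) (simp add: emeasure_distr assms)
qed

lemma nn_integral_lborel_complex_vec:
  assumes [measurable]: "f \<in> borel_measurable borel"
  shows "(\<integral>\<^sup>+z. f z \<partial>lborel) = (\<integral>\<^sup>+x. f (complex_vec x) \<partial>lborel)"
  by (subst distr_complex_vec[symmetric]) (simp add: nn_integral_distr)

text \<open>The change of variables theorem speaks of determinants of matrices, hence the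
  conjugation with \<open>vec_complex\<close>. The weight \<open>j\<close> is a separate function
  that agrees with the Jacobian on \<open>S\<close> only, so measurability is asked of
  \<open>j\<close> and not of \<open>\<tau>'\<close>.\<close>

lemma emeasure_image_complex:
  fixes \<tau> :: "complex \<Rightarrow> complex"
  assumes S: "S \<in> sets borel" and TS: "\<tau> ` S \<in> sets borel" and inj: "inj_on \<tau> S"
    and der: "\<And>z. z \<in> S \<Longrightarrow> (\<tau> has_derivative \<tau>' z) (at z)"
    and pos: "\<And>z. z \<in> S \<Longrightarrow> j z = Im (cnj (\<tau>' z 1) * \<tau>' z \<i>)" "\<And>z. z \<in> S \<Longrightarrow> 0 \<le> j z"
    and j: "(\<lambda>z. indicator S z * j z) \<in> borel_measurable borel"
  shows "emeasure lborel (\<tau> ` S) = (\<integral>\<^sup>+z\<in>S. ennreal (j z) \<partial>lborel)"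
proof -
  define S' where "S' = vec_complex ` S"
  define f where "f = vec_complex \<circ> \<tau> \<circ> complex_vec"
  define f' where "f' x = vec_complex \<circ> \<tau>' (complex_vec x) \<circ> complex_vec" for x
  have S'_eq: "S' = complex_vec -` S"
    by (simp add: S'_def vec_complex_image)
  have S': "S' \<in> sets borel"
    unfolding S'_eq using measurable_sets[OF borel_measurable_complex_vec S] by simp
  have fS: "f ` S' = vec_complex ` \<tau> ` S"
    by (auto simp: f_def S'_def image_comp)
  have der': "(f has_derivative f' x) (at x within S')" if "x \<in> S'" for x
  proof -
    have "(\<tau> has_derivative \<tau>' (complex_vec x)) (at (complex_vec x))"
      using that der by (auto simp: S'_def)
    from diff_chain_at[OF bounded_linear_imp_has_derivative[OF bounded_linear_complex_vec] this]
    have "(\<tau> \<circ> complex_vec has_derivative \<tau>' (complex_vec x) \<circ> complex_vec) (at x)" .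
    from diff_chain_at[OF this bounded_linear_imp_has_derivative[OF bounded_linear_vec_complex]]
    show ?thesis
      by (auto simp: f_def f'_def comp_assoc intro: has_derivative_at_withinI)
  qed
  have inj': "inj_on f S'"
    using inj by (auto simp: inj_on_def f_def S'_def) (metis complex_vec_inverse(2))
  have ax: "complex_vec (axis 1 1) = 1" "complex_vec (axis 2 1) = \<i>"
    by (auto simp: complex_vec_def complex_eq_iff axis_def)
  have det: "\<bar>det (matrix (f' x))\<bar> = j (complex_vec x)" if "x \<in> S'" for x
  proof -
    have "complex_vec x \<in> S" using that by (simp add: S'_eq)
    moreover from this have "det (matrix (f' x)) = j (complex_vec x)"
      using pos(1)[of "complex_vec x"] by (simp add: det_2 matrix_def f'_def ax vec_complex_def)
    ultimately show ?thesis using pos(2) by simp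
  qed
  \<comment> \<open>This equivalence holds for every finite \<open>m\<close>. Read in both
    directions, it also settles the infinite case: a finite integral would make the image
    \<open>lmeasurable\<close>.\<close>
  have eq: "f ` S' \<in> lmeasurable \<and> measure lebesgue (f ` S') = m
     \<longleftrightarrow> ((\<lambda>x. j (complex_vec x)) has_integral m) S'" for m
    using has_measure_differentiable_image[OF _ der' inj', of m] S' det
    by (simp cong: has_integral_cong)
  have m: "(\<lambda>x. indicator S' x * j (complex_vec x)) \<in> borel_measurable borel"
    using measurable_compose[OF borel_measurable_complex_vec j]
    by (auto simp: S'_eq indicator_def cong: if_cong)
  have mfS: "f ` S' \<in> sets borel"
  proof -
    have "f ` S' = complex_vec -` (\<tau> ` S)" unfolding fS by (rule vec_complex_image)
    then show ?thesis using measurable_sets[OF borel_measurable_complex_vec TS] by simp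
  qed
  have nn: "0 \<le> indicator S' x * j (complex_vec x)" for x
    using pos(2)[of "complex_vec x"] by (auto simp: indicator_def S'_def)
  have hi: "((\<lambda>x. j (complex_vec x)) has_integral m) S' \<longleftrightarrow>
      ((\<lambda>x. indicator S' x * j (complex_vec x)) has_integral m) UNIV" for m
  proof -
    have "(\<lambda>x. indicator S' x * j (complex_vec x)) = (\<lambda>x. if x \<in> S' then j (complex_vec x) else 0)"
      by (auto simp: fun_eq_iff)
    then show ?thesis by (simp only: has_integral_restrict_UNIV)
  qed
  have "emeasure lborel (f ` S') = (\<integral>\<^sup>+x. ennreal (indicator S' x * j (complex_vec x)) \<partial>lborel)"
  proof (cases "f ` S' \<in> lmeasurable")
    case True
    with eq hi have "((\<lambda>x. indicator S' x * j (complex_vec x)) has_integral measure lebesgue (f ` S')) UNIV"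
      by blast
    then have "(\<integral>\<^sup>+x. ennreal (indicator S' x * j (complex_vec x)) \<partial>lborel) = ennreal (measure lebesgue (f ` S'))"
      using m nn by (intro nn_integral_has_integral_lborel) auto
    moreover have "emeasure lborel (f ` S') = emeasure lebesgue (f ` S')" using mfS by simp
    moreover have "emeasure lebesgue (f ` S') = ennreal (measure lebesgue (f ` S'))"
      using True by (rule emeasure_eq_measure2)
    ultimately show ?thesis by simp
  next
    case False
    have "(\<integral>\<^sup>+x. ennreal (indicator S' x * j (complex_vec x)) \<partial>lborel) = \<infinity>"
    proof (rule ccontr)
      assume "\<not> ?thesis"
      then obtain r where r: "(\<integral>\<^sup>+x. ennreal (indicator S' x * j (complex_vec x)) \<partial>lborel) = ennreal r" "0 \<le> r"
        by (cases "\<integral>\<^sup>+x. ennreal (indicator S' x * j (complex_vec x)) \<partial>lborel") auto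
      then have "((\<lambda>x. indicator S' x * j (complex_vec x)) has_integral r) UNIV"
        using m nn by (intro nn_integral_has_integral) auto
      with eq hi False show False by blast
    qed
    moreover have "emeasure lborel (f ` S') = \<infinity>"
    proof -
      have "f ` S' \<in> sets lebesgue" using mfS by simp
      with False have "emeasure lebesgue (f ` S') = \<infinity>"
        using fmeasurableI[of "f ` S'" lebesgue] less_top by fastforce
      then show ?thesis using mfS by simp
    qed
    ultimately show ?thesis by simp
  qed
  also have "emeasure lborel (f ` S') = emeasure lborel (\<tau> ` S)"
    unfolding fS by (rule emeasure_lborel_complex_vec[symmetric, OF TS])
  also have "(\<integral>\<^sup>+x. ennreal (indicator S' x * j (complex_vec x)) \<partial>lborel) =
      (\<integral>\<^sup>+z. ennreal (indicator S z * j z) \<partial>lborel)"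
    by (subst nn_integral_lborel_complex_vec) (use j in \<open>auto simp: S'_eq indicator_def intro!: nn_integral_cong\<close>)
  also have "\<dots> = (\<integral>\<^sup>+z\<in>S. ennreal (j z) \<partial>lborel)"
    by (rule nn_integral_cong) (auto simp: indicator_def)
  finally show ?thesis .
qed

text \<open>Both sides integrate \<open>h\<close> against a measure on the target: Lebesgue measure
  restricted to the image of \<open>S\<close>, and the push-forward of the weight \<open>j\<close>
  on \<open>S\<close>. These two measures agree on each Borel set by
  \<open>emeasure_image_complex\<close>. That \<open>\<tau>\<close> carries Borel sets to Borel sets
  is assumed; in the uses below it comes from continuous inverses.\<close>

lemma nn_integral_image_complex:
  fixes \<tau> :: "complex \<Rightarrow> complex"
  assumes S: "S \<in> sets borel" and TS: "\<And>T. T \<in> sets borel \<Longrightarrow> T \<subseteq> S \<Longrightarrow> \<tau> ` T \<in> sets borel" and inj: "inj_on \<tau> S"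
    and der: "\<And>z. z \<in> S \<Longrightarrow> (\<tau> has_derivative \<tau>' z) (at z)"
    and pos: "\<And>z. z \<in> S \<Longrightarrow> j z = Im (cnj (\<tau>' z 1) * \<tau>' z \<i>)" "\<And>z. z \<in> S \<Longrightarrow> 0 \<le> j z"
    and j: "(\<lambda>z. indicator S z * j z) \<in> borel_measurable borel"
    and tau: "\<tau> \<in> borel_measurable (restrict_space borel S)"
    and h [measurable]: "h \<in> borel_measurable borel"
  shows "(\<integral>\<^sup>+z\<in>\<tau> ` S. h z \<partial>lborel) = (\<integral>\<^sup>+z\<in>S. h (\<tau> z) * ennreal (j z) \<partial>lborel)"
proof -
  let ?M = "density lborel (indicator (\<tau> ` S))"
  \<comment> \<open>The value 0 outside \<open>S\<close> only makes the map total; the density in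
    \<open>?N\<close> vanishes there.\<close>
  let ?t = "\<lambda>z. if z \<in> S then \<tau> z else 0"
  let ?N = "distr (density lborel (\<lambda>z. ennreal (indicator S z * j z))) borel ?t"
  have tS: "\<tau> ` S \<in> sets borel" using TS[OF S] by simp
  have mt [measurable]: "?t \<in> borel_measurable borel"
    using tau S by (subst measurable_If_restrict_space_iff) auto
  note j [measurable] S [measurable] tS [measurable]
  have "?M = ?N"
  proof (rule measure_eqI)
    fix T assume "T \<in> sets ?M"
    then have T [measurable]: "T \<in> sets borel" by simp
    define R where "R = S \<inter> ?t -` T"
    have R: "R \<in> sets borel"
      unfolding R_def using measurable_sets[OF mt T] S by auto
    have sub: "R \<subseteq> S" by (auto simp: R_def)
    have ind: "(\<lambda>z. indicator R z * (indicator S z * j z)) \<in> borel_measurable borel"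
      using R by measurable
    have ind_eq: "(\<lambda>z. indicator R z * (indicator S z * j z)) = (\<lambda>z. indicator R z * j z)"
      using sub by (auto simp: indicator_def fun_eq_iff)
    have "emeasure ?M T = emeasure lborel (\<tau> ` S \<inter> T)"
      by (subst emeasure_density) (auto simp flip: indicator_inter_arith)
    also have "\<tau> ` S \<inter> T = \<tau> ` R"
      by (auto simp: R_def)
    also have "emeasure lborel (\<tau> ` R) = (\<integral>\<^sup>+z\<in>R. ennreal (j z) \<partial>lborel)"
      using sub ind unfolding ind_eq
      by (intro emeasure_image_complex[where \<tau>' = \<tau>'] R TS inj_on_subset[OF inj] der pos) auto
    also have "\<dots> = (\<integral>\<^sup>+z. ennreal (indicator S z * j z) * indicator (?t -` T) z \<partial>lborel)"
      by (rule nn_integral_cong) (auto simp: R_def indicator_def)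
    also have "\<dots> = emeasure (density lborel (\<lambda>z. ennreal (indicator S z * j z))) (?t -` T)"
      using measurable_sets[OF mt T] by (subst emeasure_density) auto
    also have "\<dots> = emeasure ?N T"
      using T by (subst emeasure_distr) auto
    finally show "emeasure ?M T = emeasure ?N T" .
  qed simp
  have "(\<integral>\<^sup>+z\<in>\<tau> ` S. h z \<partial>lborel) = (\<integral>\<^sup>+z. h z \<partial>?M)"
    by (subst nn_integral_density) (auto simp: mult.commute)
  also have "\<dots> = (\<integral>\<^sup>+z. h z \<partial>?N)"
    using \<open>?M = ?N\<close> by simp
  also have "\<dots> = (\<integral>\<^sup>+z. ennreal (indicator S z * j z) * h (?t z) \<partial>lborel)"
    by (subst nn_integral_distr) (auto simp: nn_integral_density)
  also have "\<dots> = (\<integral>\<^sup>+z\<in>S. h (\<tau> z) * ennreal (j z) \<partial>lborel)"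
    by (rule nn_integral_cong) (auto simp: indicator_def mult.commute)
  finally show ?thesis .
qed

section \<open>Calculus of \<open>C\<^sup>k\<close> functions\<close>

lemma Ck_on_Suc_open:
  assumes "open S"
  shows "Ck_on (Suc k) S f \<longleftrightarrow>
    (\<forall>x\<in>S. f differentiable (at x)) \<and> (\<forall>v. Ck_on k S (\<lambda>x. frechet_derivative f (at x) v))"
  using assms by (simp add: differentiable_on_def at_within_open[of _ S] Ck_on.simps(2))

declare Ck_on.simps(2) [simp del]

lemma has_derivative_frechet_cong:
  assumes "open S" "x \<in> S" "\<And>y. y \<in> S \<Longrightarrow> f y = g y"
  shows "frechet_derivative f (at x) = frechet_derivative g (at x)"
proof -
  have "(f has_derivative D) (at x) \<longleftrightarrow> (g has_derivative D) (at x)" for D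
    using assms has_derivative_transform_within_open[of f D x UNIV S g]
      has_derivative_transform_within_open[of g D x UNIV S f] by auto
  then show ?thesis by (simp add: frechet_derivative_def)
qed

lemma Ck_on_cong:
  assumes "open S" "\<And>x. x \<in> S \<Longrightarrow> f x = g x"
  shows "Ck_on k S f \<longleftrightarrow> Ck_on k S g"
  using assms(2)
proof (induction k arbitrary: f g)
  case 0
  then show ?case by (simp cong: continuous_on_cong)
next
  case (Suc k)
  have "f differentiable (at x) \<longleftrightarrow> g differentiable (at x)" if "x \<in> S" for x
    using assms(1) that Suc.prems
      has_derivative_transform_within_open[of f _ x UNIV S g] has_derivative_transform_within_open[of g _ x UNIV S f]
    unfolding differentiable_def by auto
  moreover have "Ck_on k S (\<lambda>x. frechet_derivative f (at x) v) = Ck_on k S (\<lambda>x. frechet_derivative g (at x) v)" for v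
    by (rule Suc.IH) (simp add: has_derivative_frechet_cong[OF assms(1) _ Suc.prems])
  ultimately show ?case
    unfolding Ck_on_Suc_open[OF assms(1)] by blast
qed

lemma Ck_on_subset:
  assumes "open S" "open T" "T \<subseteq> S" "Ck_on k S f"
  shows "Ck_on k T f"
  using assms(4)
proof (induction k arbitrary: f)
  case 0
  then show ?case using assms(3) continuous_on_subset by auto
next
  case (Suc k)
  then show ?case
    unfolding Ck_on_Suc_open[OF assms(1)] Ck_on_Suc_open[OF assms(2)] using assms(3) by blast
qed

text \<open>Any derivative produced by the differentiation rules may stand in for the chosen
  \<open>frechet_derivative\<close>. The closure properties below are all inductions on
  \<open>k\<close> through this rule.\<close>

lemma Ck_on_SucI:
  assumes "open S" "\<And>x. x \<in> S \<Longrightarrow> (f has_derivative f' x) (at x)" "\<And>v. Ck_on k S (\<lambda>x. f' x v)"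
  shows "Ck_on (Suc k) S f"
proof -
  have "frechet_derivative f (at x) = f' x" if "x \<in> S" for x
    using frechet_derivative_at[OF assms(2)[OF that]] by simp
  then have "Ck_on k S (\<lambda>x. frechet_derivative f (at x) v) = Ck_on k S (\<lambda>x. f' x v)" for v
    by (intro Ck_on_cong[OF assms(1)]) simp
  with assms(3) have "Ck_on k S (\<lambda>x. frechet_derivative f (at x) v)" for v by simp
  then show ?thesis
    using assms(2) unfolding Ck_on_Suc_open[OF assms(1)] differentiable_def by blast
qed

lemma Ck_on_SucE:
  assumes "open S" "Ck_on (Suc k) S f"
  shows "\<And>x. x \<in> S \<Longrightarrow> (f has_derivative frechet_derivative f (at x)) (at x)"
    and "\<And>v. Ck_on k S (\<lambda>x. frechet_derivative f (at x) v)"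
  using assms(2) unfolding Ck_on_Suc_open[OF assms(1)]
  by (auto simp: frechet_derivative_works)

lemma Ck_on_SucD:
  assumes "open S" "Ck_on (Suc k) S f"
  shows "Ck_on k S f"
  using assms(2)
proof (induction k arbitrary: f)
  case 0
  then show ?case by (simp add: Ck_on.simps(2) differentiable_imp_continuous_on)
next
  case (Suc k)
  show ?case
    by (rule Ck_on_SucI[OF assms(1) Ck_on_SucE(1)[OF assms(1) Suc.prems]])
       (auto intro: Suc.IH Ck_on_SucE(2)[OF assms(1) Suc.prems])
qed

lemma Ck_on_continuous: "open S \<Longrightarrow> Ck_on k S f \<Longrightarrow> continuous_on S f"
  by (cases k) (auto simp: Ck_on.simps(2) differentiable_imp_continuous_on)

lemma Ck_on_const: "open S \<Longrightarrow> Ck_on k S (\<lambda>x. c)"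
proof (induction k arbitrary: c)
  case (Suc k)
  then show ?case by (intro Ck_on_SucI[where f' = "\<lambda>_ _. 0"]) auto
qed auto

lemma Ck_on_bounded_linear:
  assumes "open S" "bounded_linear f"
  shows "Ck_on k S f"
proof (cases k)
  case (Suc n)
  then show ?thesis
    using assms by (auto simp del: Ck_on.simps intro!: Ck_on_SucI[where f' = "\<lambda>_. f"]
      bounded_linear_imp_has_derivative Ck_on_const)
qed (use assms in \<open>auto intro: linear_continuous_on\<close>)

lemma Ck_on_linear_comp:
  assumes "open S" "bounded_linear L" "Ck_on k S f"
  shows "Ck_on k S (\<lambda>x. L (f x))"
  using assms(3)
proof (induction k arbitrary: f)
  case 0
  then show ?case using assms(2) by (auto intro: bounded_linear.continuous_on)
next
  case (Suc k)
  show ?case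
    by (rule Ck_on_SucI[OF assms(1) bounded_linear.has_derivative[OF assms(2) Ck_on_SucE(1)[OF assms(1) Suc.prems]]])
       (auto intro: Suc.IH Ck_on_SucE(2)[OF assms(1) Suc.prems])
qed

lemma Ck_on_add:
  assumes "open S" "Ck_on k S f" "Ck_on k S g"
  shows "Ck_on k S (\<lambda>x. f x + g x)"
  using assms(2,3)
proof (induction k arbitrary: f g)
  case 0
  then show ?case by (auto intro: continuous_intros)
next
  case (Suc k)
  show ?case
    by (rule Ck_on_SucI[OF assms(1) has_derivative_add[OF Ck_on_SucE(1)[OF assms(1) Suc.prems(1)] Ck_on_SucE(1)[OF assms(1) Suc.prems(2)]]])
       (auto intro: Suc.IH Ck_on_SucE(2)[OF assms(1) Suc.prems(1)] Ck_on_SucE(2)[OF assms(1) Suc.prems(2)])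
qed

lemma Ck_on_minus: "open S \<Longrightarrow> Ck_on k S f \<Longrightarrow> Ck_on k S (\<lambda>x. - f x)"
  using Ck_on_linear_comp[OF _ bounded_linear_minus[OF bounded_linear_ident]] by blast

lemma Ck_on_diff: "open S \<Longrightarrow> Ck_on k S f \<Longrightarrow> Ck_on k S g \<Longrightarrow> Ck_on k S (\<lambda>x. f x - g x)"
  using Ck_on_add[of S k f "\<lambda>x. - g x"] Ck_on_minus[of S k g] by simp

lemma Ck_on_bilinear:
  assumes "open S" "bounded_bilinear B" "Ck_on k S f" "Ck_on k S g"
  shows "Ck_on k S (\<lambda>x. B (f x) (g x))"
  using assms(3,4)
proof (induction k arbitrary: f g)
  case 0
  then show ?case using assms(2) by (auto intro: bounded_bilinear.continuous_on)
next
  case (Suc k)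
  note f = Ck_on_SucE[OF assms(1) Suc.prems(1)] and g = Ck_on_SucE[OF assms(1) Suc.prems(2)]
  show ?case
    by (rule Ck_on_SucI[OF assms(1) bounded_bilinear.FDERIV[OF assms(2) f(1) g(1)]])
       (assumption | intro Ck_on_add Suc.IH f(2) g(2) assms(1) Ck_on_SucD[OF assms(1) Suc.prems(1)] Ck_on_SucD[OF assms(1) Suc.prems(2)])+
qed

lemma Ck_on_mult:
  fixes f g :: "'a::real_normed_vector \<Rightarrow> 'b::real_normed_algebra"
  shows "open S \<Longrightarrow> Ck_on k S f \<Longrightarrow> Ck_on k S g \<Longrightarrow> Ck_on k S (\<lambda>x. f x * g x)"
  by (rule Ck_on_bilinear[OF _ bounded_bilinear_mult])

lemma Ck_on_power:
  fixes f :: "'a::real_normed_vector \<Rightarrow> 'b::{real_normed_algebra,monoid_mult}"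
  shows "open S \<Longrightarrow> Ck_on k S f \<Longrightarrow> Ck_on k S (\<lambda>x. f x ^ n)"
  by (induction n) (auto intro: Ck_on_const Ck_on_mult)

text \<open>The derivative of a reciprocal is again a product of reciprocals and of the derivative
  of \<open>g\<close>, so the induction closes.\<close>

lemma Ck_on_divide:
  fixes f g :: "'a::real_normed_vector \<Rightarrow> real"
  assumes "open S" "Ck_on k S f" "Ck_on k S g" "\<And>x. x \<in> S \<Longrightarrow> g x \<noteq> 0"
  shows "Ck_on k S (\<lambda>x. f x / g x)"
proof -
  have "Ck_on k S (\<lambda>x. inverse (g x))"
    using assms(3,4)
  proof (induction k)
    case 0
    then show ?case by (auto intro: continuous_intros)
  next
    case (Suc k)
    note g = Ck_on_SucE[OF assms(1) Suc.prems(1)]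
    show ?case
      by (rule Ck_on_SucI[OF assms(1) Deriv.has_derivative_inverse[OF _ g(1)]])
         (use Suc.prems(2) in \<open>auto intro!: Ck_on_minus Ck_on_mult assms(1) Suc.IH g(2) Ck_on_SucD[OF assms(1) Suc.prems(1)]\<close>)
  qed
  from Ck_on_mult[OF assms(1,2) this] show ?thesis by (simp add: divide_inverse)
qed

text \<open>The derivative is a quotient by the root itself, to which the induction hypothesis and
  \<open>Ck_on_divide\<close> apply.\<close>

lemma Ck_on_sqrt:
  fixes f :: "'a::real_normed_vector \<Rightarrow> real"
  assumes "open S" "Ck_on k S f" "\<And>x. x \<in> S \<Longrightarrow> f x > 0"
  shows "Ck_on k S (\<lambda>x. sqrt (f x))"
  using assms(2)
proof (induction k)
  case 0
  then show ?case by (auto intro: continuous_intros)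
next
  case (Suc k)
  note f = Ck_on_SucE[OF assms(1) Suc.prems(1)]
  have "((\<lambda>x. sqrt (f x)) has_derivative (\<lambda>v. frechet_derivative f (at x) v / (2 * sqrt (f x)))) (at x)"
    if "x \<in> S" for x
    using assms(3)[OF that] by (auto intro!: derivative_eq_intros f(1) that simp: field_simps)
  moreover have "sqrt (f x) \<noteq> 0" if "x \<in> S" for x using assms(3)[OF that] by simp
  ultimately show ?case
    by (intro Ck_on_SucI[OF assms(1)])
       (auto intro!: Ck_on_divide Ck_on_mult Ck_on_const assms(1) Suc.IH f(2) Ck_on_SucD[OF assms(1) Suc.prems])
qed

lemma linear_complex_expand:
  assumes "linear f"
  shows "f v = Re v *\<^sub>R f 1 + Im v *\<^sub>R f \<i>"
proof -
  have "v = Re v *\<^sub>R 1 + Im v *\<^sub>R \<i>" by (simp add: complex_eq_iff)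
  then show ?thesis by (metis assms linear_add linear_scale)
qed

text \<open>In the chain rule the derivative of \<open>g\<close> is applied to a direction that
  varies with \<open>x\<close>, whereas \<open>Ck_on\<close> speaks of fixed directions. Expanding
  the direction in the real basis \<open>1\<close>, \<open>\<i>\<close> turns the chain rule into a
  sum of products of functions with fixed directions; this is why \<open>g\<close> lives on the
  complex plane.\<close>

lemma Ck_on_comp:
  fixes g :: "complex \<Rightarrow> 'b::real_normed_vector"
  assumes "open S" "open T" "Ck_on k T g" "Ck_on k S f" "\<And>x. x \<in> S \<Longrightarrow> f x \<in> T"
  shows "Ck_on k S (\<lambda>x. g (f x))"
  using assms(3,4)
proof (induction k arbitrary: g)
  case 0
  then show ?case using assms(5) by (auto intro: continuous_on_compose2[of T g])
next
  case (Suc k)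
  note f = Ck_on_SucE[OF assms(1) Suc.prems(2)] and g = Ck_on_SucE[OF assms(2) Suc.prems(1)]
  let ?h = "\<lambda>x v. Re (frechet_derivative f (at x) v) *\<^sub>R frechet_derivative g (at (f x)) 1
     + Im (frechet_derivative f (at x) v) *\<^sub>R frechet_derivative g (at (f x)) \<i>"
  show ?case
  proof (rule Ck_on_SucI[OF assms(1)])
    fix x assume x: "x \<in> S"
    have lin: "linear (frechet_derivative g (at (f x)))"
      using g(1)[OF assms(5)[OF x]] has_derivative_linear by blast
    have "(g \<circ> f has_derivative frechet_derivative g (at (f x)) \<circ> frechet_derivative f (at x)) (at x)"
      by (rule diff_chain_at[OF f(1)[OF x] g(1)[OF assms(5)[OF x]]])
    then show "((\<lambda>x. g (f x)) has_derivative ?h x) (at x)"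
      by (simp add: o_def flip: linear_complex_expand[OF lin])
  next
    fix v
    note IH = Suc.IH[OF g(2) Ck_on_SucD[OF assms(1) Suc.prems(2)]]
    show "Ck_on k S (\<lambda>x. ?h x v)"
      by (intro Ck_on_add assms(1) Ck_on_bilinear[OF _ bounded_bilinear_scaleR] IH
          Ck_on_linear_comp[OF _ bounded_linear_Re] Ck_on_linear_comp[OF _ bounded_linear_Im] f(2))
  qed
qed

lemma Ck_on_slice_fst:
  assumes "open U" "Ck_on (Suc k) U f" "(s, z) \<in> U"
  shows "((\<lambda>s. f (s, z)) has_derivative (\<lambda>v. frechet_derivative f (at (s, z)) (v, 0))) (at s)"
proof -
  have "((\<lambda>s. (s, z)) has_derivative (\<lambda>v. (v, 0))) (at s)"
    by (auto intro!: derivative_eq_intros)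
  from diff_chain_at[OF this Ck_on_SucE(1)[OF assms]] show ?thesis by (simp add: o_def)
qed

lemma Ck_on_slice_snd:
  assumes "open U" "Ck_on (Suc k) U f" "(s, z) \<in> U"
  shows "((\<lambda>z. f (s, z)) has_derivative (\<lambda>v. frechet_derivative f (at (s, z)) (0, v))) (at z)"
proof -
  have "((\<lambda>z. (s, z)) has_derivative (\<lambda>v. (0, v))) (at z)"
    by (auto intro!: derivative_eq_intros)
  from diff_chain_at[OF this Ck_on_SucE(1)[OF assms]] show ?thesis by (simp add: o_def)
qed

section \<open>Differentiation under the integral over a compact space\<close>

text \<open>A tube lemma: finitely many of the sets \<open>N\<close> cover the space, and the least
  of their radii works for all points. Nearly every "for all small \<open>s\<close>" below is
  obtained from it.\<close>

lemma compact_uniform_nhd: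
  fixes P :: "'p::real_normed_vector \<Rightarrow> 'a::topological_space \<Rightarrow> bool"
  assumes "compact (UNIV :: 'a set)"
    and "\<And>p. \<exists>N \<delta>. open N \<and> p \<in> N \<and> \<delta> > 0 \<and> (\<forall>s\<in>ball s0 \<delta>. \<forall>q\<in>N. P s q)"
  shows "\<exists>\<delta>>0. \<forall>s\<in>ball s0 \<delta>. \<forall>q. P s q"
proof -
  obtain N \<delta> where N: "\<And>p. open (N p) \<and> p \<in> N p \<and> \<delta> p > (0::real) \<and> (\<forall>s\<in>ball s0 (\<delta> p). \<forall>q\<in>N p. P s q)"
    using assms(2) by metis
  obtain F where F: "finite F" "UNIV = (\<Union>p\<in>F. N p)"
    using assms(1) N by (rule_tac compactE_image[of UNIV UNIV N]) auto
  have "F \<noteq> {}" using F by auto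
  then have "Min (\<delta> ` F) > 0" using F N by simp
  moreover have "P s q" if "s \<in> ball s0 (Min (\<delta> ` F))" for s q
  proof -
    obtain p where "p \<in> F" "q \<in> N p" using F by auto
    moreover from this F have "Min (\<delta> ` F) \<le> \<delta> p" by simp
    ultimately show ?thesis using that N[of p] by auto
  qed
  ultimately show ?thesis by blast
qed

lemma open_vimage_on:
  assumes "open Y" "continuous_on Y f" "open B"
  shows "open (f -` B \<inter> Y)"
  using continuous_on_open_vimage[OF assms(1), THEN iffD1, OF assms(2), rule_format, OF assms(3)] .

lemma continuous_on_slice:
  assumes "continuous_on (S \<times> UNIV) (\<lambda>(s, p). f s p)" "s \<in> S"
  shows "continuous_on UNIV (f s)"
proof -
  have "continuous_on UNIV (\<lambda>p. (s, p))" by (intro continuous_intros)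
  moreover have "range (Pair s) \<subseteq> S \<times> UNIV" using assms(2) by auto
  ultimately show ?thesis using continuous_on_compose2[OF assms(1), of UNIV "Pair s"] by simp
qed

lemma open_box_nhd:
  fixes p :: "'a::topological_space" and s0 :: "'p::real_normed_vector"
  assumes "open U" "(s0, p) \<in> U"
  obtains N \<delta> where "open N" "p \<in> N" "\<delta> > 0" "\<forall>s\<in>ball s0 \<delta>. \<forall>q\<in>N. (s, q) \<in> U"
proof -
  obtain A N where AN: "open A" "open N" "(s0, p) \<in> A \<times> N" "A \<times> N \<subseteq> U"
    by (rule open_prod_elim[OF assms])
  moreover obtain \<delta> where "\<delta> > 0" "ball s0 \<delta> \<subseteq> A" using AN open_contains_ball by blast
  ultimately have "\<forall>s\<in>ball s0 \<delta>. \<forall>q\<in>N. (s, q) \<in> U" by auto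
  with AN(2,3) \<open>\<delta> > 0\<close> show thesis by (intro that[of N \<delta>]) auto
qed

lemma integrable_continuous_compact:
  fixes g :: "'a::topological_space \<Rightarrow> 'b::{banach, second_countable_topology}"
  assumes "compact (UNIV :: 'a set)" "finite_measure \<mu>" "sets \<mu> = sets borel" "continuous_on UNIV g"
  shows "integrable \<mu> g"
proof -
  interpret finite_measure \<mu> by fact
  have "bounded (range g)"
    using assms compact_continuous_image compact_imp_bounded by blast
  then obtain B where "\<And>x. norm (g x) \<le> B"
    unfolding bounded_iff by auto
  moreover have "g \<in> borel_measurable \<mu>"
    using borel_measurable_continuous_onI[OF assms(4)] assms(3) by (simp cong: measurable_cong_sets)
  ultimately show ?thesis
    by (intro integrable_const_bound[of _ B]) auto
qed

text \<open>The surface carries only a topology, so uniform continuity is replaced by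
  \<open>compact_uniform_nhd\<close>: near \<open>s0\<close> the derivatives are uniformly close to
  those at \<open>s0\<close>. The mean value inequality then bounds the first-order remainder
  uniformly in the point, and the bound is integrated over a finite measure. Continuity of
  \<open>f'\<close> is assumed one direction at a time, so closeness is arranged on a basis
  first.\<close>

lemma has_derivative_integral_compact:
  fixes f :: "'p::euclidean_space \<Rightarrow> 'a::topological_space \<Rightarrow> real"
  assumes comp: "compact (UNIV :: 'a set)" and fin: "finite_measure \<mu>" and sets: "sets \<mu> = sets borel"
    and der: "\<And>s p. s \<in> ball 0 \<delta> \<Longrightarrow> ((\<lambda>s. f s p) has_derivative f' s p) (at s)"
    and cf: "\<And>s. s \<in> ball 0 \<delta> \<Longrightarrow> continuous_on UNIV (f s)"
    and cf': "\<And>v. continuous_on (ball 0 \<delta> \<times> UNIV) (\<lambda>(s, p). f' s p v)"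
    and s0: "s0 \<in> ball 0 \<delta>"
  shows "((\<lambda>s. \<integral>p. f s p \<partial>\<mu>) has_derivative (\<lambda>v. \<integral>p. f' s0 p v \<partial>\<mu>)) (at s0)"
  unfolding has_derivative_at_alt
proof (intro conjI allI impI)
  interpret finite_measure \<mu> by fact
  have lin: "linear (f' s p)" if "s \<in> ball 0 \<delta>" for s p
    using der[OF that] has_derivative_linear by blast
  have cf'_slice: "continuous_on UNIV (\<lambda>p. f' s p v)" if "s \<in> ball 0 \<delta>" for s v
    using continuous_on_slice[OF cf' that, of v] .
  have int: "integrable \<mu> (\<lambda>p. f' s p v)" if "s \<in> ball 0 \<delta>" for s v
    by (rule integrable_continuous_compact[OF comp fin sets cf'_slice[OF that]])
  have intf: "integrable \<mu> (f s)" if "s \<in> ball 0 \<delta>" for s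
    by (rule integrable_continuous_compact[OF comp fin sets cf[OF that]])
  show "bounded_linear (\<lambda>v. \<integral>p. f' s0 p v \<partial>\<mu>)"
    by (rule linear_conv_bounded_linear[THEN iffD1])
       (auto intro!: linearI simp: linear_add[OF lin[OF s0]] linear_scale[OF lin[OF s0]] int[OF s0])
  fix e :: real assume e: "e > 0"
  define M where "M = measure \<mu> (space \<mu>)"
  \<comment> \<open>Adding 1 keeps the quotient defined when the total mass \<open>M\<close> is 0.
    Dividing by the dimension in \<open>e2\<close> pays for summing the errors over the basis when
    the operator norm is estimated.\<close>
  define e1 where "e1 = e / (M + 1)"
  define e2 where "e2 = e1 / DIM('p)"
  have M: "M \<ge> 0" by (simp add: M_def)
  have e1: "e1 > 0" using e M by (simp add: e1_def)
  have e2: "e2 > 0" using e1 by (simp add: e2_def)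
  have "\<exists>N d. open N \<and> p \<in> N \<and> d > 0 \<and>
      (\<forall>s\<in>ball s0 d. \<forall>q\<in>N. s \<in> ball 0 \<delta> \<and> (\<forall>b\<in>Basis. \<bar>f' s q b - f' s0 q b\<bar> \<le> e2))" for p
  proof -
    have "\<exists>N d. open N \<and> p \<in> N \<and> d > 0 \<and> (\<forall>s\<in>ball s0 d. \<forall>q\<in>N. s \<in> ball 0 \<delta> \<and> \<bar>f' s q b - f' s0 q b\<bar> < e2)"
      for b :: 'p
    proof -
      define g where "g = (\<lambda>(s, q). f' s q b - f' s0 q b)"
      have "continuous_on (ball 0 \<delta> \<times> UNIV) g"
        unfolding g_def case_prod_unfold
        by (intro continuous_intros cf'[of b, unfolded case_prod_unfold]
             continuous_on_compose2[OF cf'_slice[OF s0]]) auto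
      moreover have "open (ball 0 \<delta> \<times> (UNIV::'a set) :: ('p \<times> 'a) set)" by (intro open_Times) auto
      moreover have "open (ball 0 e2 :: real set)" by simp
      ultimately have "open (g -` ball 0 e2 \<inter> (ball 0 \<delta> \<times> UNIV))"
        by (intro open_vimage_on)
      moreover have "(s0, p) \<in> g -` ball 0 e2 \<inter> (ball 0 \<delta> \<times> UNIV)" using s0 e2 by (auto simp: g_def)
      ultimately obtain N d where "open N" "p \<in> N" "d > 0"
          "\<forall>s\<in>ball s0 d. \<forall>q\<in>N. (s, q) \<in> g -` ball 0 e2 \<inter> (ball 0 \<delta> \<times> UNIV)"
        by (rule open_box_nhd)
      then show ?thesis
        by (intro exI[of _ N] exI[of _ d]) (simp add: g_def)
    qed
    then obtain N d where Nd: "\<And>b::'p. open (N b) \<and> p \<in> N b \<and> d b > (0::real) \<and>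
        (\<forall>s\<in>ball s0 (d b). \<forall>q\<in>N b. s \<in> ball 0 \<delta> \<and> \<bar>f' s q b - f' s0 q b\<bar> < e2)"
      by metis
    show ?thesis
    proof (intro exI[of _ "\<Inter>b\<in>Basis. N b"] exI[of _ "Min (d ` Basis)"] conjI ballI)
      show "open (\<Inter>b\<in>Basis. N b)" using Nd by (intro open_INT) auto
      show "0 < Min (d ` Basis)" using Nd by (subst Min_gr_iff) auto
      fix s q assume "s \<in> ball s0 (Min (d ` Basis))" and q: "q \<in> (\<Inter>b\<in>Basis. N b)"
      then have s: "s \<in> ball s0 (d b)" if "b \<in> Basis" for b
        using that by (auto simp: Min_gr_iff)
      show "s \<in> ball 0 \<delta>" using s Nd q SOME_Basis by blast
      fix b :: 'p assume "b \<in> Basis"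
      then show "\<bar>f' s q b - f' s0 q b\<bar> \<le> e2" using s Nd q by (meson INT_D less_imp_le)
    qed (use Nd in auto)
  qed
  from compact_uniform_nhd[OF comp this] obtain d where d: "d > 0"
    "\<And>s q. s \<in> ball s0 d \<Longrightarrow> s \<in> ball 0 \<delta>"
    "\<And>s q b. s \<in> ball s0 d \<Longrightarrow> b \<in> Basis \<Longrightarrow> \<bar>f' s q b - f' s0 q b\<bar> \<le> e2"
    by blast
  have on: "onorm (\<lambda>v. f' s q v - f' s0 q v) \<le> e1" if "s \<in> ball s0 d" for s q
  proof (rule onorm_bound)
    fix v :: 'p
    define h where "h v = f' s q v - f' s0 q v" for v
    have h: "linear h"
      unfolding h_def using lin[OF d(2)[OF that]] lin[OF s0] by (rule linear_compose_sub)
    have "h v = h (\<Sum>b\<in>Basis. (v \<bullet> b) *\<^sub>R b)"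
      by (simp add: euclidean_representation)
    then have "f' s q v - f' s0 q v = (\<Sum>b\<in>Basis. (v \<bullet> b) * (f' s q b - f' s0 q b))"
      by (simp add: linear_sum[OF h] linear_scale[OF h]) (simp add: h_def)
    also have "norm \<dots> \<le> (\<Sum>b\<in>(Basis::'p set). norm v * e2)"
      by (rule sum_norm_le) (auto simp: abs_mult intro!: mult_mono Basis_le_norm d(3)[OF that])
    also have "\<dots> = e1 * norm v" by (simp add: e2_def)
    finally show "norm (f' s q v - f' s0 q v) \<le> e1 * norm v" .
  qed (use e1 in simp)
  show "\<exists>d>0. \<forall>y. norm (y - s0) < d \<longrightarrow>
      norm ((\<integral>p. f y p \<partial>\<mu>) - (\<integral>p. f s0 p \<partial>\<mu>) - (\<integral>p. f' s0 p (y - s0) \<partial>\<mu>)) \<le> e * norm (y - s0)"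
  proof (intro exI[of _ d] conjI d(1) allI impI)
    fix y assume "norm (y - s0) < d"
    then have y: "y \<in> ball s0 d" by (simp add: dist_norm norm_minus_commute)
    have seg: "s0 + t *\<^sub>R (y - s0) \<in> ball s0 d" if "t \<in> {0..1}" for t
    proof -
      have "norm (t *\<^sub>R (y - s0)) \<le> norm (y - s0)" using that by (auto intro: mult_left_le_one_le)
      with y show ?thesis by (auto simp: dist_norm norm_minus_commute)
    qed
    have on': "onorm (f' s q - f' s0 q) \<le> e1" if "s \<in> ball s0 d" for s q
      using on[OF that] by (simp add: fun_diff_def)
    have bd: "norm (f y q - f s0 q - f' s0 q (y - s0)) \<le> e1 * norm (y - s0)" for q
    proof -
      have "norm (f y q - f s0 q - f' s0 q (y - s0)) \<le> norm (y - s0) * e1"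
      proof (rule differentiable_bound_linearization[where S = "ball s0 d" and f = "\<lambda>s. f s q" and f' = "\<lambda>s. f' s q"])
        show "((\<lambda>s. f s q) has_derivative f' x q) (at x within ball s0 d)" if "x \<in> ball s0 d" for x
          by (rule has_derivative_at_withinI[OF der[OF d(2)[OF that]]])
        show "s0 \<in> ball s0 d" using d(1) by simp
      qed (fact seg on')+
      then show ?thesis by (simp add: mult.commute)
    qed
    have "(\<integral>p. f y p \<partial>\<mu>) - (\<integral>p. f s0 p \<partial>\<mu>) - (\<integral>p. f' s0 p (y - s0) \<partial>\<mu>)
       = (\<integral>p. f y p - f s0 p - f' s0 p (y - s0) \<partial>\<mu>)"
      using intf[OF d(2)[OF y]] intf[OF s0] int[OF s0] by simp
    also have "norm \<dots> \<le> (\<integral>p. e1 * norm (y - s0) \<partial>\<mu>)"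
      using intf[OF d(2)[OF y]] intf[OF s0] int[OF s0] bd
      by (intro order_trans[OF integral_norm_bound] integral_mono) auto
    also have "\<dots> = M * (e1 * norm (y - s0))" by (simp add: M_def)
    also have "\<dots> \<le> e * norm (y - s0)"
    proof -
      have "M * e1 \<le> e" using M e by (simp add: e1_def field_simps)
      then show ?thesis by (metis mult.assoc mult_right_mono norm_ge_zero)
    qed
    finally show "norm ((\<integral>p. f y p \<partial>\<mu>) - (\<integral>p. f s0 p \<partial>\<mu>) - (\<integral>p. f' s0 p (y - s0) \<partial>\<mu>)) \<le> e * norm (y - s0)" .
  qed
qed

section \<open>Linear algebra of conformal coordinates\<close>

text \<open>The root of the Gram determinant, that is the area of the coordinate square spanned by
  \<open>1\<close> and \<open>\<i>\<close>. It is the area density in every chart and reduces to the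
  conformal factor in conformal ones.\<close>

definition gram_vol :: "(complex \<Rightarrow> complex \<Rightarrow> real) \<Rightarrow> real" where
  "gram_vol m = sqrt (m 1 1 * m \<i> \<i> - (m 1 \<i>)\<^sup>2)"

text \<open>For the coefficients \<open>m\<close> of the domain metric and \<open>b\<close> of the pulled back metric, \<open>energy_form\<close> is
  half the trace of \<open>b\<close> with respect to \<open>m\<close>, times the area density, and \<open>hopf_re + \<i> hopf_im\<close> is the value
  at the tangent vector \<open>1\<close> of the \<open>(2,0)\<close>-part of \<open>b\<close> for the complex structure \<open>J\<close> of \<open>m\<close>, that is
  \<open>(b(1,1) - b(J1,J1) - 2 \<i> b(1,J1)) / 4\<close>.\<close>

definition energy_form :: "(complex \<Rightarrow> complex \<Rightarrow> real) \<Rightarrow> (complex \<Rightarrow> complex \<Rightarrow> real) \<Rightarrow> real" where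
  "energy_form m b = (m \<i> \<i> * b 1 1 - 2 * m 1 \<i> * b 1 \<i> + m 1 1 * b \<i> \<i>) / (2 * gram_vol m)"

definition hopf_re :: "(complex \<Rightarrow> complex \<Rightarrow> real) \<Rightarrow> (complex \<Rightarrow> complex \<Rightarrow> real) \<Rightarrow> real" where
  "hopf_re m b = (b 1 1 - ((m 1 \<i>)\<^sup>2 * b 1 1 - 2 * m 1 1 * m 1 \<i> * b 1 \<i> + (m 1 1)\<^sup>2 * b \<i> \<i>)
      / (m 1 1 * m \<i> \<i> - (m 1 \<i>)\<^sup>2)) / 4"

definition hopf_im :: "(complex \<Rightarrow> complex \<Rightarrow> real) \<Rightarrow> (complex \<Rightarrow> complex \<Rightarrow> real) \<Rightarrow> real" where
  "hopf_im m b = (m 1 \<i> * b 1 1 - m 1 1 * b 1 \<i>) / (2 * gram_vol m)"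

definition pos_form :: "(complex \<Rightarrow> complex \<Rightarrow> real) \<Rightarrow> bool" where
  "pos_form m \<longleftrightarrow> bilinear m \<and> (\<forall>v w. m v w = m w v) \<and> (\<forall>v. v \<noteq> 0 \<longrightarrow> m v v > 0)"

definition det2 :: "(complex \<Rightarrow> complex) \<Rightarrow> real" where
  "det2 A = Im (cnj (A 1) * A \<i>)"

lemma complex_real_expand: "v = Re v *\<^sub>R 1 + Im v *\<^sub>R \<i>"
  by (simp add: complex_eq_iff)

lemma pos_form_expand:
  assumes "pos_form m"
  shows "m v w = Re v * Re w * m 1 1 + (Re v * Im w + Im v * Re w) * m 1 \<i> + Im v * Im w * m \<i> \<i>"
proof -
  have b: "bilinear m" and s: "m \<i> 1 = m 1 \<i>" using assms by (auto simp: pos_form_def)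
  have "m v w = m (Re v *\<^sub>R 1 + Im v *\<^sub>R \<i>) (Re w *\<^sub>R 1 + Im w *\<^sub>R \<i>)"
    by (simp only: complex_real_expand[symmetric])
  also have "\<dots> = Re v * Re w * m 1 1 + (Re v * Im w + Im v * Re w) * m 1 \<i> + Im v * Im w * m \<i> \<i>"
    by (simp add: bilinear_ladd[OF b] bilinear_radd[OF b] bilinear_lmul[OF b] bilinear_rmul[OF b] s algebra_simps
          del: scaleR_conv_of_real of_real_mult)
  finally show ?thesis .
qed

lemma pos_form_det:
  assumes "pos_form m"
  shows "m 1 1 * m \<i> \<i> - (m 1 \<i>)\<^sup>2 > 0" "m 1 1 > 0" "m \<i> \<i> > 0"
proof -
  show 1: "m 1 1 > 0" "m \<i> \<i> > 0" using assms by (auto simp: pos_form_def)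
  \<comment> \<open>This vector is orthogonal to \<open>1\<close> for \<open>m\<close>; its square
    length is \<open>m 1 1\<close> times the Gram determinant.\<close>
  define v where "v = Complex (- m 1 \<i>) (m 1 1)"
  have "v \<noteq> 0" using 1 by (simp add: v_def complex_eq_iff)
  then have "0 < m v v" using assms by (auto simp: pos_form_def)
  also have "m v v = m 1 1 * (m 1 1 * m \<i> \<i> - (m 1 \<i>)\<^sup>2)"
    unfolding pos_form_expand[OF assms, of v v] by (simp add: v_def algebra_simps power2_eq_square)
  finally show "m 1 1 * m \<i> \<i> - (m 1 \<i>)\<^sup>2 > 0" using 1 by (simp add: zero_less_mult_iff)
qed

lemma gram_vol_pos: "pos_form m \<Longrightarrow> gram_vol m > 0"
  using pos_form_det by (simp add: gram_vol_def)

lemma gram_vol_square: "pos_form m \<Longrightarrow> (gram_vol m)\<^sup>2 = m 1 1 * m \<i> \<i> - (m 1 \<i>)\<^sup>2"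
  using pos_form_det(1)[of m] by (simp add: gram_vol_def)

text \<open>The Gram determinant is multiplied by the square of \<open>det2 T\<close>, and the
  positive orientation lets the root be taken without an absolute value.\<close>

lemma gram_vol_pullback:
  assumes m: "pos_form m" and T: "linear T" "det2 T > 0"
  shows "gram_vol (\<lambda>v w. m (T v) (T w)) = det2 T * gram_vol m"
proof -
  let ?a = "Re (T 1)" and ?b = "Im (T 1)" and ?c = "Re (T \<i>)" and ?d = "Im (T \<i>)"
  have "m (T 1) (T 1) * m (T \<i>) (T \<i>) - (m (T 1) (T \<i>))\<^sup>2
     = (?a * ?d - ?b * ?c)\<^sup>2 * (m 1 1 * m \<i> \<i> - (m 1 \<i>)\<^sup>2)"
    unfolding pos_form_expand[OF m, of "T _" "T _"] by (simp add: algebra_simps power2_eq_square)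
  moreover have "det2 T = ?a * ?d - ?b * ?c" by (simp add: det2_def algebra_simps)
  ultimately show ?thesis
    using T(2) by (simp add: gram_vol_def real_sqrt_mult)
qed

text \<open>\<open>m\<close> is conformal via \<open>T\<close>, so the complex linear coordinate \<open>T\<close> turns multiplication by \<open>\<i>\<close>
  into the rotation \<open>(- m 1 \<i> + m 1 1 \<i>) / gram_vol m\<close> of the vector \<open>1\<close>.\<close>

lemma conformal_rotation:
  assumes m: "pos_form m" and T: "linear T" "det2 T > 0"
    and conf: "\<And>v w. m v w = f * (T v \<bullet> T w)"
  shows "f > 0" "m 1 1 = f * (cmod (T 1))\<^sup>2" "T 1 \<noteq> 0" "gram_vol m = f * det2 T"
    "m 1 1 *\<^sub>R T \<i> = gram_vol m *\<^sub>R (\<i> * T 1) + m 1 \<i> *\<^sub>R T 1"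
    "m 1 1 * m \<i> \<i> = (gram_vol m)\<^sup>2 + (m 1 \<i>)\<^sup>2"
proof -
  have m11: "m 1 1 = f * (T 1 \<bullet> T 1)" by (rule conf)
  moreover have "m 1 1 > 0" using pos_form_det[OF m] by simp
  ultimately show f: "f > 0" and T1: "T 1 \<noteq> 0"
    by (auto simp: zero_less_mult_iff inner_gt_zero_iff) (meson inner_ge_zero not_less)
  show "m 1 1 = f * (cmod (T 1))\<^sup>2" using m11 by (simp add: power2_norm_eq_inner)
  have "m 1 1 * m \<i> \<i> - (m 1 \<i>)\<^sup>2 = (f * det2 T)\<^sup>2"
    unfolding conf det2_def by (simp add: inner_complex_def algebra_simps power2_eq_square)
  then show vol: "gram_vol m = f * det2 T" using f T(2) by (simp add: gram_vol_def)
  show "m 1 1 *\<^sub>R T \<i> = gram_vol m *\<^sub>R (\<i> * T 1) + m 1 \<i> *\<^sub>R T 1"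
    unfolding vol conf det2_def by (simp add: complex_eq_iff inner_complex_def algebra_simps power2_eq_square)
  show "m 1 1 * m \<i> \<i> = (gram_vol m)\<^sup>2 + (m 1 \<i>)\<^sup>2"
    using gram_vol_square[OF m] by simp
qed

text \<open>The vectors \<open>x\<close> and \<open>y\<close> are the images under \<open>A\<close>
  of an orthogonal pair of equal length, namely \<open>T 1\<close> and its rotation by a right
  angle. \<open>conformal_rotation\<close> writes \<open>T \<i>\<close> in this pair, after which
  the trace and the (2,0)-part of \<open>b\<close> depend only on the lengths of \<open>x\<close>
  and \<open>y\<close> and on their inner product.\<close>

lemma pullback_rotation:
  assumes m: "pos_form m" and T: "linear T" "det2 T > 0"
    and conf: "\<And>v w. m v w = f * (T v \<bullet> T w)"
    and A: "linear A" and b: "\<And>v w. b v w = r * (A (T v) \<bullet> A (T w))"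
  defines "x \<equiv> A (T 1)" and "y \<equiv> A (\<i> * T 1)"
  shows "energy_form m b = r * gram_vol m * ((cmod x)\<^sup>2 + (cmod y)\<^sup>2) / (2 * m 1 1)"
    "hopf_re m b = r * ((cmod x)\<^sup>2 - (cmod y)\<^sup>2) / 4"
    "hopf_im m b = - r * (x \<bullet> y) / 2"
proof -
  note c = conformal_rotation[OF m T conf]
  \<comment> \<open>\<open>E\<close>, \<open>F\<close>, \<open>G\<close> are the classical
    coefficients of the first fundamental form, and \<open>V\<close> is the area density with
    \<open>V\<^sup>2 = E * G - F\<^sup>2\<close>.\<close>
  define E F G V where "E = m 1 1" and "F = m 1 \<i>" and "G = m \<i> \<i>" and "V = gram_vol m"
  have pos: "E > 0" "V > 0" using pos_form_det[OF m] gram_vol_pos[OF m] by (auto simp: E_def V_def)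
  have G: "G = (V\<^sup>2 + F\<^sup>2) / E" using c(6) pos by (simp add: E_def F_def G_def V_def field_simps)
  have Ti: "A (T \<i>) = (1 / E) *\<^sub>R (V *\<^sub>R y + F *\<^sub>R x)"
  proof -
    have "E *\<^sub>R A (T \<i>) = V *\<^sub>R y + F *\<^sub>R x"
      using arg_cong[OF c(5), of A] by (simp add: linear_add[OF A] linear_scale[OF A] E_def V_def F_def x_def y_def)
    then have "(1 / E) *\<^sub>R (E *\<^sub>R A (T \<i>)) = (1 / E) *\<^sub>R (V *\<^sub>R y + F *\<^sub>R x)" by simp
    then show ?thesis using pos by simp
  qed
  define p q s where "p = x \<bullet> x" and "q = x \<bullet> y" and "s = y \<bullet> y"
  have b11: "b 1 1 = r * p" by (simp add: b p_def x_def)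
  have b1i: "b 1 \<i> = r * (V * q + F * p) / E"
    unfolding b Ti by (fold x_def) (simp add: inner_add_right p_def q_def add_divide_distrib algebra_simps)
  have bii: "b \<i> \<i> = r * (V\<^sup>2 * s + 2 * V * F * q + F\<^sup>2 * p) / E\<^sup>2"
  proof -
    have "b \<i> \<i> = r * ((1 / E) * (1 / E) * (V * V * s + 2 * V * F * q + F * F * p))"
      unfolding b Ti by (simp add: inner_add_right inner_add_left p_def q_def s_def inner_commute[of y x] algebra_simps)
    then show ?thesis by (simp add: power2_eq_square)
  qed
  have det: "E * G - F\<^sup>2 = V\<^sup>2" using pos by (simp add: G)
  have nx: "(cmod x)\<^sup>2 = p" "(cmod y)\<^sup>2 = s" by (simp_all add: p_def s_def power2_norm_eq_inner)
  show "energy_form m b = r * gram_vol m * ((cmod x)\<^sup>2 + (cmod y)\<^sup>2) / (2 * m 1 1)"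
    unfolding energy_form_def b11 b1i bii nx E_def[symmetric] F_def[symmetric] G_def[symmetric] V_def[symmetric]
    unfolding G using pos by (simp add: field_simps power2_eq_square)
  show "hopf_re m b = r * ((cmod x)\<^sup>2 - (cmod y)\<^sup>2) / 4"
    unfolding hopf_re_def b11 b1i bii nx E_def[symmetric] F_def[symmetric] G_def[symmetric] det
    using pos by (simp add: field_simps power2_eq_square)
  show "hopf_im m b = - r * (x \<bullet> y) / 2"
    unfolding hopf_im_def b11 b1i E_def[symmetric] F_def[symmetric] V_def[symmetric] q_def[symmetric]
    using pos by (simp add: field_simps power2_eq_square)
qed

text \<open>\<open>\<alpha>\<close> and \<open>\<beta>\<close> are the complex linear and antilinear
  parts of \<open>A\<close>: a tangent vector \<open>t\<close> goes to
  \<open>\<alpha> * t + \<beta> * cnj t\<close>, and \<open>\<i> * t\<close> goes to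
  \<open>\<i> * (\<alpha> * t - \<beta> * cnj t)\<close>. The sum of the two squared lengths is then
  twice the sum for the parts, while their difference and the inner product give the real and the
  imaginary part of \<open>\<alpha> * cnj \<beta> * t\<^sup>2\<close>. When \<open>A\<close> is the
  derivative of a map in conformal coordinates, these are its two Wirtinger derivatives.\<close>

lemma conformal_densities:
  assumes m: "pos_form m" and T: "linear T" "det2 T > 0"
    and conf: "\<And>v w. m v w = f * (T v \<bullet> T w)"
    and A: "linear A" and b: "\<And>v w. b v w = r * (A (T v) \<bullet> A (T w))"
  defines "\<alpha> \<equiv> (A 1 - \<i> * A \<i>) / 2" and "\<beta> \<equiv> (A 1 + \<i> * A \<i>) / 2"
  shows "energy_form m b = gram_vol m * (r / f * ((cmod \<alpha>)\<^sup>2 + (cmod \<beta>)\<^sup>2))"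
    "r * det2 A * det2 T = gram_vol m * (r / f * ((cmod \<alpha>)\<^sup>2 - (cmod \<beta>)\<^sup>2))"
    "Complex (hopf_re m b) (hopf_im m b) = of_real r * \<alpha> * cnj \<beta> * (T 1)\<^sup>2"
proof -
  note c = conformal_rotation[OF m T conf]
  note p = pullback_rotation[OF m T conf A b]
  define t where "t = T 1"
  have t: "t \<noteq> 0" using c by (simp add: t_def)
  have x: "A t = \<alpha> * t + \<beta> * cnj t" and y: "A (\<i> * t) = \<i> * (\<alpha> * t - \<beta> * cnj t)"
    by (simp_all add: linear_complex_expand[OF A, of t] linear_complex_expand[OF A, of "\<i> * t"]
        \<alpha>_def \<beta>_def complex_eq_iff field_simps)
  have 1: "(cmod (A t))\<^sup>2 + (cmod (A (\<i> * t)))\<^sup>2 = 2 * ((cmod \<alpha>)\<^sup>2 + (cmod \<beta>)\<^sup>2) * (cmod t)\<^sup>2"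
    unfolding x y cmod_power2 by (simp add: algebra_simps power2_eq_square)
  have E: "m 1 1 = f * (cmod t)\<^sup>2" using c(2) by (simp add: t_def)
  show "energy_form m b = gram_vol m * (r / f * ((cmod \<alpha>)\<^sup>2 + (cmod \<beta>)\<^sup>2))"
    unfolding p(1) t_def[symmetric] 1 E using c(1) t by (simp add: field_simps)
  have "det2 A = (cmod \<alpha>)\<^sup>2 - (cmod \<beta>)\<^sup>2"
    unfolding cmod_power2 by (simp add: det2_def \<alpha>_def \<beta>_def power2_eq_square field_simps)
  then have d: "det2 A = (cmod \<alpha>)\<^sup>2 - (cmod \<beta>)\<^sup>2" .
  show "r * det2 A * det2 T = gram_vol m * (r / f * ((cmod \<alpha>)\<^sup>2 - (cmod \<beta>)\<^sup>2))"
    unfolding c(4) d using c(1) by simp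
  show "Complex (hopf_re m b) (hopf_im m b) = of_real r * \<alpha> * cnj \<beta> * (T 1)\<^sup>2"
    unfolding p(2,3) t_def[symmetric] x y cmod_power2
    by (simp add: complex_eq_iff inner_complex_def power2_eq_square field_simps)
qed

section \<open>Charts, metrics and area measures\<close>

lemma chart_at_in: "c \<in> C \<Longrightarrow> p \<in> fst c \<Longrightarrow> chart_at C p \<in> C \<and> p \<in> fst (chart_at C p)"
  unfolding chart_at_def by (rule someI[of "\<lambda>c. c \<in> C \<and> p \<in> fst c"]) simp

lemma chart_inv_in: "z \<in> snd c ` T \<Longrightarrow> T \<subseteq> fst c \<Longrightarrow> chart_inv c z \<in> fst c"
  unfolding chart_inv_def by (meson image_mono inv_into_into subsetD)

lemma chart_inv_right: "z \<in> snd c ` T \<Longrightarrow> T \<subseteq> fst c \<Longrightarrow> snd c (chart_inv c z) = z"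
  unfolding chart_inv_def by (meson f_inv_into_f image_mono subsetD)

lemma is_chart_inj: "is_chart c \<Longrightarrow> inj_on (snd c) (fst c)"
  unfolding is_chart_def homeomorphism_def by (metis inj_onI)

lemma chart_inv_left: "is_chart c \<Longrightarrow> p \<in> fst c \<Longrightarrow> chart_inv c (snd c p) = p"
  unfolding chart_inv_def by (rule inv_into_f_f[OF is_chart_inj])

lemma is_chart_continuous: "is_chart c \<Longrightarrow> continuous_on (fst c) (snd c)"
  unfolding is_chart_def homeomorphism_def by blast

lemma chart_inv_continuous:
  assumes "is_chart c"
  shows "continuous_on (snd c ` fst c) (chart_inv c)"
proof -
  obtain h where h: "homeomorphism (fst c) (snd c ` fst c) (snd c) h"
    using assms by (auto simp: is_chart_def)
  have "h z = chart_inv c z" if "z \<in> snd c ` fst c" for z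
    using that h chart_inv_left[OF assms] by (auto simp: homeomorphism_def)
  with h show ?thesis
    by (auto simp: homeomorphism_def cong: continuous_on_cong)
qed

lemma is_chart_open: "is_chart c \<Longrightarrow> open (fst c)" "is_chart c \<Longrightarrow> open (snd c ` fst c)"
  by (auto simp: is_chart_def)

text \<open>Rewrites an image as a preimage under the continuous inverse; openness and Borel
  measurability of images follow.\<close>

lemma chart_image_eq:
  assumes "is_chart c" "T \<subseteq> fst c"
  shows "snd c ` T = chart_inv c -` T \<inter> snd c ` fst c"
  using assms chart_inv_left[OF assms(1)] by (force simp: subset_iff)

lemma chart_image_open:
  assumes "is_chart c" "open T" "T \<subseteq> fst c"
  shows "open (snd c ` T)"
  unfolding chart_image_eq[OF assms(1,3)]
  using continuous_on_open_vimage[OF is_chart_open(2)[OF assms(1)], of "chart_inv c"]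
    chart_inv_continuous[OF assms(1)] assms(2) by metis

lemma chart_inv_image_open:
  assumes "is_chart c" "open Z" "Z \<subseteq> snd c ` fst c"
  shows "open (chart_inv c ` Z)"
proof -
  have "chart_inv c ` Z = snd c -` Z \<inter> fst c"
    using assms(3) chart_inv_left[OF assms(1)] by (force simp: subset_iff image_iff)
  then show ?thesis
    using continuous_on_open_vimage[OF is_chart_open(1)[OF assms(1)], of "snd c"]
      is_chart_continuous[OF assms(1)] assms(2) by metis
qed

lemma chart_image_borel:
  assumes "is_chart c" "S \<in> sets borel" "S \<subseteq> fst c"
  shows "snd c ` S \<in> sets borel"
proof -
  have "chart_inv c \<in> borel_measurable (restrict_space borel (snd c ` fst c))"
    by (rule borel_measurable_continuous_on_restrict[OF chart_inv_continuous[OF assms(1)]])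
  from measurable_sets[OF this assms(2)] have "snd c ` S \<in> sets (restrict_space borel (snd c ` fst c))"
    unfolding chart_image_eq[OF assms(1,3)] by (simp add: space_restrict_space Int_commute)
  then show ?thesis
    using is_chart_open[OF assms(1)] by (subst (asm) sets_restrict_space_iff) auto
qed

lemma chart_inv_image_borel:
  assumes "is_chart c" "S \<in> sets borel" "S \<subseteq> snd c ` fst c"
  shows "chart_inv c ` S \<in> sets borel"
proof -
  have eq: "chart_inv c ` S = snd c -` S \<inter> fst c"
    using assms(3) chart_inv_left[OF assms(1)] by (force simp: subset_iff image_iff)
  have "snd c \<in> borel_measurable (restrict_space borel (fst c))"
    by (rule borel_measurable_continuous_on_restrict[OF is_chart_continuous[OF assms(1)]])
  from measurable_sets[OF this assms(2)] have "chart_inv c ` S \<in> sets (restrict_space borel (fst c))"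
    unfolding eq by (simp add: space_restrict_space Int_commute)
  then show ?thesis
    using is_chart_open[OF assms(1)] by (subst (asm) sets_restrict_space_iff) auto
qed

lemma borel_measurable_open_extension:
  fixes g :: "'a::topological_space \<Rightarrow> real"
  assumes "open U" "continuous_on U g"
  shows "(\<lambda>z. indicator U z * g z) \<in> borel_measurable borel"
proof -
  have "(\<lambda>z. indicator U z *\<^sub>R g z) \<in> borel_measurable borel"
    by (rule borel_measurable_continuous_on_indicator) (use assms in auto)
  then show ?thesis by simp
qed

lemma det2_comp:
  assumes "linear A" "linear B"
  shows "det2 (A \<circ> B) = det2 A * det2 B"
  unfolding det2_def o_def
  by (simp add: linear_complex_expand[OF assms(1), of "B _"] algebra_simps)

lemma jacobian_det2: "jacobian f z = det2 (frechet_derivative f (at z))"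
  by (simp add: jacobian_def det2_def)

lemma smooth_on_differentiable:
  assumes "smooth_on S f" "open S" "x \<in> S"
  shows "(f has_derivative frechet_derivative f (at x)) (at x)"
  using assms Ck_on_SucE(1)[of S 0 f x] by (auto simp: smooth_on_def)

section \<open>Derivatives of coordinate changes and transformation of metrics\<close>

locale closed_surface =
  fixes \<A> :: "'a::t2_space chart set"
  assumes compact_surface: "compact (UNIV :: 'a set)"
    and connected_surface: "connected (UNIV :: 'a set)"
    and atlas: "oriented_atlas \<A>"
begin

abbreviation "charts \<equiv> oriented_charts \<A>"

abbreviation chart_area_of :: "'a metric \<Rightarrow> 'a chart \<Rightarrow> 'a set \<Rightarrow> ennreal" where
  "chart_area_of \<sigma> c S \<equiv> (\<integral>\<^sup>+z\<in>snd c ` S. ennreal (gram_vol (\<sigma> c (chart_inv c z))) \<partial>lborel)"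

lemma atlas_oriented: "\<A> \<subseteq> charts"
  using atlas by (auto simp: oriented_atlas_def oriented_charts_def)

lemma atlas_cover: "\<exists>a\<in>\<A>. p \<in> fst a"
  using atlas by (auto simp: oriented_atlas_def)

lemma chart_at_atlas: "chart_at \<A> p \<in> \<A>" "p \<in> fst (chart_at \<A> p)"
  using atlas_cover chart_at_in by metis+

lemma oriented_is_chart: "c \<in> charts \<Longrightarrow> is_chart c"
  by (simp add: oriented_charts_def)

lemma atlas_is_chart: "c \<in> \<A> \<Longrightarrow> is_chart c"
  using atlas_oriented oriented_is_chart by blast

abbreviation trans_deriv :: "'a chart \<Rightarrow> 'a chart \<Rightarrow> 'a \<Rightarrow> complex \<Rightarrow> complex" where
  "trans_deriv c d p \<equiv> frechet_derivative (transition c d) (at (snd c p))"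

lemma transition_compatible:
  assumes "is_chart c" "is_chart d" "oriented_compatible c d" "p \<in> fst c" "p \<in> fst d"
  shows "(transition c d has_derivative trans_deriv c d p) (at (snd c p))" "det2 (trans_deriv c d p) > 0"
proof -
  have o: "open (snd c ` (fst c \<inter> fst d))"
    using assms by (auto intro!: chart_image_open is_chart_open(1))
  then show "(transition c d has_derivative trans_deriv c d p) (at (snd c p))"
    using assms by (intro smooth_on_differentiable[OF _ o]) (auto simp: oriented_compatible_def)
  show "det2 (trans_deriv c d p) > 0"
    using assms by (auto simp: oriented_compatible_def jacobian_det2)
qed

lemma transition_comp_has_derivative:
  assumes c: "is_chart c" "p \<in> fst c" and d: "is_chart d" "p \<in> fst d" and e: "is_chart e" "p \<in> fst e"
    and cd: "(transition c d has_derivative D) (at (snd c p))"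
    and de: "(transition d e has_derivative D') (at (snd d p))"
  shows "(transition c e has_derivative D' \<circ> D) (at (snd c p))"
proof -
  have "transition c d (snd c p) = snd d p"
    using c by (simp add: transition_def chart_inv_left)
  with de have "(transition d e has_derivative D') (at (transition c d (snd c p)))" by simp
  from diff_chain_at[OF cd this] have 1: "(transition d e \<circ> transition c d has_derivative D' \<circ> D) (at (snd c p))" .
  let ?U = "snd c ` (fst c \<inter> fst d \<inter> fst e)"
  have "open ?U" using c d e by (auto intro!: chart_image_open is_chart_open(1))
  moreover have "snd c p \<in> ?U" using c d e by auto
  moreover have "(transition d e \<circ> transition c d) z = transition c e z" if "z \<in> ?U" for z
    using that c(1) d(1) by (auto simp: transition_def chart_inv_left)
  ultimately show ?thesis
    using has_derivative_transform_within_open[OF 1] by blast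
qed

text \<open>Members of \<open>oriented_charts\<close> are by definition compatible only with the
  charts of \<open>\<A>\<close>; two of them are compared by passing through a chart of
  \<open>\<A>\<close> around the point.\<close>

lemma transition_deriv:
  assumes c: "c \<in> charts" "p \<in> fst c" and d: "d \<in> charts" "p \<in> fst d"
  shows "(transition c d has_derivative trans_deriv c d p) (at (snd c p))" "det2 (trans_deriv c d p) > 0"
proof -
  obtain a where a: "a \<in> \<A>" "p \<in> fst a" using atlas_cover by blast
  note ic = oriented_is_chart[OF c(1)] oriented_is_chart[OF d(1)] atlas_is_chart[OF a(1)]
  have "oriented_compatible c a" "oriented_compatible a d"
    using a c d by (auto simp: oriented_charts_def)
  note ca = transition_compatible[OF ic(1,3) this(1) c(2) a(2)]
    and ad = transition_compatible[OF ic(3,2) this(2) a(2) d(2)]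
  have 1: "(transition c d has_derivative trans_deriv a d p \<circ> trans_deriv c a p) (at (snd c p))"
    by (rule transition_comp_has_derivative[OF ic(1) c(2) ic(3) a(2) ic(2) d(2) ca(1) ad(1)])
  then have eq: "trans_deriv c d p = trans_deriv a d p \<circ> trans_deriv c a p"
    by (metis frechet_derivative_at)
  with 1 show "(transition c d has_derivative trans_deriv c d p) (at (snd c p))" by simp
  show "det2 (trans_deriv c d p) > 0"
    unfolding eq using det2_comp[OF has_derivative_linear[OF ad(1)] has_derivative_linear[OF ca(1)]] ca ad by simp
qed

lemma trans_deriv_linear:
  assumes "c \<in> charts" "p \<in> fst c" "d \<in> charts" "p \<in> fst d"
  shows "linear (trans_deriv c d p)"
  using transition_deriv(1)[OF assms] has_derivative_linear by blast

lemma trans_deriv_comp: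
  assumes "c \<in> charts" "p \<in> fst c" "d \<in> charts" "p \<in> fst d"
    "e \<in> charts" "p \<in> fst e"
  shows "trans_deriv c e p v = trans_deriv d e p (trans_deriv c d p v)"
proof -
  have "(transition c e has_derivative trans_deriv d e p \<circ> trans_deriv c d p) (at (snd c p))"
    using assms by (intro transition_comp_has_derivative[of c p d e] transition_deriv oriented_is_chart)
  from frechet_derivative_at[OF this] show ?thesis by (metis comp_apply)
qed

lemma trans_deriv_inverse:
  assumes "c \<in> charts" "p \<in> fst c" "d \<in> charts" "p \<in> fst d"
  shows "trans_deriv d c p (trans_deriv c d p v) = v"
proof -
  have ic: "is_chart c" using assms oriented_is_chart by blast
  have "(id has_derivative id) (at (snd c p))" by (rule has_derivative_id)
  then have "(transition c c has_derivative id) (at (snd c p))"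
    by (rule has_derivative_transform_within_open[OF _ is_chart_open(2)[OF ic]])
       (use assms ic in \<open>auto simp: transition_def chart_inv_left\<close>)
  from frechet_derivative_at[OF this] show ?thesis
    using trans_deriv_comp[OF assms assms(1,2)] by (metis id_apply)
qed

lemma metric_pos_form:
  "riemannian_metric \<A> \<sigma> \<Longrightarrow> c \<in> charts \<Longrightarrow> p \<in> fst c \<Longrightarrow> pos_form (\<sigma> c p)"
  unfolding riemannian_metric_def pos_form_def by blast

lemma metric_transform:
  assumes "riemannian_metric \<A> \<sigma>" "c \<in> charts" "p \<in> fst c" "d \<in> charts" "p \<in> fst d"
  shows "\<sigma> c p v w = \<sigma> d p (trans_deriv c d p v) (trans_deriv c d p w)"
  using assms unfolding riemannian_metric_def by blast

lemma gram_vol_transform: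
  assumes "riemannian_metric \<A> \<sigma>" "c \<in> charts" "p \<in> fst c" "d \<in> charts" "p \<in> fst d"
  shows "gram_vol (\<sigma> c p) = det2 (trans_deriv c d p) * gram_vol (\<sigma> d p)"
proof -
  have "\<sigma> c p = (\<lambda>v w. \<sigma> d p (trans_deriv c d p v) (trans_deriv c d p w))"
    using metric_transform[OF assms] by (intro ext)
  then show ?thesis
    using gram_vol_pullback[OF metric_pos_form[OF assms(1,4,5)] trans_deriv_linear[OF assms(2-5)] transition_deriv(2)[OF assms(2-5)]]
    by simp
qed

lemma metric_entry_continuous:
  assumes "riemannian_metric \<A> \<sigma>" "c \<in> charts"
  shows "continuous_on (fst c) (\<lambda>p. \<sigma> c p v w)"
proof -
  have ic: "is_chart c" using assms oriented_is_chart by blast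
  have "Ck_on 0 (snd c ` fst c) (\<lambda>z. \<sigma> c (chart_inv c z) v w)"
    using assms unfolding riemannian_metric_def smooth_on_def by blast
  then have 1: "continuous_on (snd c ` fst c) (\<lambda>z. \<sigma> c (chart_inv c z) v w)" by simp
  have "continuous_on (fst c) (\<lambda>p. \<sigma> c (chart_inv c (snd c p)) v w)"
    by (rule continuous_on_compose2[OF 1 is_chart_continuous[OF ic]]) simp
  then show ?thesis using ic by (simp add: chart_inv_left cong: continuous_on_cong)
qed

lemma gram_vol_continuous:
  assumes "riemannian_metric \<A> \<sigma>" "c \<in> charts"
  shows "continuous_on (fst c) (\<lambda>p. gram_vol (\<sigma> c p))"
  unfolding gram_vol_def by (intro continuous_intros metric_entry_continuous assms)

section \<open>Area densities and change of variables in charts\<close>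

lemma chart_function_measurable:
  fixes g :: "'a \<Rightarrow> real"
  assumes "is_chart c" "open T" "T \<subseteq> fst c" "continuous_on T g"
  shows "(\<lambda>z. indicator (snd c ` T) z * g (chart_inv c z)) \<in> borel_measurable borel"
proof (rule borel_measurable_open_extension)
  show "open (snd c ` T)" using assms chart_image_open by blast
  show "continuous_on (snd c ` T) (\<lambda>z. g (chart_inv c z))"
    by (rule continuous_on_compose2[OF assms(4) continuous_on_subset[OF chart_inv_continuous[OF assms(1)]]])
       (use assms in \<open>auto simp: chart_inv_left subset_iff\<close>)
qed

text \<open>In contrast to the characterisation in \<open>area_measure\<close>, the charts range
  over all oriented ones, with the Gram density instead of the conformal factor. Integrals can thus
  be computed in charts of \<open>\<A>\<close>, which do not move with the metric.\<close>

definition area_form_measure :: "'a measure \<Rightarrow> 'a metric \<Rightarrow> bool" where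
  "area_form_measure \<mu> \<sigma> \<longleftrightarrow> sets \<mu> = sets borel \<and>
    (\<forall>c\<in>charts. \<forall>S\<in>sets borel. S \<subseteq> fst c \<longrightarrow>
       emeasure \<mu> S = chart_area_of \<sigma> c S)"

lemma gram_vol_chart_measurable:
  assumes "riemannian_metric \<A> \<sigma>" "c \<in> charts"
  shows "(\<lambda>z. indicator (snd c ` fst c) z * gram_vol (\<sigma> c (chart_inv c z))) \<in> borel_measurable borel"
  using chart_function_measurable[OF oriented_is_chart[OF assms(2)] is_chart_open(1)[OF oriented_is_chart[OF assms(2)]]
      order_refl gram_vol_continuous[OF assms]] .

text \<open>\<open>nn_integral_image_complex\<close> for the coordinate expression of
  \<open>w\<close>. The function \<open>j\<close> is the Jacobian of \<open>w\<close> measured with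
  \<open>\<sigma>\<close> at both ends. Two instances matter: the identity with
  \<open>j = 1\<close>, which makes area independent of the chart, and the maps of the
  family.\<close>

lemma area_pullback:
  assumes \<sigma>: "riemannian_metric \<A> \<sigma>" and a: "a \<in> charts" and b: "b \<in> charts"
    and w: "continuous_on UNIV w" "inj w" "\<And>R. R \<in> sets borel \<Longrightarrow> w ` R \<in> sets borel"
    and j: "continuous_on UNIV j" "\<And>p. j p \<ge> 0"
    and der: "\<And>p. p \<in> fst a \<Longrightarrow> w p \<in> fst b \<Longrightarrow> (local_rep w a b has_derivative D p) (at (snd a p)) \<and>
      det2 (D p) * gram_vol (\<sigma> b (w p)) = j p * gram_vol (\<sigma> a p)"
    and S: "S \<in> sets borel" "S \<subseteq> fst a" "w ` S \<subseteq> fst b"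
  shows "chart_area_of \<sigma> b (w ` S) =
    (\<integral>\<^sup>+z\<in>snd a ` S. ennreal (j (chart_inv a z)) * ennreal (gram_vol (\<sigma> a (chart_inv a z))) \<partial>lborel)"
proof -
  note ia = oriented_is_chart[OF a] and ib = oriented_is_chart[OF b]
  let ?N = "fst a \<inter> w -` fst b" and ?\<tau> = "local_rep w a b" and ?S = "snd a ` S"
  let ?h = "\<lambda>z. ennreal (indicator (snd b ` fst b) z * gram_vol (\<sigma> b (chart_inv b z)))"
  \<comment> \<open>The determinant of \<open>D\<close>, expressed through continuous functions;
    measurability is obtained from this expression, since nothing is assumed about how
    \<open>D\<close> depends on the point.\<close>
  let ?q = "\<lambda>q. j q * gram_vol (\<sigma> a q) / gram_vol (\<sigma> b (w q))"
  have N: "open ?N" "?N \<subseteq> fst a" "S \<subseteq> ?N"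
    using S is_chart_open(1)[OF ia] is_chart_open(1)[OF ib] w(1) open_vimage[of "fst b" w] by auto
  have vol: "gram_vol (\<sigma> a q) > 0" "gram_vol (\<sigma> b (w q)) > 0" if "q \<in> ?N" for q
    using that gram_vol_pos[OF metric_pos_form[OF \<sigma>]] a b by auto
  have pt: "\<exists>q\<in>S. z = snd a q \<and> chart_inv a z = q \<and> ?\<tau> z = snd b (w q) \<and> q \<in> ?N" if "z \<in> ?S" for z
    using that S(2) N(3) ia by (force simp: chart_inv_left local_rep_def)
  have im: "?\<tau> ` snd a ` R = snd b ` w ` R" if "R \<subseteq> fst a" for R
    unfolding image_image using that ia by (intro image_cong) (auto simp: local_rep_def chart_inv_left)
  have Sim: "?S \<in> sets borel" by (rule chart_image_borel[OF ia S(1,2)])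
  have "chart_area_of \<sigma> b (w ` S) = (\<integral>\<^sup>+z\<in>?\<tau> ` ?S. ?h z \<partial>lborel)"
    unfolding im[OF S(2)] using S(3) by (intro nn_integral_cong) (auto simp: indicator_def)
  also have "\<dots> = (\<integral>\<^sup>+z\<in>?S. ?h (?\<tau> z) * ennreal (?q (chart_inv a z)) \<partial>lborel)"
  proof (rule nn_integral_image_complex[where \<tau>' = "\<lambda>z. D (chart_inv a z)"])
    show "?\<tau> ` R \<in> sets borel" if R: "R \<in> sets borel" "R \<subseteq> ?S" for R
    proof -
      have 1: "R \<subseteq> snd a ` fst a" using R S(2) by blast
      have 2: "chart_inv a ` R \<in> sets borel" by (rule chart_inv_image_borel[OF ia R(1) 1])
      have "chart_inv a ` R \<subseteq> S" using R(2) pt by blast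
      with S(3) have "w ` chart_inv a ` R \<subseteq> fst b" by blast
      from chart_image_borel[OF ib w(3)[OF 2] this] show ?thesis by (simp add: local_rep_def image_comp)
    qed
    show "inj_on ?\<tau> ?S"
    proof (rule inj_onI)
      fix x y assume x: "x \<in> ?S" and y: "y \<in> ?S" and eq: "?\<tau> x = ?\<tau> y"
      obtain u v where "x = snd a u" "?\<tau> x = snd b (w u)" "u \<in> ?N" "y = snd a v" "?\<tau> y = snd b (w v)" "v \<in> ?N"
        using pt[OF x] pt[OF y] by blast
      then show "x = y"
        using eq w(2) is_chart_inj[OF ib] by (auto simp: inj_on_def inj_def)
    qed
    show derS: "(?\<tau> has_derivative D (chart_inv a z)) (at z)"
      and "?q (chart_inv a z) = Im (cnj (D (chart_inv a z) 1) * D (chart_inv a z) \<i>)" if z: "z \<in> ?S" for z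
    proof -
      obtain q where q: "z = snd a q" "chart_inv a z = q" "q \<in> ?N" using pt[OF z] by blast
      then show "(?\<tau> has_derivative D (chart_inv a z)) (at z)" using der[of q] by simp
      have "?q q = det2 (D q)" using der[of q] vol[OF q(3)] q(3) by (simp add: field_simps)
      then show "?q (chart_inv a z) = Im (cnj (D (chart_inv a z) 1) * D (chart_inv a z) \<i>)"
        unfolding q(2) det2_def .
    qed
    show "0 \<le> ?q (chart_inv a z)" if "z \<in> ?S" for z
      using pt[OF that] vol j(2) by (fastforce simp: less_imp_le)
    have "continuous_on ?N ?q"
    proof (intro continuous_intros)
      show "continuous_on ?N j" using j(1) continuous_on_subset by blast
      show "continuous_on ?N (\<lambda>q. gram_vol (\<sigma> a q))"
        by (rule continuous_on_subset[OF gram_vol_continuous[OF \<sigma> a] N(2)])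
      show "continuous_on ?N (\<lambda>q. gram_vol (\<sigma> b (w q)))"
        by (rule continuous_on_compose2[OF gram_vol_continuous[OF \<sigma> b] continuous_on_subset[OF w(1)]]) auto
      show "\<forall>q\<in>?N. gram_vol (\<sigma> b (w q)) \<noteq> 0" using vol by force
    qed
    note [measurable] = chart_function_measurable[OF ia N(1,2) this] Sim
    have "(\<lambda>z. indicator ?S z * (indicator (snd a ` ?N) z * ?q (chart_inv a z))) \<in> borel_measurable borel"
      by measurable
    also have "(\<lambda>z. indicator ?S z * (indicator (snd a ` ?N) z * ?q (chart_inv a z))) = (\<lambda>z. indicator ?S z * ?q (chart_inv a z))"
      using N(3) by (auto simp: indicator_def fun_eq_iff)
    finally show "(\<lambda>z. indicator ?S z * ?q (chart_inv a z)) \<in> borel_measurable borel" .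
    have "continuous_on ?S ?\<tau>"
      by (rule has_derivative_continuous_on[OF has_derivative_at_withinI[OF derS]])
    then show "?\<tau> \<in> borel_measurable (restrict_space borel ?S)"
      by (rule borel_measurable_continuous_on_restrict)
    show "?h \<in> borel_measurable borel"
      using gram_vol_chart_measurable[OF \<sigma> b] by measurable
  qed (fact Sim)
  also have "\<dots> = (\<integral>\<^sup>+z\<in>?S. ennreal (j (chart_inv a z)) * ennreal (gram_vol (\<sigma> a (chart_inv a z))) \<partial>lborel)"
  proof (rule nn_integral_cong)
    fix z
    show "?h (?\<tau> z) * ennreal (?q (chart_inv a z)) * indicator ?S z
       = ennreal (j (chart_inv a z)) * ennreal (gram_vol (\<sigma> a (chart_inv a z))) * indicator ?S z"
    proof (cases "z \<in> ?S")
      case True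
      then obtain q where q: "chart_inv a z = q" "?\<tau> z = snd b (w q)" "q \<in> ?N" using pt by blast
      then have "?h (?\<tau> z) = ennreal (gram_vol (\<sigma> b (w q)))" using ib by (simp add: chart_inv_left)
      then show ?thesis
        using q vol[OF q(3)] j(2)[of q] by (simp flip: ennreal_mult)
    qed simp
  qed
  finally show ?thesis .
qed

text \<open>The identity map in \<open>area_pullback\<close>: its expression in two charts is the
  transition map, and its Jacobian is 1.\<close>

lemma area_change_chart:
  assumes \<sigma>: "riemannian_metric \<A> \<sigma>" and c: "c \<in> charts" "S \<subseteq> fst c"
    and d: "d \<in> charts" "S \<subseteq> fst d" and S: "S \<in> sets borel"
  shows "chart_area_of \<sigma> d S = chart_area_of \<sigma> c S"
proof -
  have "chart_area_of \<sigma> d (id ` S) = (\<integral>\<^sup>+z\<in>snd c ` S. ennreal 1 * ennreal (gram_vol (\<sigma> c (chart_inv c z))) \<partial>lborel)"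
  proof (rule area_pullback[OF \<sigma> c(1) d(1)])
    show "(local_rep id c d has_derivative trans_deriv c d p) (at (snd c p)) \<and>
        det2 (trans_deriv c d p) * gram_vol (\<sigma> d (id p)) = 1 * gram_vol (\<sigma> c p)"
      if "p \<in> fst c" "id p \<in> fst d" for p
      using transition_deriv(1)[OF c(1) _ d(1), of p] gram_vol_transform[OF \<sigma> c(1) _ d(1), of p] that
      by (simp add: local_rep_def transition_def)
  qed (use assms in auto)
  then show ?thesis by simp
qed

end

section \<open>Gluing measures and continuity from local data\<close>

lemma borel_partition:
  fixes N :: "'a::topological_space \<Rightarrow> 'a set"
  assumes "compact (UNIV :: 'a set)" "\<And>p. open (N p)" "\<And>p. p \<in> N p"
  obtains n :: nat and q P where "\<And>i. P i \<in> sets borel" "\<And>i. P i \<subseteq> N (q i)"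
    "disjoint_family_on P {..<n}" "(\<Union>i<n. P i) = UNIV"
proof -
  obtain F where F: "finite F" "UNIV = (\<Union>p\<in>F. N p)"
    using assms by (rule_tac compactE_image[of UNIV UNIV N]) auto
  obtain n and q :: "nat \<Rightarrow> 'a" where q: "F = q ` {i. i < n}"
    using finite_imp_nat_seg_image_inj_on[OF F(1)] by blast
  let ?P = "disjointed (\<lambda>i. N (q i))"
  have "?P i \<in> sets borel" for i
    unfolding disjointed_def using assms(2) by (auto intro!: sets.Diff sets.finite_UN)
  moreover have "disjoint_family_on ?P {..<n}"
    using disjoint_family_disjointed by (rule disjoint_family_on_mono[rotated]) auto
  moreover have "(\<Union>i<n. ?P i) = UNIV"
    using finite_UN_disjointed_eq[of "\<lambda>i. N (q i)" n] F q by (auto simp: lessThan_def atLeast0LessThan)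
  ultimately show ?thesis
    using disjointed_subset[of "\<lambda>i. N (q i)"] that by blast
qed

text \<open>A Borel set is cut along a finite Borel partition into pieces that lie in the given
  neighbourhoods, and the values on the pieces are added.\<close>

lemma measure_eqI_local:
  fixes \<mu> \<nu> :: "'a::topological_space measure"
  assumes "compact (UNIV :: 'a set)" "sets \<mu> = sets borel" "sets \<nu> = sets borel"
    and loc: "\<And>p. \<exists>N. open N \<and> p \<in> N \<and> (\<forall>S\<in>sets borel. S \<subseteq> N \<longrightarrow> emeasure \<mu> S = emeasure \<nu> S)"
  shows "\<mu> = \<nu>"
proof (rule measure_eqI)
  fix S assume "S \<in> sets \<mu>"
  then have S: "S \<in> sets borel" using assms by simp
  obtain N where N: "\<And>p. open (N p) \<and> p \<in> N p \<and> (\<forall>S\<in>sets borel. S \<subseteq> N p \<longrightarrow> emeasure \<mu> S = emeasure \<nu> S)"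
    using loc by metis
  obtain n :: nat and q P where P: "\<And>i. P i \<in> sets borel" "\<And>i. P i \<subseteq> N (q i)"
    "disjoint_family_on P {..<n}" "(\<Union>i<n. P i) = UNIV"
    using borel_partition[OF assms(1), of N] N by metis
  have dj: "disjoint_family_on (\<lambda>i. P i \<inter> S) {..<n}"
    using P(3) by (auto simp: disjoint_family_on_def)
  have un: "(\<Union>i<n. P i \<inter> S) = S" using P(4) by auto
  have "(\<Sum>i<n. emeasure \<mu> (P i \<inter> S)) = emeasure \<mu> (\<Union>i<n. P i \<inter> S)"
    using P(1) S assms dj by (intro sum_emeasure) auto
  moreover have "(\<Sum>i<n. emeasure \<nu> (P i \<inter> S)) = emeasure \<nu> (\<Union>i<n. P i \<inter> S)"
    using P(1) S assms dj by (intro sum_emeasure) auto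
  moreover have "emeasure \<mu> (P i \<inter> S) = emeasure \<nu> (P i \<inter> S)" for i
    using N[of "q i"] P(1,2)[of i] S by blast
  ultimately show "emeasure \<mu> S = emeasure \<nu> S" unfolding un by simp
qed (use assms in auto)

lemma continuous_on_UNIV_local:
  fixes g :: "'a::t2_space \<Rightarrow> 'b::topological_space"
  assumes "\<And>p. \<exists>N. open N \<and> p \<in> N \<and> continuous_on N g"
  shows "continuous_on UNIV g"
proof -
  have "isCont g p" for p
    using assms[of p] continuous_on_eq_continuous_at by blast
  then show ?thesis by (simp add: continuous_on_eq_continuous_at)
qed

lemma conformal_factor_gram_vol:
  assumes "c \<in> conformal_charts \<A> \<sigma>" "p \<in> fst c" "pos_form (\<sigma> c p)"
  shows "gram_vol (\<sigma> c p) = conformal_factor \<sigma> c p" "\<sigma> c p v w = conformal_factor \<sigma> c p * (v \<bullet> w)"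
    "conformal_factor \<sigma> c p > 0"
proof -
  obtain f where f: "\<And>v w. \<sigma> c p v w = f * (v \<bullet> w)"
    using assms(1,2) unfolding conformal_charts_def by blast
  then have cf: "conformal_factor \<sigma> c p = f" by (simp add: conformal_factor_def)
  then show "\<sigma> c p v w = conformal_factor \<sigma> c p * (v \<bullet> w)" by (simp add: f)
  show pos: "conformal_factor \<sigma> c p > 0"
    using pos_form_det(2)[OF assms(3)] by (simp add: conformal_factor_def)
  show "gram_vol (\<sigma> c p) = conformal_factor \<sigma> c p"
    using pos cf by (simp add: gram_vol_def f inner_complex_def flip: power2_eq_square)
qed

text \<open>In each chart of the underlying conformal structure the metric is a scalar depending on
  the point times \<open>v \<bullet> w\<close>, which is conformality. The scalar is given as a
  complex number; its real part serves as the factor because the metric is real.\<close>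

lemma canonical_metric_conformal:
  assumes "canonical_metric \<A> g \<sigma>"
  shows "riemannian_metric \<A> \<sigma>" "\<exists>c\<in>conformal_charts \<A> \<sigma>. p \<in> fst c"
proof -
  obtain C where C: "conformal_structure \<A> C" "canonical_metric_of \<A> g C \<sigma>" and R: "riemannian_metric \<A> \<sigma>"
    using assms by (auto simp: canonical_metric_def)
  show "riemannian_metric \<A> \<sigma>" by (rule R)
  obtain c where c: "c \<in> C" "p \<in> fst c" using C(1) unfolding conformal_structure_def by blast
  have "\<exists>\<omega> Y. \<forall>c\<in>C. \<forall>p\<in>fst c. \<forall>v w. complex_of_real (\<sigma> c p v w) =
      (\<Sum>i<g. \<Sum>j<g. of_real (Y i j) * \<omega> i c p * cnj (\<omega> j c p)) * of_real (v \<bullet> w)"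
    using C(2) unfolding canonical_metric_of_def by (elim exE conjE) (rule exI, rule exI, assumption)
  then obtain \<omega> Y where Y: "\<And>c p v w. c \<in> C \<Longrightarrow> p \<in> fst c \<Longrightarrow> complex_of_real (\<sigma> c p v w) =
      (\<Sum>i<g. \<Sum>j<g. of_real (Y i j) * \<omega> i c p * cnj (\<omega> j c p)) * of_real (v \<bullet> w)"
    by blast
  have "\<exists>f. \<forall>v w. \<sigma> c q v w = f * (v \<bullet> w)" if q: "q \<in> fst c" for q
  proof -
    obtain X where X: "\<And>v w. complex_of_real (\<sigma> c q v w) = X * of_real (v \<bullet> w)"
      using Y[OF c(1) q] by blast
    have "\<sigma> c q v w = Re X * (v \<bullet> w)" for v w
      using arg_cong[OF X[of v w], of Re] by simp
    then show ?thesis by blast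
  qed
  then have "c \<in> conformal_charts \<A> \<sigma>"
    using C(1) c(1) by (auto simp: conformal_charts_def conformal_structure_def)
  with c show "\<exists>c\<in>conformal_charts \<A> \<sigma>. p \<in> fst c" by blast
qed

section \<open>Construction, uniqueness and comparison of area measures\<close>

context closed_surface
begin

lemma conformal_oriented: "c \<in> conformal_charts \<A> \<sigma> \<Longrightarrow> c \<in> charts"
  by (simp add: conformal_charts_def)

text \<open>The area of the part of a set inside \<open>P\<close>, transported from one chart. For
  \<open>P\<close> inside the chart the value \<open>undefined\<close> is harmless, since the
  density vanishes off the image of \<open>P\<close>.\<close>

definition chart_area :: "'a metric \<Rightarrow> 'a chart \<Rightarrow> 'a set \<Rightarrow> 'a measure" where
  "chart_area \<sigma> c P = distr (density lborel (\<lambda>z. ennreal (indicator (snd c ` P) z * gram_vol (\<sigma> c (chart_inv c z)))))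
     borel (\<lambda>z. if z \<in> snd c ` fst c then chart_inv c z else undefined)"

lemma chart_inv_measurable:
  assumes "is_chart c"
  shows "(\<lambda>z. if z \<in> snd c ` fst c then chart_inv c z else undefined) \<in> borel_measurable borel"
proof -
  have "chart_inv c \<in> borel_measurable (restrict_space borel (snd c ` fst c))"
    by (rule borel_measurable_continuous_on_restrict[OF chart_inv_continuous[OF assms]])
  then show ?thesis
    using is_chart_open[OF assms] by (subst measurable_If_restrict_space_iff) auto
qed

lemma gram_vol_part_measurable:
  assumes \<sigma>: "riemannian_metric \<A> \<sigma>" and c: "c \<in> charts" and P: "P \<in> sets borel" "P \<subseteq> fst c"
  shows "(\<lambda>z. indicator (snd c ` P) z * gram_vol (\<sigma> c (chart_inv c z))) \<in> borel_measurable borel"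
proof -
  have [measurable]: "snd c ` P \<in> sets borel"
    by (rule chart_image_borel[OF oriented_is_chart[OF c] P])
  note [measurable] = gram_vol_chart_measurable[OF \<sigma> c]
  have "(\<lambda>z. indicator (snd c ` P) z * (indicator (snd c ` fst c) z * gram_vol (\<sigma> c (chart_inv c z)))) \<in> borel_measurable borel"
    by measurable
  also have "(\<lambda>z. indicator (snd c ` P) z * (indicator (snd c ` fst c) z * gram_vol (\<sigma> c (chart_inv c z))))
     = (\<lambda>z. indicator (snd c ` P) z * gram_vol (\<sigma> c (chart_inv c z)))"
    using P by (auto simp: indicator_def fun_eq_iff)
  finally show ?thesis .
qed

lemma emeasure_chart_area:
  assumes \<sigma>: "riemannian_metric \<A> \<sigma>" and c: "c \<in> charts" and P: "P \<in> sets borel" "P \<subseteq> fst c"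
    and S: "S \<in> sets borel"
  shows "emeasure (chart_area \<sigma> c P) S = chart_area_of \<sigma> c (S \<inter> P)"
proof -
  note ic = oriented_is_chart[OF c]
  let ?t = "\<lambda>z. if z \<in> snd c ` fst c then chart_inv c z else undefined"
  note t = chart_inv_measurable[OF ic] and [measurable] = gram_vol_part_measurable[OF \<sigma> c P]
  have "emeasure (chart_area \<sigma> c P) S
      = emeasure (density lborel (\<lambda>z. ennreal (indicator (snd c ` P) z * gram_vol (\<sigma> c (chart_inv c z))))) (?t -` S)"
    unfolding chart_area_def using t S by (subst emeasure_distr) auto
  also have "\<dots> = (\<integral>\<^sup>+z. ennreal (indicator (snd c ` P) z * gram_vol (\<sigma> c (chart_inv c z))) * indicator (?t -` S) z \<partial>lborel)"
    using measurable_sets[OF t S] by (subst emeasure_density) auto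
  also have "\<dots> = chart_area_of \<sigma> c (S \<inter> P)"
  proof (rule nn_integral_cong)
    fix z
    have "z \<in> snd c ` (S \<inter> P) \<longleftrightarrow> z \<in> snd c ` P \<and> z \<in> ?t -` S"
      using P(2) chart_inv_left[OF ic] by (force simp: subset_iff image_iff)
    then show "ennreal (indicator (snd c ` P) z * gram_vol (\<sigma> c (chart_inv c z))) * indicator (?t -` S) z
        = ennreal (gram_vol (\<sigma> c (chart_inv c z))) * indicator (snd c ` (S \<inter> P)) z"
      by (cases "z \<in> snd c ` P"; cases "z \<in> ?t -` S") auto
  qed
  finally show ?thesis .
qed

text \<open>The surface is cut into finitely many Borel pieces, each inside a chart of
  \<open>\<A>\<close>, and the chart measures of the pieces are added. That the sum has the right
  value in every oriented chart is \<open>area_change_chart\<close>, applied piece by piece.\<close>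

lemma area_form_measure_exists:
  assumes \<sigma>: "riemannian_metric \<A> \<sigma>"
  shows "\<exists>\<mu>. area_form_measure \<mu> \<sigma>"
proof -
  define a where "a p = chart_at \<A> p" for p
  have a: "a p \<in> charts" "p \<in> fst (a p)" for p
    using chart_at_atlas atlas_oriented by (auto simp: a_def)
  obtain n :: nat and q P where P: "\<And>i. P i \<in> sets borel" "\<And>i. P i \<subseteq> fst (a (q i))"
    "disjoint_family_on P {..<n}" "(\<Union>i<n. P i) = UNIV"
    using borel_partition[OF compact_surface, of "\<lambda>p. fst (a p)"] a(2) is_chart_open(1)[OF oriented_is_chart[OF a(1)]] by metis
  define M where "M i = chart_area \<sigma> (a (q i)) (P i)" for i
  have sM: "sets (M i) = sets borel" for i by (simp add: M_def chart_area_def)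
  define \<mu> where "\<mu> = measure_of UNIV (sets borel) (\<lambda>S. \<Sum>i<n. emeasure (M i) S)"
  have s\<mu>: "sets \<mu> = sets (borel :: 'a measure)"
    unfolding \<mu>_def using sets.sets_measure_of_eq[of "borel :: 'a measure"] by simp
  have ca: "countably_additive (sets borel) (\<lambda>S. \<Sum>i<n. emeasure (M i) S)"
  proof (rule countably_additiveI)
    fix A :: "nat \<Rightarrow> 'a set" assume A: "range A \<subseteq> sets borel" "disjoint_family A"
    have "suminf (\<lambda>j. \<Sum>i<n. emeasure (M i) (A j)) = (\<Sum>i<n. suminf (\<lambda>j. emeasure (M i) (A j)))"
      by (rule suminf_sum) simp
    also have "\<dots> = (\<Sum>i<n. emeasure (M i) (\<Union>j. A j))"
      using A sM by (intro sum.cong refl suminf_emeasure) auto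
    finally show "suminf (\<lambda>j. \<Sum>i<n. emeasure (M i) (A j)) = (\<Sum>i<n. emeasure (M i) (\<Union>j. A j))" .
  qed
  have em: "emeasure \<mu> S = (\<Sum>i<n. emeasure (M i) S)" if "S \<in> sets borel" for S
  proof (rule emeasure_measure_of[OF \<mu>_def])
    show "positive (sets \<mu>) (\<lambda>S. \<Sum>i<n. emeasure (M i) S)" by (simp add: positive_def)
    show "countably_additive (sets \<mu>) (\<lambda>S. \<Sum>i<n. emeasure (M i) S)" unfolding s\<mu> by (rule ca)
  qed (use that s\<mu> in auto)
  have "emeasure \<mu> S = chart_area_of \<sigma> c S"
    if c: "c \<in> charts" and S: "S \<in> sets borel" "S \<subseteq> fst c" for c S
  proof -
    let ?v = "\<lambda>z. ennreal (gram_vol (\<sigma> c (chart_inv c z)))"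
    have SP: "S \<inter> P i \<in> sets borel" for i using S P(1) by auto
    have img: "snd c ` (S \<inter> P i) \<in> sets borel" for i
      using chart_image_borel[OF oriented_is_chart[OF c] SP] S(2) by blast
    \<comment> \<open>Used to put the pieces together again once all of them are measured in the one
      chart \<open>c\<close>.\<close>
    let ?N = "chart_area \<sigma> c S"
    have "emeasure \<mu> S = (\<Sum>i<n. \<integral>\<^sup>+z\<in>snd (a (q i)) ` (S \<inter> P i). ennreal (gram_vol (\<sigma> (a (q i)) (chart_inv (a (q i)) z))) \<partial>lborel)"
      unfolding em[OF S(1)] M_def using emeasure_chart_area[OF \<sigma> a(1) P(1,2) S(1)] by simp
    also have "\<dots> = (\<Sum>i<n. \<integral>\<^sup>+z\<in>snd c ` (S \<inter> P i). ?v z \<partial>lborel)"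
      using S(2) P(2) by (intro sum.cong refl area_change_chart[OF \<sigma> c _ a(1) _ SP]) auto
    also have "\<dots> = (\<Sum>i<n. emeasure ?N (P i))"
      by (simp add: emeasure_chart_area[OF \<sigma> c S P(1)] Int_commute)
    also have "\<dots> = emeasure ?N (\<Union>i<n. P i)"
      using P by (intro sum_emeasure) (auto simp: chart_area_def)
    also have "\<dots> = (\<integral>\<^sup>+z\<in>snd c ` S. ?v z \<partial>lborel)"
      unfolding P(4) by (simp add: emeasure_chart_area[OF \<sigma> c S])
    finally show ?thesis .
  qed
  with s\<mu> show ?thesis unfolding area_form_measure_def by blast
qed

lemma area_form_measure_sets: "area_form_measure \<mu> \<sigma> \<Longrightarrow> sets \<mu> = sets borel"
  by (simp add: area_form_measure_def)

lemma area_form_measure_emeasure: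
  "area_form_measure \<mu> \<sigma> \<Longrightarrow> c \<in> charts \<Longrightarrow> S \<in> sets borel \<Longrightarrow> S \<subseteq> fst c \<Longrightarrow>
   emeasure \<mu> S = chart_area_of \<sigma> c S"
  by (simp add: area_form_measure_def)

lemma nn_integral_area_form:
  assumes \<mu>: "area_form_measure \<mu> \<sigma>" and \<sigma>: "riemannian_metric \<A> \<sigma>" and c: "c \<in> charts"
    and S: "S \<in> sets borel" "S \<subseteq> fst c" and g: "g \<in> borel_measurable borel"
  shows "(\<integral>\<^sup>+p\<in>S. g p \<partial>\<mu>) = (\<integral>\<^sup>+z\<in>snd c ` S. g (chart_inv c z) * ennreal (gram_vol (\<sigma> c (chart_inv c z))) \<partial>lborel)"
proof -
  note sets = area_form_measure_sets[OF \<mu>]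
  note ic = oriented_is_chart[OF c]
  let ?t = "\<lambda>z. if z \<in> snd c ` fst c then chart_inv c z else undefined"
  note [measurable] = chart_inv_measurable[OF ic] gram_vol_part_measurable[OF \<sigma> c S] g
  have ind: "(indicator S :: 'a \<Rightarrow> ennreal) \<in> borel_measurable \<mu>"
    using S sets by simp
  have g\<mu>: "g \<in> borel_measurable \<mu>" using g sets by (simp cong: measurable_cong_sets)
  have "density \<mu> (indicator S) = chart_area \<sigma> c S"
  proof (rule measure_eqI)
    fix T assume "T \<in> sets (density \<mu> (indicator S))"
    then have T: "T \<in> sets borel" using sets by simp
    have "emeasure (density \<mu> (indicator S)) T = emeasure \<mu> (S \<inter> T)"
      using T S sets by (subst emeasure_density) (auto simp flip: indicator_inter_arith)
    also have "\<dots> = emeasure (chart_area \<sigma> c S) T"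
      using area_form_measure_emeasure[OF \<mu> c, of "S \<inter> T"] emeasure_chart_area[OF \<sigma> c S T] S T
      by (auto simp: Int_commute)
    finally show "emeasure (density \<mu> (indicator S)) T = emeasure (chart_area \<sigma> c S) T" .
  qed (use sets in \<open>auto simp: chart_area_def\<close>)
  then have "(\<integral>\<^sup>+p. g p \<partial>density \<mu> (indicator S)) = (\<integral>\<^sup>+p. g p \<partial>chart_area \<sigma> c S)" by simp
  also have "(\<integral>\<^sup>+p. g p \<partial>density \<mu> (indicator S)) = (\<integral>\<^sup>+p\<in>S. g p \<partial>\<mu>)"
    using ind g\<mu> by (subst nn_integral_density) (auto simp: mult.commute)
  also have "(\<integral>\<^sup>+p. g p \<partial>chart_area \<sigma> c S) =
     (\<integral>\<^sup>+z. ennreal (indicator (snd c ` S) z * gram_vol (\<sigma> c (chart_inv c z))) * g (?t z) \<partial>lborel)"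
    unfolding chart_area_def by (subst nn_integral_distr) (auto simp: nn_integral_density)
  also have "\<dots> = (\<integral>\<^sup>+z\<in>snd c ` S. g (chart_inv c z) * ennreal (gram_vol (\<sigma> c (chart_inv c z))) \<partial>lborel)"
    using S(2) by (intro nn_integral_cong) (auto simp: indicator_def mult.commute)
  finally show ?thesis .
qed

text \<open>Resolves the definite description: the constructed measure has the required values
  because the Gram density is the conformal factor in conformal charts, and it is the only such
  measure because conformal charts cover the surface.\<close>

lemma area_measure_area_form:
  assumes \<sigma>: "riemannian_metric \<A> \<sigma>" and conf: "\<And>p. \<exists>c\<in>conformal_charts \<A> \<sigma>. p \<in> fst c"
  shows "area_form_measure (area_measure \<A> \<sigma>) \<sigma>"
proof -
  obtain \<mu> where \<mu>: "area_form_measure \<mu> \<sigma>" using area_form_measure_exists[OF \<sigma>] by blast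
  have vol: "(\<integral>\<^sup>+z\<in>snd c ` S. ennreal (conformal_factor \<sigma> c (chart_inv c z)) \<partial>lborel)
      = chart_area_of \<sigma> c S"
    if "c \<in> conformal_charts \<A> \<sigma>" "S \<subseteq> fst c" for c S
  proof (rule nn_integral_cong)
    fix z
    have "gram_vol (\<sigma> c (chart_inv c z)) = conformal_factor \<sigma> c (chart_inv c z)" if "z \<in> snd c ` S"
      using chart_inv_in[OF that \<open>S \<subseteq> fst c\<close>]
        conformal_factor_gram_vol(1) metric_pos_form[OF \<sigma>] conformal_oriented \<open>c \<in> conformal_charts \<A> \<sigma>\<close> by metis
    then show "ennreal (conformal_factor \<sigma> c (chart_inv c z)) * indicator (snd c ` S) z
       = ennreal (gram_vol (\<sigma> c (chart_inv c z))) * indicator (snd c ` S) z"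
      by (cases "z \<in> snd c ` S") auto
  qed
  have "area_measure \<A> \<sigma> = \<mu>"
    unfolding area_measure_def
  proof (rule the_equality)
    show "sets \<mu> = sets borel \<and> (\<forall>c\<in>conformal_charts \<A> \<sigma>. \<forall>S\<in>sets borel. S \<subseteq> fst c \<longrightarrow>
        emeasure \<mu> S = (\<integral>\<^sup>+z\<in>snd c ` S. ennreal (conformal_factor \<sigma> c (chart_inv c z)) \<partial>lborel))"
      using area_form_measure_sets[OF \<mu>] area_form_measure_emeasure[OF \<mu>] vol conformal_oriented by simp
    fix \<nu> assume \<nu>: "sets \<nu> = sets borel \<and> (\<forall>c\<in>conformal_charts \<A> \<sigma>. \<forall>S\<in>sets borel. S \<subseteq> fst c \<longrightarrow>
        emeasure \<nu> S = (\<integral>\<^sup>+z\<in>snd c ` S. ennreal (conformal_factor \<sigma> c (chart_inv c z)) \<partial>lborel))"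
    show "\<nu> = \<mu>"
    proof (rule measure_eqI_local[OF compact_surface])
      fix p :: 'a
      obtain c where c: "c \<in> conformal_charts \<A> \<sigma>" "p \<in> fst c" using conf by blast
      have "emeasure \<nu> S = emeasure \<mu> S" if "S \<in> sets borel" "S \<subseteq> fst c" for S
        using \<nu> c that area_form_measure_emeasure[OF \<mu> conformal_oriented[OF c(1)] that] vol[OF c(1) that(2)] by simp
      then show "\<exists>N. open N \<and> p \<in> N \<and> (\<forall>S\<in>sets borel. S \<subseteq> N \<longrightarrow> emeasure \<nu> S = emeasure \<mu> S)"
        using c is_chart_open(1)[OF oriented_is_chart[OF conformal_oriented[OF c(1)]]] by blast
    qed (use \<nu> area_form_measure_sets[OF \<mu>] in auto)
  qed
  with \<mu> show ?thesis by simp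
qed

text \<open>The density is bounded on a closed coordinate ball, so each point has a neighbourhood of
  finite area; compactness leaves finitely many of them.\<close>

lemma area_form_measure_finite:
  assumes \<mu>: "area_form_measure \<mu> \<sigma>" and \<sigma>: "riemannian_metric \<A> \<sigma>"
  shows "finite_measure \<mu>"
proof
  have "\<exists>N. open N \<and> p \<in> N \<and> emeasure \<mu> N \<noteq> \<infinity>" for p
  proof -
    obtain a where a: "a \<in> charts" "p \<in> fst a" using atlas_cover atlas_oriented by blast
    note ia = oriented_is_chart[OF a(1)]
    let ?v = "\<lambda>z. gram_vol (\<sigma> a (chart_inv a z))"
    obtain r where r: "r > 0" "cball (snd a p) r \<subseteq> snd a ` fst a"
      using is_chart_open(2)[OF ia] a(2) open_contains_cball by blast
    have "continuous_on (snd a ` fst a) ?v"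
      by (rule continuous_on_compose2[OF gram_vol_continuous[OF \<sigma> a(1)] chart_inv_continuous[OF ia]])
         (use chart_inv_in[of _ a "fst a"] in auto)
    then have "compact (?v ` cball (snd a p) r)"
      using r compact_continuous_image continuous_on_subset compact_cball by metis
    then obtain B where "\<forall>x\<in>?v ` cball (snd a p) r. norm x \<le> B"
      using compact_imp_bounded bounded_iff by metis
    then have B: "\<bar>?v z\<bar> \<le> B" if "z \<in> cball (snd a p) r" for z
      using that by auto
    let ?N = "chart_inv a ` ball (snd a p) r"
    have sub: "ball (snd a p) r \<subseteq> snd a ` fst a" using r(2) ball_subset_cball by blast
    have N: "open ?N" "p \<in> ?N" "?N \<subseteq> fst a"
      using chart_inv_image_open[OF ia open_ball sub] r(1) a(2) chart_inv_left[OF ia a(2)]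
        chart_inv_in[of _ a "fst a"] sub by (auto simp: image_iff intro!: bexI[of _ "snd a p"])
    have img: "snd a ` ?N = ball (snd a p) r"
      using sub chart_inv_right[of _ a "fst a"] by (force simp: image_image subset_iff)
    have "emeasure \<mu> ?N = (\<integral>\<^sup>+z\<in>ball (snd a p) r. ennreal (?v z) \<partial>lborel)"
      using area_form_measure_emeasure[OF \<mu> a(1) _ N(3)] N(1) img by simp
    also have "\<dots> \<le> (\<integral>\<^sup>+z\<in>ball (snd a p) r. ennreal B \<partial>lborel)"
      using order_trans[OF abs_ge_self B] ball_subset_cball
      by (intro nn_integral_mono) (auto simp: indicator_def intro!: ennreal_leI)
    also have "\<dots> = ennreal B * emeasure lborel (ball (snd a p) r)"
      by (subst nn_integral_cmult_indicator) auto
    also have "\<dots> < \<infinity>"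
      using emeasure_lborel_ball_finite[of "snd a p" r] by (simp add: ennreal_mult_less_top less_top)
    finally have "emeasure \<mu> ?N \<noteq> \<infinity>" by simp
    with N(1,2) show ?thesis by (intro exI[of _ ?N] conjI)
  qed
  then obtain N where N: "\<And>p. open (N p) \<and> p \<in> N p \<and> emeasure \<mu> (N p) \<noteq> \<infinity>" by metis
  obtain F where F: "finite F" "UNIV = (\<Union>p\<in>F. N p)"
    using compact_surface N by (rule_tac compactE_image[of UNIV UNIV N]) auto
  have "emeasure \<mu> (space \<mu>) = emeasure \<mu> (\<Union>p\<in>F. N p)"
    using area_form_measure_sets[OF \<mu>] F(2) by (metis sets_eq_imp_space_eq space_borel)
  also have "\<dots> \<le> (\<Sum>p\<in>F. emeasure \<mu> (N p))"
    using F N area_form_measure_sets[OF \<mu>] by (intro emeasure_subadditive_finite) auto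
  also have "\<dots> < \<infinity>" using F N by (auto simp: less_top)
  finally show "emeasure \<mu> (space \<mu>) \<noteq> \<infinity>" by simp
qed

definition area_ratio :: "'a metric \<Rightarrow> 'a metric \<Rightarrow> 'a \<Rightarrow> real" where
  "area_ratio \<sigma> \<rho> p = gram_vol (\<sigma> (chart_at \<A> p) p) / gram_vol (\<rho> (chart_at \<A> p) p)"

text \<open>Both densities acquire the same Jacobian factor under a change of chart, and it cancels
  in the quotient.\<close>

lemma area_ratio_eq:
  assumes "riemannian_metric \<A> \<sigma>" "riemannian_metric \<A> \<rho>" "c \<in> charts" "p \<in> fst c"
  shows "area_ratio \<sigma> \<rho> p = gram_vol (\<sigma> c p) / gram_vol (\<rho> c p)"
proof -
  have a: "chart_at \<A> p \<in> charts" "p \<in> fst (chart_at \<A> p)"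
    using chart_at_atlas atlas_oriented by auto
  show ?thesis
    unfolding area_ratio_def gram_vol_transform[OF assms(1) assms(3,4) a] gram_vol_transform[OF assms(2) assms(3,4) a]
    using transition_deriv(2)[OF assms(3,4) a] by simp
qed

lemma area_ratio_continuous:
  assumes "riemannian_metric \<A> \<sigma>" "riemannian_metric \<A> \<rho>"
  shows "continuous_on UNIV (area_ratio \<sigma> \<rho>)"
proof (rule continuous_on_UNIV_local)
  fix p
  obtain a where a: "a \<in> charts" "p \<in> fst a" using atlas_cover atlas_oriented by blast
  have "gram_vol (\<rho> a q) \<noteq> 0" if "q \<in> fst a" for q
    using gram_vol_pos[OF metric_pos_form[OF assms(2) a(1) that]] by simp
  then have "continuous_on (fst a) (\<lambda>q. gram_vol (\<sigma> a q) / gram_vol (\<rho> a q))"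
    by (intro continuous_on_divide gram_vol_continuous assms a) auto
  then have "continuous_on (fst a) (area_ratio \<sigma> \<rho>)"
    using area_ratio_eq[OF assms a(1)] by (simp cong: continuous_on_cong)
  then show "\<exists>N. open N \<and> p \<in> N \<and> continuous_on N (area_ratio \<sigma> \<rho>)"
    using a is_chart_open(1)[OF oriented_is_chart[OF a(1)]] by blast
qed

text \<open>Refers the area of a varying metric to one fixed measure, so that differentiation in the
  parameter only concerns integrands.\<close>

lemma area_form_measure_density:
  assumes \<mu>: "area_form_measure \<mu> \<rho>" and \<nu>: "area_form_measure \<nu> \<sigma>"
    and \<sigma>: "riemannian_metric \<A> \<sigma>" and \<rho>: "riemannian_metric \<A> \<rho>"
  shows "\<nu> = density \<mu> (\<lambda>p. ennreal (area_ratio \<sigma> \<rho> p))"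
proof (rule measure_eqI_local[OF compact_surface])
  note [measurable] = borel_measurable_continuous_onI[OF area_ratio_continuous[OF \<sigma> \<rho>]]
  fix p :: 'a
  obtain a where a: "a \<in> charts" "p \<in> fst a" using atlas_cover atlas_oriented by blast
  have "emeasure \<nu> S = emeasure (density \<mu> (\<lambda>p. ennreal (area_ratio \<sigma> \<rho> p))) S" if S: "S \<in> sets borel" "S \<subseteq> fst a" for S
  proof -
    have "emeasure (density \<mu> (\<lambda>p. ennreal (area_ratio \<sigma> \<rho> p))) S = (\<integral>\<^sup>+p\<in>S. ennreal (area_ratio \<sigma> \<rho> p) \<partial>\<mu>)"
      using S area_form_measure_sets[OF \<mu>] by (subst emeasure_density) (auto cong: measurable_cong_sets)
    also have "\<dots> = (\<integral>\<^sup>+z\<in>snd a ` S. ennreal (area_ratio \<sigma> \<rho> (chart_inv a z)) * ennreal (gram_vol (\<rho> a (chart_inv a z))) \<partial>lborel)"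
      by (rule nn_integral_area_form[OF \<mu> \<rho> a(1) S]) measurable
    also have "\<dots> = chart_area_of \<sigma> a S"
    proof (rule nn_integral_cong)
      fix z
      have "ennreal (area_ratio \<sigma> \<rho> (chart_inv a z)) * ennreal (gram_vol (\<rho> a (chart_inv a z))) = ennreal (gram_vol (\<sigma> a (chart_inv a z)))"
        if z: "z \<in> snd a ` S"
      proof -
        note q = chart_inv_in[OF z S(2)]
        show ?thesis
          using gram_vol_pos[OF metric_pos_form[OF \<rho> a(1) q]] gram_vol_pos[OF metric_pos_form[OF \<sigma> a(1) q]]
          by (simp add: area_ratio_eq[OF \<sigma> \<rho> a(1) q] flip: ennreal_mult)
      qed
      then show "ennreal (area_ratio \<sigma> \<rho> (chart_inv a z)) * ennreal (gram_vol (\<rho> a (chart_inv a z))) * indicator (snd a ` S) z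
        = ennreal (gram_vol (\<sigma> a (chart_inv a z))) * indicator (snd a ` S) z"
        by (cases "z \<in> snd a ` S") auto
    qed
    also have "\<dots> = emeasure \<nu> S" using area_form_measure_emeasure[OF \<nu> a(1) S] by simp
    finally show ?thesis by simp
  qed
  then show "\<exists>N. open N \<and> p \<in> N \<and> (\<forall>S\<in>sets borel. S \<subseteq> N \<longrightarrow> emeasure \<nu> S = emeasure (density \<mu> (\<lambda>p. ennreal (area_ratio \<sigma> \<rho> p))) S)"
    using a is_chart_open(1)[OF oriented_is_chart[OF a(1)]] by blast
qed (use area_form_measure_sets[OF \<mu>] area_form_measure_sets[OF \<nu>] in auto)

text \<open>The image of the area measure under the inverse of \<open>w\<close> has density \<open>j\<close>, by the change of variables
  formula in charts.\<close>

lemma nn_integral_jacobian_bijection: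
  assumes \<mu>: "area_form_measure \<mu> \<rho>" and \<rho>: "riemannian_metric \<A> \<rho>"
    and w: "continuous_on UNIV w" "bij w" and j: "continuous_on UNIV j" "\<And>p. j p \<ge> 0"
    and der: "\<And>a b p. a \<in> \<A> \<Longrightarrow> b \<in> \<A> \<Longrightarrow> p \<in> fst a \<Longrightarrow> w p \<in> fst b \<Longrightarrow>
      (local_rep w a b has_derivative frechet_derivative (local_rep w a b) (at (snd a p))) (at (snd a p)) \<and>
      det2 (frechet_derivative (local_rep w a b) (at (snd a p))) * gram_vol (\<rho> b (w p)) = j p * gram_vol (\<rho> a p)"
  shows "(\<integral>\<^sup>+p. ennreal (j p) \<partial>\<mu>) = emeasure \<mu> UNIV"
proof -
  note sets = area_form_measure_sets[OF \<mu>]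
  have space: "space \<mu> = UNIV" using sets_eq_imp_space_eq[OF sets] by simp
  have jm[measurable]: "j \<in> borel_measurable borel" by (rule borel_measurable_continuous_onI[OF j(1)])
  have inj: "inj w" using w(2) bij_is_inj by blast
  \<comment> \<open>A continuous bijection of a compact Hausdorff space has a continuous inverse.
    Images under \<open>w\<close> are preimages under this inverse, hence Borel.\<close>
  have "continuous_on (w ` UNIV) (inv_into UNIV w)"
    by (rule continuous_on_inv[OF w(1) compact_surface]) (simp add: inj)
  then have "continuous_on UNIV (inv_into UNIV w)" using w(2) by (simp add: bij_is_surj)
  then have invm: "inv_into UNIV w \<in> borel_measurable borel" by (rule borel_measurable_continuous_onI)
  then have invm': "inv_into UNIV w \<in> measurable \<mu> borel" using sets by (simp cong: measurable_cong_sets)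
  have wim: "w ` S = inv_into UNIV w -` S" for S
    using bij_is_surj[OF w(2)] inj by (auto simp: image_iff) (metis surj_f_inv_f)
  have wb: "w ` S \<in> sets borel" if "S \<in> sets borel" for S
    using measurable_sets[OF invm that] by (simp add: wim)
  have "distr \<mu> borel (inv_into UNIV w) = density \<mu> (\<lambda>p. ennreal (j p))"
  proof (rule measure_eqI_local[OF compact_surface])
    fix p :: 'a
    obtain a where a: "a \<in> \<A>" "p \<in> fst a" using atlas_cover by blast
    obtain b where b: "b \<in> \<A>" "w p \<in> fst b" using atlas_cover by blast
    have oa: "a \<in> charts" and ob: "b \<in> charts" using a b atlas_oriented by auto
    note ia = oriented_is_chart[OF oa] and ib = oriented_is_chart[OF ob]
    let ?N = "fst a \<inter> w -` fst b"
    have N: "open ?N" "p \<in> ?N"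
      using a b is_chart_open(1)[OF ia] is_chart_open(1)[OF ib] w(1) open_vimage[of "fst b" w] by auto
    have "emeasure (distr \<mu> borel (inv_into UNIV w)) S = emeasure (density \<mu> (\<lambda>p. ennreal (j p))) S"
      if S: "S \<in> sets borel" "S \<subseteq> ?N" for S
    proof -
      have Sa: "S \<subseteq> fst a" and Sb: "w ` S \<subseteq> fst b" using S by auto
      have "emeasure (distr \<mu> borel (inv_into UNIV w)) S = emeasure \<mu> (w ` S)"
        using invm' S by (subst emeasure_distr) (auto simp: wim space)
      also have "\<dots> = chart_area_of \<rho> b (w ` S)"
        by (rule area_form_measure_emeasure[OF \<mu> ob wb[OF S(1)] Sb])
      also have "\<dots> = (\<integral>\<^sup>+z\<in>snd a ` S. ennreal (j (chart_inv a z)) * ennreal (gram_vol (\<rho> a (chart_inv a z))) \<partial>lborel)"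
        by (rule area_pullback[OF \<rho> oa ob w(1) inj wb j der[OF a(1) b(1)] S(1) Sa Sb])
      also have "\<dots> = (\<integral>\<^sup>+p\<in>S. ennreal (j p) \<partial>\<mu>)"
        by (rule nn_integral_area_form[OF \<mu> \<rho> oa S(1) Sa, symmetric]) measurable
      also have "\<dots> = emeasure (density \<mu> (\<lambda>p. ennreal (j p))) S"
        using S sets by (subst emeasure_density) (auto cong: measurable_cong_sets)
      finally show ?thesis .
    qed
    with N show "\<exists>N. open N \<and> p \<in> N \<and> (\<forall>S\<in>sets borel. S \<subseteq> N \<longrightarrow> emeasure (distr \<mu> borel (inv_into UNIV w)) S = emeasure (density \<mu> (\<lambda>p. ennreal (j p))) S)"
      by blast
  qed (use sets in auto)
  then have "emeasure (distr \<mu> borel (inv_into UNIV w)) UNIV = emeasure (density \<mu> (\<lambda>p. ennreal (j p))) UNIV" by simp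
  moreover have "emeasure (distr \<mu> borel (inv_into UNIV w)) UNIV = emeasure \<mu> UNIV"
    using invm' by (subst emeasure_distr) (auto simp: space)
  moreover have "emeasure (density \<mu> (\<lambda>p. ennreal (j p))) UNIV = (\<integral>\<^sup>+p. ennreal (j p) \<partial>\<mu>)"
    using sets by (subst emeasure_density) (auto cong: measurable_cong_sets)
  ultimately show ?thesis by simp
qed

end

section \<open>Energy density and Hopf differential in charts\<close>

lemma Ck_on_eq: "open S \<Longrightarrow> Ck_on k S f \<Longrightarrow> (\<And>x. x \<in> S \<Longrightarrow> f x = g x) \<Longrightarrow> Ck_on k S g"
  using Ck_on_cong[of S f g k] by simp

context closed_surface
begin

text \<open>Links a fixed pair of charts \<open>a\<close>, \<open>b\<close> with the pair
  \<open>c\<close>, \<open>d\<close> in which the densities are evaluated.\<close>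

lemma local_rep_has_derivative:
  assumes c: "c \<in> charts" "p \<in> fst c" and a: "a \<in> charts" "p \<in> fst a"
    and d: "d \<in> charts" "w p \<in> fst d" and b: "b \<in> charts" "w p \<in> fst b"
    and w: "continuous_on UNIV w" and A: "(local_rep w a b has_derivative A) (at (snd a p))"
  shows "(local_rep w c d has_derivative trans_deriv b d (w p) \<circ> A \<circ> trans_deriv c a p) (at (snd c p))"
proof -
  note ic = oriented_is_chart[OF c(1)] and ia = oriented_is_chart[OF a(1)]
    and id = oriented_is_chart[OF d(1)] and ib = oriented_is_chart[OF b(1)]
  have "transition c a (snd c p) = snd a p" using c ic by (simp add: transition_def chart_inv_left)
  with A have "(local_rep w a b has_derivative A) (at (transition c a (snd c p)))" by simp
  from diff_chain_at[OF transition_deriv(1)[OF c a] this]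
  have 1: "(local_rep w a b \<circ> transition c a has_derivative A \<circ> trans_deriv c a p) (at (snd c p))" .
  have "(local_rep w a b \<circ> transition c a) (snd c p) = snd b (w p)"
    using c a ic ia by (simp add: transition_def local_rep_def chart_inv_left)
  then have "(transition b d has_derivative trans_deriv b d (w p)) (at ((local_rep w a b \<circ> transition c a) (snd c p)))"
    using transition_deriv(1)[OF b d] by simp
  from diff_chain_at[OF 1 this]
  have 2: "(transition b d \<circ> (local_rep w a b \<circ> transition c a) has_derivative trans_deriv b d (w p) \<circ> (A \<circ> trans_deriv c a p)) (at (snd c p))" .
  let ?N = "fst c \<inter> fst a \<inter> w -` (fst b \<inter> fst d)"
  have "open (w -` (fst b \<inter> fst d))"
    using w by (intro open_vimage open_Int is_chart_open(1)[OF ib] is_chart_open(1)[OF id])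
  then have "open (snd c ` ?N)"
    by (intro chart_image_open[OF ic] open_Int is_chart_open(1)[OF ia] is_chart_open(1)[OF ic]) auto
  moreover have "snd c p \<in> snd c ` ?N" using a b c d by (intro imageI) simp
  moreover have "(transition b d \<circ> (local_rep w a b \<circ> transition c a)) z = local_rep w c d z" if "z \<in> snd c ` ?N" for z
    using that ic ia ib by (auto simp: transition_def local_rep_def chart_inv_left)
  ultimately show ?thesis
    using has_derivative_transform_within_open[OF 2, of "snd c ` ?N" "local_rep w c d"] by (simp add: comp_assoc)
qed

text \<open>The left sides refer to chosen conformal charts \<open>c\<close> at \<open>p\<close> and
  \<open>d\<close> at \<open>w p\<close>, the right sides only to the given charts \<open>a\<close>
  and \<open>b\<close>. With \<open>T\<close> and \<open>U\<close> the derivatives of the coordinate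
  changes from \<open>a\<close> to \<open>c\<close> and from \<open>b\<close> to \<open>d\<close>,
  the derivative of \<open>w\<close> in \<open>c\<close> and \<open>d\<close> is the map
  \<open>A'\<close> with \<open>A' (T v) = U (A v)\<close>. Both metrics are scalar in the new
  coordinates, so \<open>conformal_densities\<close> applies to \<open>T\<close> and
  \<open>A'\<close>. The Hopf differential may be evaluated in a further chart \<open>e\<close>, on
  the vector that has coordinate \<open>1\<close> in \<open>a\<close>.\<close>

lemma density_formulas:
  assumes \<sigma>: "riemannian_metric \<A> \<sigma>" "\<And>p. \<exists>c\<in>conformal_charts \<A> \<sigma>. p \<in> fst c"
    and \<rho>: "riemannian_metric \<A> \<rho>" "\<And>p. \<exists>c\<in>conformal_charts \<A> \<rho>. p \<in> fst c"
    and w: "continuous_on UNIV w" and a: "a \<in> charts" "p \<in> fst a" and b: "b \<in> charts" "w p \<in> fst b"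
    and A: "(local_rep w a b has_derivative A) (at (snd a p))" and e: "e \<in> charts" "p \<in> fst e"
    and B: "\<And>v v'. B v v' = \<rho> b (w p) (A v) (A v')"
  shows "H_density \<A> \<sigma> \<rho> w p + L_density \<A> \<sigma> \<rho> w p = energy_form (\<sigma> a p) B / gram_vol (\<sigma> a p)"
    "H_density \<A> \<sigma> \<rho> w p - L_density \<A> \<sigma> \<rho> w p = gram_vol (\<rho> b (w p)) * det2 A / gram_vol (\<sigma> a p)"
    "hopf_differential \<A> \<sigma> \<rho> w e p (trans_deriv a e p 1) = Complex (hopf_re (\<sigma> a p) B) (hopf_im (\<sigma> a p) B)"
    "H_density \<A> \<sigma> \<rho> w p * L_density \<A> \<sigma> \<rho> w p * (\<sigma> a p 1 1)\<^sup>2 = (hopf_re (\<sigma> a p) B)\<^sup>2 + (hopf_im (\<sigma> a p) B)\<^sup>2"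
proof -
  define c where "c = chart_at (conformal_charts \<A> \<sigma>) p"
  define d where "d = chart_at (conformal_charts \<A> \<rho>) (w p)"
  have cc: "c \<in> conformal_charts \<A> \<sigma>" and c: "c \<in> charts" "p \<in> fst c"
    using \<sigma>(2)[of p] chart_at_in[of _ "conformal_charts \<A> \<sigma>" p] conformal_oriented[of c \<sigma>] unfolding c_def by auto
  have dc: "d \<in> conformal_charts \<A> \<rho>" and d: "d \<in> charts" "w p \<in> fst d"
    using \<rho>(2)[of "w p"] chart_at_in[of _ "conformal_charts \<A> \<rho>" "w p"] conformal_oriented[of d \<rho>] unfolding d_def by auto
  define T U where "T = trans_deriv a c p" and "U = trans_deriv b d (w p)"
  define A' where "A' = U \<circ> A \<circ> trans_deriv c a p"
  have linA: "linear A" using A has_derivative_linear by blast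
  have linT: "linear T" unfolding T_def by (rule trans_deriv_linear[OF a c])
  have linU: "linear U" unfolding U_def by (rule trans_deriv_linear[OF b d])
  have A': "(local_rep w c d has_derivative A') (at (snd c p))"
    unfolding A'_def U_def by (rule local_rep_has_derivative[OF c a d b w A])
  then have linA': "linear A'" using has_derivative_linear by blast
  have AT: "A' (T v) = U (A v)" for v
    by (simp add: A'_def T_def trans_deriv_inverse[OF a c])
  have detT: "det2 T > 0" unfolding T_def by (rule transition_deriv(2)[OF a c])
  define f r where "f = conformal_factor \<sigma> c p" and "r = conformal_factor \<rho> d (w p)"
  note pa = metric_pos_form[OF \<sigma>(1) a] and pd = metric_pos_form[OF \<rho>(1) d]
  note cf = conformal_factor_gram_vol[OF cc c(2) metric_pos_form[OF \<sigma>(1) c]]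
  note df = conformal_factor_gram_vol[OF dc d(2) pd]
  have conf: "\<sigma> a p v v' = f * (T v \<bullet> T v')" for v v'
    unfolding metric_transform[OF \<sigma>(1) a c] cf(2) f_def T_def ..
  have BT: "B v v' = r * (A' (T v) \<bullet> A' (T v'))" for v v'
    unfolding B metric_transform[OF \<rho>(1) b d] df(2) r_def AT U_def ..
  define \<alpha> \<beta> where "\<alpha> = (A' 1 - \<i> * A' \<i>) / 2" and "\<beta> = (A' 1 + \<i> * A' \<i>) / 2"
  note cd = conformal_densities[OF pa linT detT conf linA' BT, folded \<alpha>_def \<beta>_def]
  have fd: "frechet_derivative (local_rep w c d) (at (snd c p)) = A'"
    using frechet_derivative_at[OF A'] by simp
  have pz: "pd_z (local_rep w c d) (snd c p) = \<alpha>" "pd_zbar (local_rep w c d) (snd c p) = \<beta>"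
    by (simp_all add: pd_z_def pd_zbar_def fd \<alpha>_def \<beta>_def)
  have "((\<lambda>z. cnj (local_rep w c d z)) has_derivative (\<lambda>v. cnj (A' v))) (at (snd c p))"
    by (rule has_derivative_cnj[OF A'])
  then have "frechet_derivative (\<lambda>z. cnj (local_rep w c d z)) (at (snd c p)) = (\<lambda>v. cnj (A' v))"
    using frechet_derivative_at by metis
  then have pzc: "pd_z (\<lambda>z. cnj (local_rep w c d z)) (snd c p) = cnj \<beta>"
    by (simp add: pd_z_def \<beta>_def)
  have H: "H_density \<A> \<sigma> \<rho> w p = r / f * (cmod \<alpha>)\<^sup>2" and L: "L_density \<A> \<sigma> \<rho> w p = r / f * (cmod \<beta>)\<^sup>2"
    by (simp_all add: H_density_def L_density_def Let_def pz r_def f_def flip: c_def d_def)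
  have vol: "gram_vol (\<sigma> a p) \<noteq> 0" using gram_vol_pos[OF pa] by simp
  show "H_density \<A> \<sigma> \<rho> w p + L_density \<A> \<sigma> \<rho> w p = energy_form (\<sigma> a p) B / gram_vol (\<sigma> a p)"
    unfolding H L cd(1) nonzero_mult_div_cancel_left[OF vol] by (simp only: distrib_left)
  have "A' \<circ> T = U \<circ> A" using AT by (auto simp: fun_eq_iff)
  then have "det2 A' * det2 T = det2 U * det2 A"
    using det2_comp[OF linA' linT] det2_comp[OF linU linA] by simp
  moreover have "gram_vol (\<rho> b (w p)) = det2 U * r"
    unfolding gram_vol_transform[OF \<rho>(1) b d] df(1) r_def U_def ..
  ultimately have J: "gram_vol (\<rho> b (w p)) * det2 A = r * det2 A' * det2 T" by simp
  show "H_density \<A> \<sigma> \<rho> w p - L_density \<A> \<sigma> \<rho> w p = gram_vol (\<rho> b (w p)) * det2 A / gram_vol (\<sigma> a p)"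
    unfolding J H L cd(2) nonzero_mult_div_cancel_left[OF vol] by (simp only: right_diff_distrib)
  have "hopf_differential \<A> \<sigma> \<rho> w e p (trans_deriv a e p 1) = of_real r * \<alpha> * cnj \<beta> * (T 1)\<^sup>2"
    unfolding hopf_differential_def Let_def c_def[symmetric] d_def[symmetric] hopf_coeff_def pz pzc r_def[symmetric]
      T_def trans_deriv_comp[OF a e c] ..
  with cd(3) show "hopf_differential \<A> \<sigma> \<rho> w e p (trans_deriv a e p 1) = Complex (hopf_re (\<sigma> a p) B) (hopf_im (\<sigma> a p) B)"
    by simp
  have E: "\<sigma> a p 1 1 = f * (cmod (T 1))\<^sup>2" by (simp add: conf power2_norm_eq_inner)
  have "(hopf_re (\<sigma> a p) B)\<^sup>2 + (hopf_im (\<sigma> a p) B)\<^sup>2 = (cmod (Complex (hopf_re (\<sigma> a p) B) (hopf_im (\<sigma> a p) B)))\<^sup>2"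
    by (simp add: cmod_power2)
  also have "\<dots> = r\<^sup>2 * (cmod \<alpha>)\<^sup>2 * (cmod \<beta>)\<^sup>2 * ((cmod (T 1))\<^sup>2)\<^sup>2"
    unfolding cd(3) by (simp add: norm_mult power_mult_distrib norm_power flip: power_mult)
  finally show "H_density \<A> \<sigma> \<rho> w p * L_density \<A> \<sigma> \<rho> w p * (\<sigma> a p 1 1)\<^sup>2 = (hopf_re (\<sigma> a p) B)\<^sup>2 + (hopf_im (\<sigma> a p) B)\<^sup>2"
    unfolding H L E using cf(3) by (simp add: f_def[symmetric] field_simps power2_eq_square)
qed

text \<open>Regularity is required only for parameters near 0, on a box whose size may depend on the
  chart and on the point; compactness supplies a common radius afterwards.\<close>

definition Ck_fam :: "nat \<Rightarrow> ('p::real_normed_vector \<Rightarrow> 'a \<Rightarrow> real) \<Rightarrow> bool" where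
  "Ck_fam k f \<longleftrightarrow> (\<forall>a\<in>\<A>. \<forall>p\<in>fst a. \<exists>\<delta>>0. \<exists>r>0. ball (snd a p) r \<subseteq> snd a ` fst a \<and>
     Ck_on k (ball 0 \<delta> \<times> ball (snd a p) r) (\<lambda>x. f (fst x) (chart_inv a (snd x))))"

lemma chart_ball_nhd:
  assumes "a \<in> \<A>" "p \<in> fst a" "r > 0"
  shows "open (snd a -` ball (snd a p) r \<inter> fst a)" "p \<in> snd a -` ball (snd a p) r \<inter> fst a"
  using assms continuous_on_open_vimage[OF is_chart_open(1)[OF atlas_is_chart[OF assms(1)]], of "snd a"]
    is_chart_continuous[OF atlas_is_chart[OF assms(1)]] by auto

lemma Ck_fam_binop:
  fixes f g :: "'p::real_normed_vector \<Rightarrow> 'a \<Rightarrow> real"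
  assumes op: "\<And>S (f :: 'p \<times> complex \<Rightarrow> real) g. open S \<Longrightarrow> Ck_on k S f \<Longrightarrow> Ck_on k S g \<Longrightarrow> Ck_on k S (\<lambda>x. h (f x) (g x))"
    and f: "Ck_fam k f" and g: "Ck_fam k g"
  shows "Ck_fam k (\<lambda>s p. h (f s p) (g s p))"
  unfolding Ck_fam_def
proof (intro ballI)
  fix a p assume ap: "a \<in> \<A>" "p \<in> fst a"
  obtain d1 r1 where 1: "d1 > 0" "r1 > 0" "ball (snd a p) r1 \<subseteq> snd a ` fst a"
      "Ck_on k (ball 0 d1 \<times> ball (snd a p) r1) (\<lambda>x. f (fst x) (chart_inv a (snd x)))"
    using f ap unfolding Ck_fam_def by blast
  obtain d2 r2 where 2: "d2 > 0" "r2 > 0" "ball (snd a p) r2 \<subseteq> snd a ` fst a"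
      "Ck_on k (ball 0 d2 \<times> ball (snd a p) r2) (\<lambda>x. g (fst x) (chart_inv a (snd x)))"
    using g ap unfolding Ck_fam_def by blast
  let ?V = "ball (0::'p) (min d1 d2) \<times> ball (snd a p) (min r1 r2)"
  have V: "open ?V" by (intro open_Times open_ball)
  have o: "open (ball (0::'p) d \<times> ball (snd a p) r)" for d r by (intro open_Times open_ball)
  have "Ck_on k ?V (\<lambda>x. f (fst x) (chart_inv a (snd x)))"
    by (rule Ck_on_subset[OF o V _ 1(4)]) auto
  moreover have "Ck_on k ?V (\<lambda>x. g (fst x) (chart_inv a (snd x)))"
    by (rule Ck_on_subset[OF o V _ 2(4)]) auto
  ultimately have "Ck_on k ?V (\<lambda>x. h (f (fst x) (chart_inv a (snd x))) (g (fst x) (chart_inv a (snd x))))"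
    by (rule op[OF V])
  moreover have "ball (snd a p) (min r1 r2) \<subseteq> snd a ` fst a" using 1(3) by auto
  ultimately show "\<exists>\<delta>>0. \<exists>r>0. ball (snd a p) r \<subseteq> snd a ` fst a \<and>
     Ck_on k (ball 0 \<delta> \<times> ball (snd a p) r) (\<lambda>x. h (f (fst x) (chart_inv a (snd x))) (g (fst x) (chart_inv a (snd x))))"
    using 1 2 by (intro exI[of _ "min d1 d2"] exI[of _ "min r1 r2"] conjI) auto
qed

lemma Ck_fam_isCont:
  assumes "Ck_fam k f" "a \<in> \<A>" "p \<in> fst a"
  shows "\<exists>N \<delta>. open N \<and> p \<in> N \<and> \<delta> > 0 \<and> (\<forall>s\<in>ball 0 \<delta>. \<forall>q\<in>N. isCont (\<lambda>(s, q). f s q) (s, q))"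
proof -
  obtain d r where d: "d > 0" "r > 0" "ball (snd a p) r \<subseteq> snd a ` fst a"
      "Ck_on k (ball 0 d \<times> ball (snd a p) r) (\<lambda>x. f (fst x) (chart_inv a (snd x)))"
    using assms unfolding Ck_fam_def by blast
  note ia = atlas_is_chart[OF assms(2)]
  let ?N = "snd a -` ball (snd a p) r \<inter> fst a"
  note N = chart_ball_nhd[OF assms(2,3) d(2)]
  have "continuous_on (ball 0 d \<times> ball (snd a p) r) (\<lambda>x. f (fst x) (chart_inv a (snd x)))"
    by (rule Ck_on_continuous[OF _ d(4)]) (intro open_Times open_ball)
  then have "continuous_on (ball 0 d \<times> ?N) (\<lambda>y. f (fst (fst y, snd a (snd y))) (chart_inv a (snd (fst y, snd a (snd y)))))"
    by (rule continuous_on_compose2)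
       (auto intro!: continuous_intros continuous_on_compose2[OF is_chart_continuous[OF ia]])
  then have "continuous_on (ball 0 d \<times> ?N) (\<lambda>(s, q). f s q)"
    by (rule continuous_on_eq) (use ia in \<open>auto simp: chart_inv_left\<close>)
  moreover have "open (ball 0 d \<times> ?N)" using N by (intro open_Times) auto
  ultimately have "isCont (\<lambda>(s, q). f s q) (s, q)" if "s \<in> ball 0 d" "q \<in> ?N" for s q
    using that continuous_on_eq_continuous_at by blast
  then show ?thesis using N d(1) by (intro exI[of _ ?N] exI[of _ d] conjI ballI)
qed

text \<open>Continuity at a point of the product is a pointwise condition, hence suited to
  \<open>compact_uniform_nhd\<close>; that is why the local statement is phrased with
  \<open>isCont\<close>.\<close>

lemma Ck_fam_continuous:
  assumes "Ck_fam k f"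
  shows "\<exists>\<delta>>0. continuous_on (ball 0 \<delta> \<times> UNIV) (\<lambda>(s, q). f s q)"
proof -
  have "\<exists>N \<delta>. open N \<and> p \<in> N \<and> \<delta> > 0 \<and> (\<forall>s\<in>ball 0 \<delta>. \<forall>q\<in>N. isCont (\<lambda>(s, q). f s q) (s, q))" for p
  proof -
    obtain a where "a \<in> \<A>" "p \<in> fst a" using atlas_cover by blast
    then show ?thesis by (rule Ck_fam_isCont[OF assms])
  qed
  from compact_uniform_nhd[OF compact_surface this] obtain \<delta> where "\<delta> > 0"
      "\<forall>s\<in>ball 0 \<delta>. \<forall>q. isCont (\<lambda>(s, q). f s q) (s, q)"
    by blast
  then show ?thesis
    by (intro exI[of _ \<delta>] conjI continuous_at_imp_continuous_on) auto
qed

lemma Ck_fam_pos: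
  assumes "Ck_fam k f" "\<And>p. f 0 p > 0"
  shows "\<exists>\<delta>>0. \<forall>s\<in>ball 0 \<delta>. \<forall>p. f s p > 0"
proof (rule compact_uniform_nhd[OF compact_surface])
  fix p
  obtain d where d: "d > 0" "continuous_on (ball 0 d \<times> UNIV) (\<lambda>(s, q). f s q)"
    using Ck_fam_continuous[OF assms(1)] by blast
  have "open (ball 0 d \<times> (UNIV :: 'a set))" by (intro open_Times) auto
  from open_vimage_on[OF this d(2), of "{0<..}"]
  have "open ((\<lambda>(s, q). f s q) -` {0<..} \<inter> (ball 0 d \<times> UNIV))" by simp
  moreover have "(0, p) \<in> (\<lambda>(s, q). f s q) -` {0<..} \<inter> (ball 0 d \<times> UNIV)" using assms(2) d by simp
  ultimately obtain N e where "open N" "p \<in> N" "e > 0"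
      "\<forall>s\<in>ball 0 e. \<forall>q\<in>N. (s, q) \<in> (\<lambda>(s, q). f s q) -` {0<..} \<inter> (ball 0 d \<times> UNIV)"
    by (rule open_box_nhd)
  then show "\<exists>N \<delta>. open N \<and> p \<in> N \<and> \<delta> > 0 \<and> (\<forall>s\<in>ball 0 \<delta>. \<forall>q\<in>N. f s q > 0)"
    by (intro exI[of _ N] exI[of _ e]) auto
qed

text \<open>With the direction before the parameter, \<open>fam_deriv f v\<close> is again a family,
  and the operation can be iterated.\<close>

definition fam_deriv :: "('p::real_normed_vector \<Rightarrow> 'a \<Rightarrow> real) \<Rightarrow> 'p \<Rightarrow> 'p \<Rightarrow> 'a \<Rightarrow> real" where
  "fam_deriv f v s p = frechet_derivative (\<lambda>s. f s p) (at s) v"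

lemma Ck_fam_deriv_local:
  assumes "Ck_on (Suc k) (ball 0 d \<times> ball (snd a p) r) (\<lambda>x. f (fst x) (chart_inv a (snd x)))" (is "Ck_on _ ?V ?F")
    and "s \<in> ball 0 d" "z \<in> ball (snd a p) r"
  shows "((\<lambda>s. f s (chart_inv a z)) has_derivative (\<lambda>v. frechet_derivative ?F (at (s, z)) (v, 0))) (at s)"
    "fam_deriv f v s (chart_inv a z) = frechet_derivative ?F (at (s, z)) (v, 0)"
proof -
  have "open ?V" by (intro open_Times open_ball)
  from Ck_on_slice_fst[OF this assms(1), of s z] assms(2,3)
  show 1: "((\<lambda>s. f s (chart_inv a z)) has_derivative (\<lambda>v. frechet_derivative ?F (at (s, z)) (v, 0))) (at s)" by simp
  show "fam_deriv f v s (chart_inv a z) = frechet_derivative ?F (at (s, z)) (v, 0)"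
    unfolding fam_deriv_def frechet_derivative_at[OF 1, symmetric] ..
qed

text \<open>In a chart the parameter derivative is the full derivative in the direction
  \<open>(v, 0)\<close>, which is one order less regular on the same box.\<close>

lemma Ck_fam_deriv:
  assumes "Ck_fam (Suc k) f"
  shows "Ck_fam k (fam_deriv f v)"
  unfolding Ck_fam_def
proof (intro ballI)
  fix a p assume ap: "a \<in> \<A>" "p \<in> fst a"
  obtain d r where d: "d > 0" "r > 0" "ball (snd a p) r \<subseteq> snd a ` fst a"
      "Ck_on (Suc k) (ball 0 d \<times> ball (snd a p) r) (\<lambda>x. f (fst x) (chart_inv a (snd x)))" (is "Ck_on _ ?V ?F")
    using assms ap unfolding Ck_fam_def by blast
  have V: "open ?V" by (intro open_Times open_ball)
  have "Ck_on k ?V (\<lambda>x. frechet_derivative ?F (at x) (v, 0))"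
    by (rule Ck_on_SucE(2)[OF V d(4)])
  then have "Ck_on k ?V (\<lambda>x. fam_deriv f v (fst x) (chart_inv a (snd x)))"
  proof (rule Ck_on_eq[OF V])
    fix x assume "x \<in> ?V"
    then show "frechet_derivative ?F (at x) (v, 0) = fam_deriv f v (fst x) (chart_inv a (snd x))"
      using Ck_fam_deriv_local(2)[OF d(4), of "fst x" "snd x" v] by (cases x) simp
  qed
  with d show "\<exists>\<delta>>0. \<exists>r>0. ball (snd a p) r \<subseteq> snd a ` fst a \<and>
     Ck_on k (ball 0 \<delta> \<times> ball (snd a p) r) (\<lambda>x. fam_deriv f v (fst x) (chart_inv a (snd x)))" by blast
qed

lemma Ck_fam_has_derivative:
  assumes "Ck_fam (Suc k) f"
  shows "\<exists>\<delta>>0. \<forall>s\<in>ball 0 \<delta>. \<forall>p. ((\<lambda>s. f s p) has_derivative (\<lambda>v. fam_deriv f v s p)) (at s)"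
proof (rule compact_uniform_nhd[OF compact_surface])
  fix p
  obtain a where ap: "a \<in> \<A>" "p \<in> fst a" using atlas_cover by blast
  obtain d r where d: "d > 0" "r > 0" "ball (snd a p) r \<subseteq> snd a ` fst a"
      "Ck_on (Suc k) (ball 0 d \<times> ball (snd a p) r) (\<lambda>x. f (fst x) (chart_inv a (snd x)))"
    using assms ap unfolding Ck_fam_def by blast
  have "((\<lambda>s. f s q) has_derivative (\<lambda>v. fam_deriv f v s q)) (at s)"
    if "s \<in> ball 0 d" "q \<in> snd a -` ball (snd a p) r \<inter> fst a" for s q
    using Ck_fam_deriv_local[OF d(4) that(1), of "snd a q"] that(2) atlas_is_chart[OF ap(1)]
    by (simp add: chart_inv_left)
  then show "\<exists>N \<delta>. open N \<and> p \<in> N \<and> \<delta> > 0 \<and> (\<forall>s\<in>ball 0 \<delta>. \<forall>q\<in>N. ((\<lambda>s. f s q) has_derivative (\<lambda>v. fam_deriv f v s q)) (at s))"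
    using chart_ball_nhd[OF ap d(2)] d(1) by blast
qed

lemma Ck_fam_integral_has_derivative:
  fixes f :: "'p::euclidean_space \<Rightarrow> 'a \<Rightarrow> real"
  assumes f: "Ck_fam (Suc k) f" and \<mu>: "finite_measure \<mu>" "sets \<mu> = sets borel"
  shows "\<exists>\<delta>>0. \<forall>s\<in>ball 0 \<delta>. ((\<lambda>s. \<integral>p. f s p \<partial>\<mu>) has_derivative (\<lambda>v. \<integral>p. fam_deriv f v s p \<partial>\<mu>)) (at s)"
proof -
  obtain d1 where d1: "d1 > 0" "\<And>s p. s \<in> ball 0 d1 \<Longrightarrow> ((\<lambda>s. f s p) has_derivative (\<lambda>v. fam_deriv f v s p)) (at s)"
    using Ck_fam_has_derivative[OF f] by blast
  obtain d2 where d2: "d2 > 0" "continuous_on (ball 0 d2 \<times> UNIV) (\<lambda>(s, q). f s q)"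
    using Ck_fam_continuous[OF f] by blast
  obtain d3 where d3: "\<And>v. d3 v > 0" "\<And>v. continuous_on (ball 0 (d3 v) \<times> UNIV) (\<lambda>(s, q). fam_deriv f v s q)"
    using Ck_fam_continuous[OF Ck_fam_deriv[OF f]] by metis
  \<comment> \<open>The radius of continuity depends on the direction, so the minimum runs over the
    finitely many basis directions; the others follow by linearity.\<close>
  define d where "d = Min (insert d1 (insert d2 (d3 ` Basis)))"
  have d: "d > 0" using d1 d2 d3 by (simp add: d_def)
  have dle: "d \<le> d1" "d \<le> d2" "\<And>b. b \<in> Basis \<Longrightarrow> d \<le> d3 b" unfolding d_def by (rule Min_le; simp)+
  have der: "((\<lambda>s. f s p) has_derivative (\<lambda>v. fam_deriv f v s p)) (at s)" if "s \<in> ball 0 d" for s p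
    using d1 that dle(1) by auto
  have cont: "continuous_on UNIV (f s)" if "s \<in> ball 0 d" for s
    using continuous_on_slice[OF d2(2)] that dle(2) by auto
  have cont': "continuous_on (ball 0 d \<times> UNIV) (\<lambda>(s, q). fam_deriv f v s q)" for v
  proof -
    have "continuous_on (ball 0 d \<times> UNIV) (\<lambda>(s, q). fam_deriv f b s q)" if b: "b \<in> Basis" for b
      by (rule continuous_on_subset[OF d3(2)[of b]]) (use dle(3)[OF b] in auto)
    then have c: "continuous_on (ball 0 d \<times> UNIV) (\<lambda>x. \<Sum>b\<in>Basis. (v \<bullet> b) * (case x of (s, q) \<Rightarrow> fam_deriv f b s q))"
      by (intro continuous_intros)
    have "(\<Sum>b\<in>Basis. (v \<bullet> b) * fam_deriv f b s q) = fam_deriv f v s q" if s: "s \<in> ball 0 d" for s q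
    proof -
      have lin: "linear (\<lambda>v. fam_deriv f v s q)" using der[OF s] has_derivative_linear by blast
      have "fam_deriv f v s q = fam_deriv f (\<Sum>b\<in>Basis. (v \<bullet> b) *\<^sub>R b) s q" by (simp add: euclidean_representation)
      also have "\<dots> = (\<Sum>b\<in>Basis. (v \<bullet> b) * fam_deriv f b s q)"
        unfolding linear_sum[OF lin] linear_scale[OF lin] by simp
      finally show ?thesis by simp
    qed
    then show ?thesis by (intro continuous_on_eq[OF c]) auto
  qed
  show ?thesis
    using has_derivative_integral_compact[OF compact_surface \<mu> der cont cont'] d by blast
qed

end

lemma Ck_on_slice:
  fixes f :: "'p::real_normed_vector \<times> complex \<Rightarrow> 'b::real_normed_vector"
  assumes "open S" "open T" "Ck_on k (S \<times> T) f" "z \<in> T"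
  shows "Ck_on k S (\<lambda>s. f (s, z))"
  using assms(3)
proof (induction k arbitrary: f)
  case 0
  have "continuous_on S (\<lambda>s. (s, z))" by (intro continuous_intros)
  moreover have "(\<lambda>s. (s, z)) ` S \<subseteq> S \<times> T" using assms(4) by auto
  moreover have "continuous_on (S \<times> T) f" using 0 by simp
  ultimately show ?case using continuous_on_compose2[of "S \<times> T" f S "\<lambda>s. (s, z)"] by simp
next
  case (Suc k)
  have o: "open (S \<times> T)" using assms by (intro open_Times)
  show ?case
    by (rule Ck_on_SucI[OF assms(1), where f' = "\<lambda>s v. frechet_derivative f (at (s, z)) (v, 0)"])
       (use Ck_on_slice_fst[OF o Suc.prems] Suc.IH[OF Ck_on_SucE(2)[OF o Suc.prems]] assms(4) in auto)
qed

text \<open>Since \<open>q1\<close> and \<open>q2\<close> vanish at 0, a term of the second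
  derivative survives only if both factors of a square have been differentiated; the derivatives of
  \<open>K\<close> drop out.\<close>

lemma square_second_derivative:
  fixes q1 q2 K f :: "'p::real_normed_vector \<Rightarrow> real"
  assumes "\<delta> > 0" and C: "Ck_on 2 (ball 0 \<delta>) q1" "Ck_on 2 (ball 0 \<delta>) q2" "Ck_on 2 (ball 0 \<delta>) K"
    and z: "q1 0 = 0" "q2 0 = 0" and f: "\<And>s. s \<in> ball 0 \<delta> \<Longrightarrow> f s = ((q1 s)\<^sup>2 + (q2 s)\<^sup>2) * K s"
  shows "((\<lambda>s. frechet_derivative f (at s) u) has_derivative (\<lambda>v. 2 * K 0 *
      (frechet_derivative q1 (at 0) u * frechet_derivative q1 (at 0) v +
       frechet_derivative q2 (at 0) u * frechet_derivative q2 (at 0) v))) (at 0)"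
proof -
  let ?B = "ball (0::'p) \<delta>"
  have o: "open ?B" by simp
  have 0: "0 \<in> ?B" using assms(1) by simp
  note C' = C[unfolded numeral_2_eq_2]
  note d1 = Ck_on_SucE(1)[OF o C'(1)] and d2 = Ck_on_SucE(1)[OF o C'(2)] and d3 = Ck_on_SucE(1)[OF o C'(3)]
  note e1 = Ck_on_SucE(1)[OF o Ck_on_SucE(2)[OF o C'(1)] 0] and e2 = Ck_on_SucE(1)[OF o Ck_on_SucE(2)[OF o C'(2)] 0]
    and e3 = Ck_on_SucE(1)[OF o Ck_on_SucE(2)[OF o C'(3)] 0]
  define D where "D s = (2 * q1 s * frechet_derivative q1 (at s) u + 2 * q2 s * frechet_derivative q2 (at s) u) * K s
     + ((q1 s)\<^sup>2 + (q2 s)\<^sup>2) * frechet_derivative K (at s) u" for s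
  have fD: "frechet_derivative f (at s) u = D s" if s: "s \<in> ?B" for s
  proof -
    have "((\<lambda>s. ((q1 s)\<^sup>2 + (q2 s)\<^sup>2) * K s) has_derivative (\<lambda>v. (2 * q1 s * frechet_derivative q1 (at s) v + 2 * q2 s * frechet_derivative q2 (at s) v) * K s
     + ((q1 s)\<^sup>2 + (q2 s)\<^sup>2) * frechet_derivative K (at s) v)) (at s)"
      by (rule derivative_eq_intros d1[OF s] d2[OF s] d3[OF s] refl | simp add: algebra_simps)+
    from has_derivative_transform_within_open[OF this o s] f
    have "(f has_derivative (\<lambda>v. (2 * q1 s * frechet_derivative q1 (at s) v + 2 * q2 s * frechet_derivative q2 (at s) v) * K s
     + ((q1 s)\<^sup>2 + (q2 s)\<^sup>2) * frechet_derivative K (at s) v)) (at s)" by simp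
    from frechet_derivative_at[OF this, symmetric] show ?thesis by (simp add: D_def)
  qed
  have "(D has_derivative (\<lambda>v. 2 * K 0 *
      (frechet_derivative q1 (at 0) u * frechet_derivative q1 (at 0) v +
       frechet_derivative q2 (at 0) u * frechet_derivative q2 (at 0) v))) (at 0)"
    unfolding D_def
    by (rule derivative_eq_intros d1[OF 0] d2[OF 0] d3[OF 0] e1 e2 e3 refl | simp add: z algebra_simps)+
  then show ?thesis
    using has_derivative_transform_within_open[OF _ o 0, of D] fD by simp
qed

section \<open>Families of metrics and maps\<close>

locale metric_family = closed_surface \<A> for \<A> :: "'a::t2_space chart set" +
  fixes \<epsilon> :: real and \<rho> :: "'a metric" and \<sigma> :: "complex \<times> complex \<Rightarrow> 'a metric"
    and w :: "complex \<times> complex \<Rightarrow> 'a \<Rightarrow> 'a"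
  assumes eps: "\<epsilon> > 0"
    and rho: "riemannian_metric \<A> \<rho>" "\<And>p. \<exists>c\<in>conformal_charts \<A> \<rho>. p \<in> fst c"
    and sigma: "\<And>s. s \<in> ball 0 \<epsilon> \<Longrightarrow> riemannian_metric \<A> (\<sigma> s)"
      "\<And>s p. s \<in> ball 0 \<epsilon> \<Longrightarrow> \<exists>c\<in>conformal_charts \<A> (\<sigma> s). p \<in> fst c"
    and sigma0: "\<sigma> 0 = \<rho>" and sigma_smooth: "smooth_metric_family \<A> (ball 0 \<epsilon>) \<sigma>"
    and w0: "w 0 = id" and w_smooth: "smooth_family \<A> (ball 0 \<epsilon>) w"
begin

lemma w_joint_continuous: "continuous_on (ball 0 \<epsilon> \<times> UNIV) (\<lambda>x. w (fst x) (snd x))"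
  using w_smooth by (simp add: smooth_family_def case_prod_unfold)

lemma w_continuous:
  assumes "s \<in> ball 0 \<epsilon>"
  shows "continuous_on UNIV (w s)"
  using continuous_on_slice[of "ball 0 \<epsilon>" w s] w_joint_continuous assms by (simp add: case_prod_unfold)

text \<open>One chart serves the source and the target: \<open>w 0\<close> is the identity, so for
  small \<open>s\<close> the point \<open>w s p\<close> remains in a chart around
  \<open>p\<close>.\<close>

definition w_deriv :: "complex \<times> complex \<Rightarrow> 'a chart \<Rightarrow> 'a \<Rightarrow> complex \<Rightarrow> complex" where
  "w_deriv s a p = frechet_derivative (local_rep (w s) a a) (at (snd a p))"

definition pullback :: "complex \<times> complex \<Rightarrow> 'a chart \<Rightarrow> 'a \<Rightarrow> complex \<Rightarrow> complex \<Rightarrow> real" where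
  "pullback s a p v v' = \<rho> a (w s p) (w_deriv s a p v) (w_deriv s a p v')"

text \<open>The domain in \<open>smooth_family\<close> is not visibly open, while the rules for
  \<open>Ck_on\<close> apply to open sets only.\<close>

lemma rep_domain_open:
  assumes "a \<in> \<A>" "b \<in> \<A>"
  shows "open {(s, z). s \<in> ball 0 \<epsilon> \<and> z \<in> snd a ` fst a \<and> w s (chart_inv a z) \<in> fst b}" (is "open ?U")
proof -
  note ia = atlas_is_chart[OF assms(1)] and ib = atlas_is_chart[OF assms(2)]
  let ?Y = "ball 0 \<epsilon> \<times> snd a ` fst a"
  have oY: "open ?Y" using is_chart_open(2)[OF ia] by (intro open_Times) auto
  have "continuous_on ?Y (\<lambda>x. w (fst (fst x, chart_inv a (snd x))) (snd (fst x, chart_inv a (snd x))))"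
    by (rule continuous_on_compose2[OF w_joint_continuous])
       (auto intro!: continuous_intros continuous_on_compose2[OF chart_inv_continuous[OF ia]])
  then have "continuous_on ?Y (\<lambda>x. w (fst x) (chart_inv a (snd x)))" by simp
  from open_vimage_on[OF oY this is_chart_open(1)[OF ib]]
  have "open ((\<lambda>x. w (fst x) (chart_inv a (snd x))) -` fst b \<inter> ?Y)" .
  also have "(\<lambda>x. w (fst x) (chart_inv a (snd x))) -` fst b \<inter> ?Y = ?U" by auto
  finally show ?thesis .
qed

lemma local_rep_differentiable:
  assumes s: "s \<in> ball 0 \<epsilon>" and a: "a \<in> \<A>" "p \<in> fst a" and b: "b \<in> \<A>" "w s p \<in> fst b"
  shows "(local_rep (w s) a b has_derivative frechet_derivative (local_rep (w s) a b) (at (snd a p))) (at (snd a p))"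
proof -
  note ia = atlas_is_chart[OF a(1)]
  let ?U = "{(s, z). s \<in> ball 0 \<epsilon> \<and> z \<in> snd a ` fst a \<and> w s (chart_inv a z) \<in> fst b}"
  have "smooth_on ?U (\<lambda>(s, z). snd b (w s (chart_inv a z)))"
    using w_smooth a b unfolding smooth_family_def by blast
  then have C: "Ck_on (Suc 0) ?U (\<lambda>(s, z). snd b (w s (chart_inv a z)))"
    unfolding smooth_on_def by blast
  have "(s, snd a p) \<in> ?U" using s a b ia by (simp add: chart_inv_left)
  from Ck_on_slice_snd[OF rep_domain_open[OF a(1) b(1)] C this] have "((\<lambda>z. snd b (w s (chart_inv a z))) has_derivative
      (\<lambda>v. frechet_derivative (\<lambda>(s, z). snd b (w s (chart_inv a z))) (at (s, snd a p)) (0, v))) (at (snd a p))"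
    by simp
  then have "local_rep (w s) a b differentiable (at (snd a p))"
    unfolding local_rep_def o_def differentiable_def by blast
  then show ?thesis by (simp add: frechet_derivative_works)
qed

text \<open>A product neighbourhood of \<open>(0, p)\<close> on which every \<open>w s\<close> stays
  in the chart \<open>a\<close> and all coefficients that occur later are regular. One box serves
  every order \<open>k\<close>, since it is shrunk only to keep \<open>w s\<close> inside the
  chart.\<close>

definition smooth_box :: "'a chart \<Rightarrow> 'a \<Rightarrow> real \<Rightarrow> real \<Rightarrow> bool" where
  "smooth_box a p \<delta> r \<longleftrightarrow> \<delta> > 0 \<and> r > 0 \<and> \<delta> \<le> \<epsilon> \<and> ball (snd a p) r \<subseteq> snd a ` fst a \<and>
     (\<forall>s\<in>ball 0 \<delta>. \<forall>z\<in>ball (snd a p) r. w s (chart_inv a z) \<in> fst a) \<and>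
     (\<forall>k v v'. let C = Ck_on k (ball (0 :: complex \<times> complex) \<delta> \<times> ball (snd a p) r) in
        Ck_on k (ball 0 \<delta> \<times> ball (snd a p) r) (\<lambda>x. w_deriv (fst x) a (chart_inv a (snd x)) v) \<and>
        C (\<lambda>x. \<sigma> (fst x) a (chart_inv a (snd x)) v v') \<and>
        C (\<lambda>x. \<rho> a (chart_inv a (snd x)) v v') \<and>
        C (\<lambda>x. \<rho> a (w (fst x) (chart_inv a (snd x))) v v') \<and>
        C (\<lambda>x. pullback (fst x) a (chart_inv a (snd x)) v v'))"

lemma smooth_boxD:
  assumes "smooth_box a p \<delta> r"
  shows "\<delta> > 0" "r > 0" "\<delta> \<le> \<epsilon>" "ball (snd a p) r \<subseteq> snd a ` fst a"
    "\<And>s z. s \<in> ball 0 \<delta> \<Longrightarrow> z \<in> ball (snd a p) r \<Longrightarrow> w s (chart_inv a z) \<in> fst a"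
    "Ck_on k (ball 0 \<delta> \<times> ball (snd a p) r) (\<lambda>x. w_deriv (fst x) a (chart_inv a (snd x)) v)"
    "Ck_on k (ball 0 \<delta> \<times> ball (snd a p) r) (\<lambda>x. \<sigma> (fst x) a (chart_inv a (snd x)) v v')"
    "Ck_on k (ball (0 :: complex \<times> complex) \<delta> \<times> ball (snd a p) r) (\<lambda>x. \<rho> a (chart_inv a (snd x)) v v')"
    "Ck_on k (ball 0 \<delta> \<times> ball (snd a p) r) (\<lambda>x. \<rho> a (w (fst x) (chart_inv a (snd x))) v v')"
    "Ck_on k (ball 0 \<delta> \<times> ball (snd a p) r) (\<lambda>x. pullback (fst x) a (chart_inv a (snd x)) v v')"
  using assms unfolding smooth_box_def Let_def by blast+

lemma local_smoothness:
  assumes a: "a \<in> \<A>" "p \<in> fst a"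
  shows "\<exists>\<delta> r. smooth_box a p \<delta> r"
proof -
  note ia = atlas_is_chart[OF a(1)]
  have oa: "a \<in> charts" using a atlas_oriented by blast
  let ?Z = "snd a ` fst a"
  let ?U = "{(s, z). s \<in> ball 0 \<epsilon> \<and> z \<in> ?Z \<and> w s (chart_inv a z) \<in> fst a}"
  let ?Y = "ball 0 \<epsilon> \<times> ?Z"
  have oZ: "open ?Z" using is_chart_open(2)[OF ia] .
  have oY: "open ?Y" using oZ by (intro open_Times) auto
  have oU: "open ?U" by (rule rep_domain_open[OF a(1) a(1)])
  have U0: "(0, snd a p) \<in> ?U" using a eps ia by (simp add: chart_inv_left w0)
  obtain A C where AC: "open A" "open C" "(0, snd a p) \<in> A \<times> C" "A \<times> C \<subseteq> ?U"
    by (rule open_prod_elim[OF oU U0])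
  obtain d where d: "d > 0" "ball 0 d \<subseteq> A" using AC open_contains_ball by blast
  obtain r where r: "r > 0" "ball (snd a p) r \<subseteq> C" using AC open_contains_ball by blast
  define \<delta> where "\<delta> = min d \<epsilon>"
  let ?V = "ball (0 :: complex \<times> complex) \<delta> \<times> ball (snd a p) r"
  have V: "open ?V" by (intro open_Times open_ball)
  have "ball 0 \<delta> \<subseteq> A" using d(2) by (auto simp: \<delta>_def)
  then have VU: "?V \<subseteq> ?U" using AC(4) Sigma_mono[of "ball 0 \<delta>" A "\<lambda>_. ball (snd a p) r" "\<lambda>_. C"] r(2) by (meson order_trans)
  have VY: "?V \<subseteq> ?Y" using VU by auto
  have inU: "s \<in> ball 0 \<epsilon>" "z \<in> ?Z" "w s (chart_inv a z) \<in> fst a" if "s \<in> ball 0 \<delta>" "z \<in> ball (snd a p) r" for s z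
  proof -
    have "(s, z) \<in> ?V" using that by simp
    then have "(s, z) \<in> ?U" using VU by (rule rev_subsetD)
    then show "s \<in> ball 0 \<epsilon>" "z \<in> ?Z" "w s (chart_inv a z) \<in> fst a" by simp_all
  qed
  have "smooth_on ?U (\<lambda>(s, z). snd a (w s (chart_inv a z)))"
    using w_smooth a unfolding smooth_family_def by blast
  then have "Ck_on k ?U (\<lambda>(s, z). snd a (w s (chart_inv a z)))" for k
    unfolding smooth_on_def by blast
  from Ck_on_subset[OF oU V VU this] have W: "Ck_on k ?V (\<lambda>x. snd a (w (fst x) (chart_inv a (snd x))))" for k
    unfolding case_prod_unfold .
  have D: "Ck_on k ?V (\<lambda>x. w_deriv (fst x) a (chart_inv a (snd x)) v)" for k v
  proof -
    have eq: "frechet_derivative (\<lambda>x. snd a (w (fst x) (chart_inv a (snd x)))) (at x) (0, v) = w_deriv (fst x) a (chart_inv a (snd x)) v"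
      if "x \<in> ?V" for x
    proof -
      obtain s z where x: "x = (s, z)" by (cases x)
      have sa: "snd a (chart_inv a z) = z"
        using inU(2)[of s z] that x chart_inv_right[of z a "fst a"] by auto
      have "((\<lambda>z. snd a (w s (chart_inv a z))) has_derivative
          (\<lambda>v. frechet_derivative (\<lambda>x. snd a (w (fst x) (chart_inv a (snd x)))) (at (s, z)) (0, v))) (at z)"
        using Ck_on_slice_snd[OF V W[of "Suc 0"], of s z] that x by simp
      from fun_cong[OF frechet_derivative_at[OF this], of v]
      have "frechet_derivative (\<lambda>x. snd a (w (fst x) (chart_inv a (snd x)))) (at (s, z)) (0, v) =
          frechet_derivative (\<lambda>z. snd a (w s (chart_inv a z))) (at z) v" .
      also have "\<dots> = w_deriv s a (chart_inv a z) v"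
        unfolding w_deriv_def local_rep_def o_def sa ..
      finally show ?thesis unfolding x fst_conv snd_conv .
    qed
    show ?thesis by (rule Ck_on_eq[OF V Ck_on_SucE(2)[OF V W[of "Suc k"]] eq])
  qed
  have S: "Ck_on k ?V (\<lambda>x. \<sigma> (fst x) a (chart_inv a (snd x)) v v')" for k v v'
  proof -
    have "smooth_on ?Y (\<lambda>(s, z). \<sigma> s a (chart_inv a z) v v')"
      using sigma_smooth a unfolding smooth_metric_family_def by blast
    then have "Ck_on k ?Y (\<lambda>(s, z). \<sigma> s a (chart_inv a z) v v')"
      unfolding smooth_on_def by blast
    from Ck_on_subset[OF oY V VY this] show ?thesis unfolding case_prod_unfold .
  qed
  have G: "Ck_on k ?Z (\<lambda>z. \<rho> a (chart_inv a z) v v')" for k v v'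
    using rho(1) oa unfolding riemannian_metric_def smooth_on_def by blast
  have R: "Ck_on k ?V (\<lambda>x. \<rho> a (chart_inv a (snd x)) v v')" for k v v'
    by (rule Ck_on_comp[OF V oZ G Ck_on_bounded_linear[OF V bounded_linear_snd]]) (use inU in auto)
  have RW: "Ck_on k ?V (\<lambda>x. \<rho> a (w (fst x) (chart_inv a (snd x))) v v')" for k v v'
  proof -
    have "Ck_on k ?V (\<lambda>x. \<rho> a (chart_inv a (snd a (w (fst x) (chart_inv a (snd x))))) v v')"
      by (rule Ck_on_comp[OF V oZ G W]) (use inU in auto)
    then show ?thesis
      by (rule Ck_on_eq[OF V]) (use inU(3) chart_inv_left[OF ia] in auto)
  qed
  have B: "Ck_on k ?V (\<lambda>x. pullback (fst x) a (chart_inv a (snd x)) v v')" for k v v'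
  proof -
    \<comment> \<open>The metric at \<open>w s p\<close> is applied to vectors that vary with
      \<open>s\<close> and \<open>z\<close>. Expanding it in the basis \<open>1\<close>,
      \<open>\<i>\<close> leaves a polynomial in functions known to be regular.\<close>
    let ?A = "\<lambda>v x. w_deriv (fst x) a (chart_inv a (snd x)) v" and ?R = "\<lambda>v v' x. \<rho> a (w (fst x) (chart_inv a (snd x))) v v'"
    have C: "Ck_on k ?V (\<lambda>x. Re (?A v x) * Re (?A v' x) * ?R 1 1 x + (Re (?A v x) * Im (?A v' x) + Im (?A v x) * Re (?A v' x)) * ?R 1 \<i> x
       + Im (?A v x) * Im (?A v' x) * ?R \<i> \<i> x)"
      by (intro Ck_on_add Ck_on_mult V RW Ck_on_linear_comp[OF V bounded_linear_Re] Ck_on_linear_comp[OF V bounded_linear_Im] D)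
    have eq: "Re (?A v x) * Re (?A v' x) * ?R 1 1 x + (Re (?A v x) * Im (?A v' x) + Im (?A v x) * Re (?A v' x)) * ?R 1 \<i> x
       + Im (?A v x) * Im (?A v' x) * ?R \<i> \<i> x = pullback (fst x) a (chart_inv a (snd x)) v v'" if "x \<in> ?V" for x
      unfolding pullback_def using that inU(3)[of "fst x" "snd x"]
      by (subst pos_form_expand[OF metric_pos_form[OF rho(1) oa], of _ "w_deriv (fst x) a (chart_inv a (snd x)) v"]) auto
    show ?thesis by (rule Ck_on_eq[OF V C eq])
  qed
  have \<delta>0: "\<delta> > 0" "\<delta> \<le> \<epsilon>" using d(1) eps by (auto simp: \<delta>_def)
  have sub: "ball (snd a p) r \<subseteq> ?Z" using inU(2)[of 0] \<delta>0(1) by auto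
  have "smooth_box a p \<delta> r"
    unfolding smooth_box_def Let_def
    by (intro conjI allI ballI inU(3) \<delta>0 r(1) sub D S R RW B)
  then show ?thesis by blast
qed

abbreviation "H_fam s p \<equiv> H_density \<A> (\<sigma> s) \<rho> (w s) p"
abbreviation "L_fam s p \<equiv> L_density \<A> (\<sigma> s) \<rho> (w s) p"
abbreviation "ratio_fam s p \<equiv> area_ratio (\<sigma> s) \<rho> p"

lemma fam_formulas:
  assumes s: "s \<in> ball 0 \<epsilon>" and a: "a \<in> \<A>" "p \<in> fst a" "w s p \<in> fst a"
  shows "H_fam s p + L_fam s p = energy_form (\<sigma> s a p) (pullback s a p) / gram_vol (\<sigma> s a p)"
    "H_fam s p - L_fam s p = gram_vol (\<rho> a (w s p)) * det2 (w_deriv s a p) / gram_vol (\<sigma> s a p)"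
    "e \<in> charts \<Longrightarrow> p \<in> fst e \<Longrightarrow> hopf_differential \<A> (\<sigma> s) \<rho> (w s) e p (trans_deriv a e p 1) =
       Complex (hopf_re (\<sigma> s a p) (pullback s a p)) (hopf_im (\<sigma> s a p) (pullback s a p))"
    "H_fam s p * L_fam s p * (\<sigma> s a p 1 1)\<^sup>2 = (hopf_re (\<sigma> s a p) (pullback s a p))\<^sup>2 + (hopf_im (\<sigma> s a p) (pullback s a p))\<^sup>2"
proof -
  have oa: "a \<in> charts" using a atlas_oriented by blast
  note d = local_rep_differentiable[OF s a(1,2) a(1,3), folded w_deriv_def]
  note f = density_formulas[OF sigma(1)[OF s] sigma(2)[OF s] rho w_continuous[OF s] oa a(2) oa a(3) d _ _ pullback_def]
  show "H_fam s p + L_fam s p = energy_form (\<sigma> s a p) (pullback s a p) / gram_vol (\<sigma> s a p)"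
    "H_fam s p - L_fam s p = gram_vol (\<rho> a (w s p)) * det2 (w_deriv s a p) / gram_vol (\<sigma> s a p)"
    "H_fam s p * L_fam s p * (\<sigma> s a p 1 1)\<^sup>2 = (hopf_re (\<sigma> s a p) (pullback s a p))\<^sup>2 + (hopf_im (\<sigma> s a p) (pullback s a p))\<^sup>2"
    using f(1,2,4)[OF oa a(2)] by blast+
  show "e \<in> charts \<Longrightarrow> p \<in> fst e \<Longrightarrow> hopf_differential \<A> (\<sigma> s) \<rho> (w s) e p (trans_deriv a e p 1) =
       Complex (hopf_re (\<sigma> s a p) (pullback s a p)) (hopf_im (\<sigma> s a p) (pullback s a p))"
    by (rule f(3))
qed

text \<open>\<open>fam_formulas\<close> gives the sum and the difference of the two densities as
  algebraic expressions in regular coefficients with nonvanishing denominators; half the sum and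
  half the difference of these expressions are the densities themselves. The pointwise choice of
  conformal charts has disappeared.\<close>

lemma fam_smooth:
  shows "Ck_fam k H_fam" "Ck_fam k L_fam" "Ck_fam k ratio_fam"
proof -
  have "\<exists>\<delta>>0. \<exists>r>0. ball (snd a p) r \<subseteq> snd a ` fst a \<and>
      Ck_on k (ball 0 \<delta> \<times> ball (snd a p) r) (\<lambda>x. H_fam (fst x) (chart_inv a (snd x))) \<and>
      Ck_on k (ball 0 \<delta> \<times> ball (snd a p) r) (\<lambda>x. L_fam (fst x) (chart_inv a (snd x))) \<and>
      Ck_on k (ball 0 \<delta> \<times> ball (snd a p) r) (\<lambda>x. ratio_fam (fst x) (chart_inv a (snd x)))"
    if a: "a \<in> \<A>" "p \<in> fst a" for a p
  proof -
    have oa: "a \<in> charts" using a atlas_oriented by blast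
    obtain \<delta> r where box: "smooth_box a p \<delta> r" using local_smoothness[OF a] by blast
    note dr = smooth_boxD(1-4)[OF box] and inU = smooth_boxD(5)[OF box] and sm = smooth_boxD(6-10)[OF box]
    let ?V = "ball (0 :: complex \<times> complex) \<delta> \<times> ball (snd a p) r"
    have V: "open ?V" by (intro open_Times open_ball)
    have x: "fst x \<in> ball 0 \<epsilon>" "chart_inv a (snd x) \<in> fst a" "w (fst x) (chart_inv a (snd x)) \<in> fst a" if "x \<in> ?V" for x
      using that dr(3,4) inU[of "fst x" "snd x"] chart_inv_in[of "snd x" a "fst a"] by auto
    have ps: "pos_form (\<sigma> (fst x) a (chart_inv a (snd x)))" if "x \<in> ?V" for x
      by (rule metric_pos_form[OF sigma(1)[OF x(1)[OF that]] oa x(2)[OF that]])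
    note pr = metric_pos_form[OF rho(1) oa x(2)]
      and prw = metric_pos_form[OF rho(1) oa x(3)]
    let ?S = "\<lambda>x. gram_vol (\<sigma> (fst x) a (chart_inv a (snd x)))"
    let ?J = "\<lambda>x. gram_vol (\<rho> a (w (fst x) (chart_inv a (snd x)))) * det2 (w_deriv (fst x) a (chart_inv a (snd x)))"
    let ?E = "\<lambda>x. energy_form (\<sigma> (fst x) a (chart_inv a (snd x))) (pullback (fst x) a (chart_inv a (snd x)))"
    have vS: "Ck_on k ?V ?S"
      unfolding gram_vol_def by (intro Ck_on_sqrt Ck_on_diff Ck_on_mult Ck_on_power V sm pos_form_det(1) ps)
    have vR: "Ck_on k ?V (\<lambda>x. gram_vol (\<rho> a (chart_inv a (snd x))))"
      unfolding gram_vol_def by (intro Ck_on_sqrt Ck_on_diff Ck_on_mult Ck_on_power V sm pos_form_det(1) pr)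
    have vRW: "Ck_on k ?V (\<lambda>x. gram_vol (\<rho> a (w (fst x) (chart_inv a (snd x)))))"
      unfolding gram_vol_def by (intro Ck_on_sqrt Ck_on_diff Ck_on_mult Ck_on_power V sm pos_form_det(1) prw)
    have det: "Ck_on k ?V (\<lambda>x. det2 (w_deriv (fst x) a (chart_inv a (snd x))))"
    proof -
      have "det2 T = Re (T 1) * Im (T \<i>) - Im (T 1) * Re (T \<i>)" for T by (simp add: det2_def algebra_simps)
      then show ?thesis
        by (simp only:) (intro Ck_on_diff Ck_on_mult V sm Ck_on_linear_comp[OF V bounded_linear_Re] Ck_on_linear_comp[OF V bounded_linear_Im])
    qed
    have S0: "?S x \<noteq> 0" if "x \<in> ?V" for x using gram_vol_pos[OF ps[OF that]] by simp
    have R0: "gram_vol (\<rho> a (chart_inv a (snd x))) \<noteq> 0" if "x \<in> ?V" for x using gram_vol_pos[OF pr[OF that]] by simp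
    have E: "Ck_on k ?V ?E"
      unfolding energy_form_def
      by (intro Ck_on_divide Ck_on_add Ck_on_diff Ck_on_mult Ck_on_const V sm vS) (use S0 in auto)
    have J: "Ck_on k ?V ?J" by (intro Ck_on_mult V vRW det)
    have HL: "H_fam (fst x) (chart_inv a (snd x)) = (?E x + ?J x) / (2 * ?S x)"
      "L_fam (fst x) (chart_inv a (snd x)) = (?E x - ?J x) / (2 * ?S x)" if "x \<in> ?V" for x
      using fam_formulas(1,2)[OF x(1)[OF that] a(1) x(2,3)[OF that]] S0[OF that] by (simp_all add: field_simps)
    have RT: "ratio_fam (fst x) (chart_inv a (snd x)) = ?S x / gram_vol (\<rho> a (chart_inv a (snd x)))" if "x \<in> ?V" for x
      by (rule area_ratio_eq[OF sigma(1)[OF x(1)[OF that]] rho(1) oa x(2)[OF that]])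
    have "Ck_on k ?V (\<lambda>x. H_fam (fst x) (chart_inv a (snd x)))"
      by (rule Ck_on_eq[OF V _ HL(1)[symmetric]]) (intro Ck_on_divide Ck_on_add Ck_on_mult Ck_on_const V E J vS, use S0 in auto)
    moreover have "Ck_on k ?V (\<lambda>x. L_fam (fst x) (chart_inv a (snd x)))"
      by (rule Ck_on_eq[OF V _ HL(2)[symmetric]]) (intro Ck_on_divide Ck_on_diff Ck_on_mult Ck_on_const V E J vS, use S0 in auto)
    moreover have "Ck_on k ?V (\<lambda>x. ratio_fam (fst x) (chart_inv a (snd x)))"
      by (rule Ck_on_eq[OF V _ RT[symmetric]]) (intro Ck_on_divide V vS vR, use R0 in auto)
    ultimately show ?thesis using dr by blast
  qed
  then show "Ck_fam k H_fam" "Ck_fam k L_fam" "Ck_fam k ratio_fam"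
    unfolding Ck_fam_def by meson+
qed

lemma w_deriv_0: "a \<in> \<A> \<Longrightarrow> p \<in> fst a \<Longrightarrow> w_deriv 0 a p v = v"
proof -
  assume a: "a \<in> \<A>" "p \<in> fst a"
  have "transition a a = local_rep (w 0) a a" by (simp add: w0 local_rep_def transition_def)
  then have "w_deriv 0 a p = trans_deriv a a p" by (simp add: w_deriv_def)
  \<comment> \<open>The derivative of \<open>transition a a\<close> is both idempotent and its own
    inverse, hence the identity.\<close>
  then show ?thesis
    using trans_deriv_inverse[of a p a "v"] trans_deriv_comp[of a p a a v] a atlas_oriented by (metis subsetD)
qed

lemma fam_at_0: "H_fam 0 p = 1" "L_fam 0 p = 0" "ratio_fam 0 p = 1"
proof -
  obtain a where a: "a \<in> \<A>" "p \<in> fst a" using atlas_cover by blast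
  have oa: "a \<in> charts" using a atlas_oriented by blast
  have 0: "0 \<in> ball 0 \<epsilon>" using eps by simp
  note pr = metric_pos_form[OF rho(1) oa a(2)]
  have B: "pullback 0 a p = \<rho> a p" by (intro ext) (simp add: pullback_def w_deriv_0[OF a] w0)
  have d: "det2 (w_deriv 0 a p) = 1" by (simp add: det2_def w_deriv_0[OF a])
  have "energy_form (\<rho> a p) (\<rho> a p) = gram_vol (\<rho> a p)"
    unfolding energy_form_def using gram_vol_pos[OF pr] gram_vol_square[OF pr]
    by (simp add: field_simps power2_eq_square)
  then have "H_fam 0 p + L_fam 0 p = 1" "H_fam 0 p - L_fam 0 p = 1"
    using fam_formulas(1,2)[OF 0 a] gram_vol_pos[OF pr] a by (simp_all add: B d w0 sigma0)
  then show "H_fam 0 p = 1" "L_fam 0 p = 0" by linarith+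
  show "ratio_fam 0 p = 1" using gram_vol_pos[OF pr] by (simp add: sigma0 area_ratio_eq[OF rho(1) rho(1) oa a(2)])
qed

end

section \<open>Bijectivity of the maps near the base parameter\<close>

context metric_family
begin

lemma w_neighbourhood:
  assumes U: "open U" "p \<in> U"
  shows "\<exists>N \<delta>. open N \<and> p \<in> N \<and> \<delta> > 0 \<and> (\<forall>s\<in>ball 0 \<delta>. \<forall>q\<in>N. w s q \<in> U)"
proof -
  have o: "open (ball (0::complex \<times> complex) \<epsilon> \<times> (UNIV :: 'a set))" by (intro open_Times) auto
  have "open ((\<lambda>x. w (fst x) (snd x)) -` U \<inter> (ball 0 \<epsilon> \<times> UNIV))"
    by (rule open_vimage_on[OF o w_joint_continuous U(1)])
  moreover have "(0, p) \<in> (\<lambda>x. w (fst x) (snd x)) -` U \<inter> (ball 0 \<epsilon> \<times> UNIV)" using U(2) eps by (simp add: w0)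
  ultimately obtain N e where "open N" "p \<in> N" "e > 0"
      "\<forall>s\<in>ball 0 e. \<forall>q\<in>N. (s, q) \<in> (\<lambda>x. w (fst x) (snd x)) -` U \<inter> (ball 0 \<epsilon> \<times> UNIV)"
    by (rule open_box_nhd)
  then show ?thesis by (intro exI[of _ N] exI[of _ e]) auto
qed

text \<open>In a chart \<open>w s\<close> differs from the identity by a map with Lipschitz constant at most \<open>1/2\<close>.\<close>

lemma w_locally_injective: "\<exists>N \<delta>. open N \<and> p \<in> N \<and> \<delta> > 0 \<and> (\<forall>s\<in>ball 0 \<delta>. inj_on (w s) N)"
proof -
  obtain a where a: "a \<in> \<A>" "p \<in> fst a" using atlas_cover by blast
  note ia = atlas_is_chart[OF a(1)]
  obtain \<delta> r where box: "smooth_box a p \<delta> r" using local_smoothness[OF a] by blast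
  note dr = smooth_boxD(1-4)[OF box] and inU = smooth_boxD(5)[OF box] and sm = smooth_boxD(6-10)[OF box]
  let ?V = "ball (0 :: complex \<times> complex) \<delta> \<times> ball (snd a p) r"
  have V: "open ?V" by (intro open_Times open_ball)
  define g where "g x = norm (w_deriv (fst x) a (chart_inv a (snd x)) 1 - 1) + norm (w_deriv (fst x) a (chart_inv a (snd x)) \<i> - \<i>)" for x
  have "continuous_on ?V g"
    unfolding g_def by (intro continuous_intros Ck_on_continuous[OF V sm(1)])
  from open_vimage_on[OF V this] have "open (g -` {..<1/2} \<inter> ?V)" by simp
  moreover have "(0, snd a p) \<in> g -` {..<1/2} \<inter> ?V"
    using dr a w_deriv_0[OF a] by (simp add: g_def chart_inv_left[OF ia])
  ultimately obtain C d where C: "open C" "snd a p \<in> C" and d: "d > 0"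
    and AC: "\<forall>s\<in>ball 0 d. \<forall>z\<in>C. (s, z) \<in> g -` {..<1/2} \<inter> ?V"
    by (rule open_box_nhd)
  obtain r' where r': "r' > 0" "ball (snd a p) r' \<subseteq> C" using C open_contains_ball by blast
  have gb: "g (s, z) \<le> 1/2" "s \<in> ball 0 \<delta>" "z \<in> ball (snd a p) r" if "s \<in> ball 0 d" "z \<in> ball (snd a p) r'" for s z
  proof -
    have "(s, z) \<in> g -` {..<1/2} \<inter> ?V" using AC r'(2) that by blast
    then show "g (s, z) \<le> 1/2" "s \<in> ball 0 \<delta>" "z \<in> ball (snd a p) r" by auto
  qed
  let ?N = "snd a -` ball (snd a p) r' \<inter> fst a"
  have "inj_on (w s) ?N" if s: "s \<in> ball 0 d" for s
  proof (rule inj_onI)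
    fix x y assume x: "x \<in> ?N" and y: "y \<in> ?N" and eq: "w s x = w s y"
    have seps: "s \<in> ball 0 \<epsilon>" using gb(2)[OF s, of "snd a p"] r'(1) dr(3) by auto
    define h where "h z = local_rep (w s) a a z - z" for z
    define h' where "h' z v = w_deriv s a (chart_inv a z) v - v" for z v
    have der: "(h has_derivative h' z) (at z)" and lin: "linear (w_deriv s a (chart_inv a z))"
      if z: "z \<in> ball (snd a p) r'" for z
    proof -
      note b = gb[OF s z]
      have q: "chart_inv a z \<in> fst a" "snd a (chart_inv a z) = z"
        using b(3) dr(4) chart_inv_in[of z a "fst a"] chart_inv_right[of z a "fst a"] by auto
      have 1: "(local_rep (w s) a a has_derivative w_deriv s a (chart_inv a z)) (at z)"
        using local_rep_differentiable[OF seps a(1) q(1) a(1) inU[OF b(2,3)]] by (simp add: w_deriv_def q(2))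
      show "linear (w_deriv s a (chart_inv a z))" by (rule has_derivative_linear[OF 1])
      show "(h has_derivative h' z) (at z)"
        unfolding h_def h'_def by (intro has_derivative_diff 1 has_derivative_ident)
    qed
    have on: "onorm (h' z) \<le> 1/2" if z: "z \<in> ball (snd a p) r'" for z
    proof (rule onorm_bound)
      fix v
      let ?A = "w_deriv s a (chart_inv a z)"
      have "h' z v = Re v *\<^sub>R (?A 1 - 1) + Im v *\<^sub>R (?A \<i> - \<i>)"
        unfolding h'_def linear_complex_expand[OF lin[OF z], of v] by (simp add: complex_eq_iff algebra_simps)
      also have "norm \<dots> \<le> norm v * norm (?A 1 - 1) + norm v * norm (?A \<i> - \<i>)"
        by (intro order_trans[OF norm_triangle_ineq] add_mono)
           (auto simp: abs_Re_le_cmod abs_Im_le_cmod intro!: mult_right_mono)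
      also have "\<dots> = norm v * g (s, z)" by (simp add: g_def distrib_left)
      also have "\<dots> \<le> norm v * (1/2)" by (intro mult_left_mono gb[OF s z]) simp
      finally show "norm (h' z v) \<le> 1/2 * norm v" by simp
    qed simp
    have "norm (h (snd a x) - h (snd a y)) \<le> 1/2 * norm (snd a x - snd a y)"
      using x y by (intro differentiable_bound[OF convex_ball has_derivative_at_withinI[OF der] on]) auto
    \<comment> \<open>If \<open>w s\<close> identifies \<open>x\<close> and \<open>y\<close>, then
      \<open>h\<close> alone must account for the whole difference of their coordinates, against its
      Lipschitz constant 1/2.\<close>
    moreover have "h (snd a x) - h (snd a y) = - (snd a x - snd a y)"
      using x y eq by (simp add: h_def local_rep_def chart_inv_left[OF ia])
    ultimately have "norm (snd a x - snd a y) \<le> 1/2 * norm (snd a x - snd a y)"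
      by (simp only: norm_minus_cancel)
    then have "norm (snd a x - snd a y) \<le> 0" by linarith
    then have "snd a x = snd a y" by simp
    then show "x = y" using x y is_chart_inj[OF ia] by (auto simp: inj_on_def)
  qed
  then show ?thesis using chart_ball_nhd[OF a r'(1)] d by blast
qed

text \<open>Compactness is applied to pairs of points. Near a diagonal pair local injectivity
  suffices; near a pair of distinct points the images stay in disjoint neighbourhoods of the two
  points for small \<open>s\<close>.\<close>

lemma w_injective: "\<exists>\<delta>>0. \<forall>s\<in>ball 0 \<delta>. inj (w s)"
proof -
  have c: "compact (UNIV :: ('a \<times> 'a) set)"
    using compact_Times[OF compact_surface compact_surface] by simp
  have "\<exists>N \<delta>. open N \<and> x \<in> N \<and> \<delta> > 0 \<and> (\<forall>s\<in>ball 0 \<delta>. \<forall>y\<in>N. w s (fst y) = w s (snd y) \<longrightarrow> fst y = snd y)"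
    for x :: "'a \<times> 'a"
  proof (cases "fst x = snd x")
    case True
    obtain N \<delta> where N: "open N" "fst x \<in> N" "\<delta> > 0" "\<And>s. s \<in> ball 0 \<delta> \<Longrightarrow> inj_on (w s) N"
      using w_locally_injective[of "fst x"] by blast
    have "fst y = snd y" if "s \<in> ball 0 \<delta>" "y \<in> N \<times> N" "w s (fst y) = w s (snd y)" for s y
      using inj_onD[OF N(4)[OF that(1)] that(3)] that(2) by (simp add: mem_Times_iff)
    then show ?thesis
      using N True by (intro exI[of _ "N \<times> N"] exI[of _ \<delta>] conjI open_Times) (simp_all add: mem_Times_iff)
  next
    case False
    obtain U U' where U: "open U" "open U'" "fst x \<in> U" "snd x \<in> U'" "U \<inter> U' = {}"
      using hausdorff[OF False] by (elim exE conjE) (rule that)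
    obtain N \<delta> where N: "open N" "fst x \<in> N" "\<delta> > 0" "\<And>s q. s \<in> ball 0 \<delta> \<Longrightarrow> q \<in> N \<Longrightarrow> w s q \<in> U"
      using w_neighbourhood[OF U(1,3)] by blast
    obtain N' \<delta>' where N': "open N'" "snd x \<in> N'" "\<delta>' > 0" "\<And>s q. s \<in> ball 0 \<delta>' \<Longrightarrow> q \<in> N' \<Longrightarrow> w s q \<in> U'"
      using w_neighbourhood[OF U(2,4)] by blast
    have "w s (fst y) \<noteq> w s (snd y)" if "s \<in> ball 0 (min \<delta> \<delta>')" "y \<in> N \<times> N'" for s y
      using N(4)[of s "fst y"] N'(4)[of s "snd y"] U(5) that by auto
    then show ?thesis
      using N N' by (intro exI[of _ "N \<times> N'"] exI[of _ "min \<delta> \<delta>'"] conjI open_Times) (auto simp: mem_Times_iff)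
  qed
  from compact_uniform_nhd[OF c this] obtain \<delta> where "\<delta> > 0"
    "\<forall>s\<in>ball 0 \<delta>. \<forall>y. w s (fst y) = w s (snd y) \<longrightarrow> fst y = snd y"
    by blast
  then show ?thesis by (intro exI[of _ \<delta>]) (auto simp: inj_def)
qed

text \<open>By invariance of domain in charts an injective \<open>w s\<close> is open, so its image
  is open; it is also compact, hence closed, and the surface is connected.\<close>

lemma w_surjective:
  assumes s: "s \<in> ball 0 \<epsilon>" and inj: "inj (w s)"
  shows "surj (w s)"
proof -
  note w = w_continuous[OF s]
  have "\<exists>N. open N \<and> p \<in> N \<and> open (w s ` N)" for p
  proof -
    obtain a where a: "a \<in> \<A>" "p \<in> fst a" using atlas_cover by blast
    obtain b where b: "b \<in> \<A>" "w s p \<in> fst b" using atlas_cover by blast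
    note ia = atlas_is_chart[OF a(1)] and ib = atlas_is_chart[OF b(1)]
    let ?N = "fst a \<inter> w s -` fst b" and ?\<tau> = "local_rep (w s) a b"
    have N: "open ?N" "p \<in> ?N" "?N \<subseteq> fst a"
      using a b is_chart_open(1)[OF ia] is_chart_open(1)[OF ib] w open_vimage[of "fst b" "w s"] by auto
    have \<tau>: "?\<tau> (snd a q) = snd b (w s q)" if "q \<in> fst a" for q
      using that ia by (simp add: local_rep_def chart_inv_left)
    have "continuous_on (snd a ` ?N) ?\<tau>"
    proof (rule has_derivative_continuous_on)
      fix z assume "z \<in> snd a ` ?N"
      then obtain q where q: "z = snd a q" "q \<in> fst a" "w s q \<in> fst b" by blast
      show "(?\<tau> has_derivative frechet_derivative ?\<tau> (at z)) (at z within snd a ` ?N)"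
        using local_rep_differentiable[OF s a(1) q(2) b(1) q(3)] q(1) has_derivative_at_withinI by blast
    qed
    moreover have "inj_on ?\<tau> (snd a ` ?N)"
    proof (rule inj_onI)
      fix x y assume "x \<in> snd a ` ?N" "y \<in> snd a ` ?N" and eq: "?\<tau> x = ?\<tau> y"
      then obtain u v where uv: "u \<in> ?N" "x = snd a u" "v \<in> ?N" "y = snd a v" by blast
      then have "snd b (w s u) = snd b (w s v)" using eq \<tau>[of u] \<tau>[of v] by simp
      then have "w s u = w s v" using is_chart_inj[OF ib] uv by (auto simp: inj_on_def)
      then show "x = y" using inj uv by (auto simp: inj_def)
    qed
    ultimately have "open (?\<tau> ` snd a ` ?N)"
      using invariance_of_domain chart_image_open[OF ia N(1,3)] by blast
    moreover have eq: "?\<tau> ` snd a ` ?N = snd b ` w s ` ?N"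
      unfolding image_image using \<tau> by (intro image_cong) auto
    ultimately have o: "open (snd b ` w s ` ?N)" by simp
    have sub: "w s ` ?N \<subseteq> fst b" by auto
    have "chart_inv b ` snd b ` w s ` ?N = w s ` ?N"
      unfolding image_image using chart_inv_left[OF ib] by (intro image_cong) auto
    moreover have "open (chart_inv b ` snd b ` w s ` ?N)"
      by (rule chart_inv_image_open[OF ib o image_mono[OF sub]])
    ultimately show ?thesis using N by metis
  qed
  then obtain N where N: "\<And>p. open (N p) \<and> p \<in> N p \<and> open (w s ` N p)" by metis
  have "w s ` UNIV = (\<Union>p. w s ` N p)" using N by blast
  then have "open (w s ` UNIV)" using N by auto
  moreover have "closed (w s ` UNIV)"
    using compact_continuous_image[OF w compact_surface] compact_imp_closed by blast
  ultimately have "w s ` UNIV = {} \<or> w s ` UNIV = UNIV"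
    using connected_surface unfolding connected_clopen by simp (metis empty_iff rangeI)
  then show ?thesis by auto
qed

lemma w_bijective: "\<exists>\<delta>>0. \<forall>s\<in>ball 0 \<delta>. bij (w s)"
proof -
  obtain \<delta> where "\<delta> > 0" "\<forall>s\<in>ball 0 \<delta>. inj (w s)" using w_injective by blast
  then show ?thesis
    using w_surjective eps by (intro exI[of _ "min \<delta> \<epsilon>"]) (auto simp: bij_def)
qed

section \<open>The energy as a constant plus twice the integral of the L-density against the fixed
  area\<close>

definition L_area :: "complex \<times> complex \<Rightarrow> 'a \<Rightarrow> real" where
  "L_area s p = L_fam s p * ratio_fam s p"

abbreviation "mu \<equiv> area_measure \<A> \<rho>"

lemma mu: "area_form_measure mu \<rho>" "sets mu = sets borel" "finite_measure mu"
  using area_measure_area_form[OF rho] area_form_measure_finite[OF _ rho(1)] area_form_measure_sets by auto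

lemma L_area_smooth: "Ck_fam k L_area"
  unfolding L_area_def using Ck_fam_binop[OF Ck_on_mult fam_smooth(2,3)] .

lemma Ck_fam_slice_continuous:
  assumes "Ck_fam k f"
  shows "\<exists>\<delta>>0. \<forall>s\<in>ball 0 \<delta>. continuous_on UNIV (f s)"
proof -
  obtain \<delta> where d: "\<delta> > 0" "continuous_on (ball 0 \<delta> \<times> UNIV) (\<lambda>(s, q). f s q)"
    using Ck_fam_continuous[OF assms] by blast
  then show ?thesis using continuous_on_slice[OF d(2)] by blast
qed

lemma energy_identity:
  "\<exists>\<delta>>0. \<forall>s\<in>ball 0 \<delta>. energy \<A> (\<sigma> s) \<rho> (w s) = measure mu UNIV + 2 * (\<integral>p. L_area s p \<partial>mu)"
proof -
  \<comment> \<open>The factor \<open>ratio_fam\<close> replaces the area density of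
    \<open>\<sigma> s\<close> in the denominator by that of \<open>\<rho>\<close>, so
    \<open>j s\<close> is the Jacobian of \<open>w s\<close> measured with \<open>\<rho>\<close> at
    both ends. It is 1 at \<open>s = 0\<close>, hence positive for small \<open>s\<close>, which
    permits the change of variables.\<close>
  define j where "j s p = (H_fam s p - L_fam s p) * ratio_fam s p" for s p
  have j: "Ck_fam 0 j"
    unfolding j_def by (intro Ck_fam_binop[OF Ck_on_mult] Ck_fam_binop[OF Ck_on_diff] fam_smooth)
  obtain d1 where d1: "d1 > 0" "\<forall>s\<in>ball 0 d1. \<forall>p. j s p > 0"
    using Ck_fam_pos[OF j] by (auto simp: j_def fam_at_0)
  obtain d2 where d2: "d2 > 0" "\<forall>s\<in>ball 0 d2. bij (w s)" using w_bijective by blast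
  obtain d3 where d3: "d3 > 0" "\<forall>s\<in>ball 0 d3. continuous_on UNIV (j s)"
    using Ck_fam_slice_continuous[OF j] by blast
  obtain d4 where d4: "d4 > 0" "\<forall>s\<in>ball 0 d4. continuous_on UNIV (L_area s)"
    using Ck_fam_slice_continuous[OF L_area_smooth] by blast
  have HL: "Ck_fam 0 (\<lambda>s p. H_fam s p + L_fam s p)"
    by (rule Ck_fam_binop[OF Ck_on_add fam_smooth(1,2)])
  obtain d5 where d5: "d5 > 0" "\<forall>s\<in>ball 0 d5. continuous_on UNIV (\<lambda>p. H_fam s p + L_fam s p)"
    using Ck_fam_slice_continuous[OF HL] by blast
  let ?d = "Min {d1, d2, d3, d4, d5, \<epsilon>}"
  have "energy \<A> (\<sigma> s) \<rho> (w s) = measure mu UNIV + 2 * (\<integral>p. L_area s p \<partial>mu)" if "s \<in> ball 0 ?d" for s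
  proof -
    have s: "s \<in> ball 0 d1" "s \<in> ball 0 d2" "s \<in> ball 0 d3" "s \<in> ball 0 d4" "s \<in> ball 0 d5" "s \<in> ball 0 \<epsilon>"
      using that by auto
    note jc = d3(2)[rule_format, OF s(3)] and Lc = d4(2)[rule_format, OF s(4)] and Ec = d5(2)[rule_format, OF s(5)]
    have jpos: "j s p > 0" for p using d1 s by blast
    have ji: "integrable mu (j s)" and Li: "integrable mu (L_area s)"
      by (intro integrable_continuous_compact[OF compact_surface mu(3,2)] jc Lc)+
    note rc = area_ratio_continuous[OF sigma(1)[OF s(6)] rho(1)]
    have meas: "f \<in> borel_measurable mu" if "continuous_on UNIV f" for f :: "'a \<Rightarrow> real"
      using borel_measurable_continuous_onI[OF that] mu(2) by (simp cong: measurable_cong_sets)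
    have rpos: "ratio_fam s p \<ge> 0" for p
    proof -
      have a: "chart_at \<A> p \<in> charts" "p \<in> fst (chart_at \<A> p)" using chart_at_atlas atlas_oriented by auto
      show ?thesis
        unfolding area_ratio_def using gram_vol_pos[OF metric_pos_form[OF sigma(1)[OF s(6)] a]] gram_vol_pos[OF metric_pos_form[OF rho(1) a]] by simp
    qed
    have dens: "area_measure \<A> (\<sigma> s) = density mu (\<lambda>p. ennreal (ratio_fam s p))"
      by (rule area_form_measure_density[OF mu(1) area_measure_area_form[OF sigma(1)[OF s(6)] sigma(2)[OF s(6)]] sigma(1)[OF s(6)] rho(1)])
    have "energy \<A> (\<sigma> s) \<rho> (w s) = (\<integral>p. ratio_fam s p *\<^sub>R (H_fam s p + L_fam s p) \<partial>mu)"
      unfolding energy_def dens by (rule integral_density[OF meas[OF Ec] meas[OF rc]]) (simp add: rpos)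
    also have "\<dots> = (\<integral>p. j s p + 2 * L_area s p \<partial>mu)"
      by (intro Bochner_Integration.integral_cong refl) (simp add: j_def L_area_def algebra_simps)
    also have "\<dots> = (\<integral>p. j s p \<partial>mu) + 2 * (\<integral>p. L_area s p \<partial>mu)"
      using ji Li by simp
    also have "(\<integral>p. j s p \<partial>mu) = measure mu UNIV"
    proof -
      have "(\<integral>\<^sup>+p. ennreal (j s p) \<partial>mu) = emeasure mu UNIV"
      proof (rule nn_integral_jacobian_bijection[OF mu(1) rho(1) w_continuous[OF s(6)] _ jc])
        show "bij (w s)" using d2 s by blast
        show "j s p \<ge> 0" for p using jpos[of p] by simp
        fix a b p assume a: "a \<in> \<A>" "b \<in> \<A>" "p \<in> fst a" "w s p \<in> fst b"
        then have oab: "a \<in> charts" "b \<in> charts" using atlas_oriented by auto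
        note d = local_rep_differentiable[OF s(6) a(1,3,2,4)]
        have "j s p = gram_vol (\<rho> b (w s p)) * det2 (frechet_derivative (local_rep (w s) a b) (at (snd a p))) / gram_vol (\<rho> a p)"
          unfolding j_def density_formulas(2)[OF sigma(1)[OF s(6)] sigma(2)[OF s(6)] rho w_continuous[OF s(6)] oab(1) a(3) oab(2) a(4) d oab(1) a(3) refl]
            area_ratio_eq[OF sigma(1)[OF s(6)] rho(1) oab(1) a(3)]
          using gram_vol_pos[OF metric_pos_form[OF sigma(1)[OF s(6)] oab(1) a(3)]] by simp
        then show "(local_rep (w s) a b has_derivative frechet_derivative (local_rep (w s) a b) (at (snd a p))) (at (snd a p)) \<and>
            det2 (frechet_derivative (local_rep (w s) a b) (at (snd a p))) * gram_vol (\<rho> b (w s p)) = j s p * gram_vol (\<rho> a p)"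
          using d gram_vol_pos[OF metric_pos_form[OF rho(1) oab(1) a(3)]] by simp
      qed
      then have "ennreal (\<integral>p. j s p \<partial>mu) = emeasure mu UNIV"
        using nn_integral_eq_integral[OF ji] jpos by (simp add: less_imp_le)
      then show ?thesis
        using jpos by (metis Bochner_Integration.integral_nonneg enn2real_ennreal less_imp_le measure_def)
    qed
    finally show ?thesis .
  qed
  then show ?thesis using d1 d2 d3 d4 d5 eps by (intro exI[of _ ?d]) auto
qed

text \<open>At a fixed point, \<open>L_area\<close> is \<open>(q1\<^sup>2 + q2\<^sup>2) * K\<close>,
  where \<open>q1\<close> and \<open>q2\<close> are the real and imaginary parts of the Hopf
  differential on the vector with coordinate \<open>1\<close> in a chart \<open>a\<close> of the
  atlas. By \<open>square_second_derivative\<close> the result is a real inner product of the first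
  derivatives along the two parameter axes, and these are complex multiples of \<open>x\<close> and
  \<open>y\<close> by hypothesis. Passing from \<open>a\<close> to the conformal chart
  \<open>e\<close> contributes the fourth power of the length of \<open>v\<close>, which cancels
  against \<open>K 0\<close>.\<close>

lemma L_area_second_derivative:
  assumes \<phi>: "infinitesimal_differential \<A> \<rho> (\<lambda>t. hopf_differential \<A> (\<sigma> (t, 0)) \<rho> (w (t, 0))) \<phi>\<^sub>a"
    and \<psi>: "infinitesimal_differential \<A> \<rho> (\<lambda>t. hopf_differential \<A> (\<sigma> (0, t)) \<rho> (w (0, t))) \<phi>\<^sub>b"
    and e: "e \<in> conformal_charts \<A> \<rho>" "p \<in> fst e"
  shows "fam_deriv (fam_deriv L_area (0, y)) (x, 0) 0 p =
     2 * Re (x * cnj y * (\<phi>\<^sub>a e p * cnj (\<phi>\<^sub>b e p) / of_real (conformal_factor \<rho> e p) ^ 2))"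
proof -
  obtain a where a: "a \<in> \<A>" "p \<in> fst a" using atlas_cover by blast
  have oa: "a \<in> charts" using a atlas_oriented by blast
  have oe: "e \<in> charts" by (rule conformal_oriented[OF e(1)])
  note ia = atlas_is_chart[OF a(1)]
  obtain \<delta>0 r where box: "smooth_box a p \<delta>0 r" using local_smoothness[OF a] by blast
  note dr = smooth_boxD(1-4)[OF box] and inU = smooth_boxD(5)[OF box] and sm = smooth_boxD(6-10)[OF box]
  obtain d1 r1 where d1: "d1 > 0" "r1 > 0" "Ck_on 2 (ball 0 d1 \<times> ball (snd a p) r1) (\<lambda>x. H_fam (fst x) (chart_inv a (snd x)))"
    using fam_smooth(1)[of 2] a unfolding Ck_fam_def by blast
  obtain d2 r2 where d2: "d2 > 0" "r2 > 0" "Ck_on 2 (ball 0 d2 \<times> ball (snd a p) r2) (\<lambda>x. ratio_fam (fst x) (chart_inv a (snd x)))"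
    using fam_smooth(3)[of 2] a unfolding Ck_fam_def by blast
  obtain d3 where d3: "d3 > 0" "\<forall>s\<in>ball 0 d3. \<forall>p. H_fam s p > 0"
    using Ck_fam_pos[OF fam_smooth(1)[of 0]] by (auto simp: fam_at_0)
  define \<delta> where "\<delta> = Min {\<delta>0, d1, d2, d3}"
  have \<delta>: "\<delta> > 0" using dr d1 d2 d3 by (simp add: \<delta>_def)
  let ?B = "ball (0 :: complex \<times> complex) \<delta>"
  have o: "open ?B" by simp
  have sub: "s \<in> ball 0 \<delta>0" "s \<in> ball 0 d1" "s \<in> ball 0 d2" "s \<in> ball 0 d3" "s \<in> ball 0 \<epsilon>" if "s \<in> ?B" for s
    using that dr(3) by (auto simp: \<delta>_def)
  have ca: "chart_inv a (snd a p) = p" by (rule chart_inv_left[OF ia a(2)])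
  have slice: "Ck_on k ?B (\<lambda>s. F s p)" if F: "Ck_on k (ball 0 d \<times> ball (snd a p) r') (\<lambda>x. F (fst x) (chart_inv a (snd x)))"
    and "?B \<subseteq> ball 0 d" "r' > 0" for F :: "complex \<times> complex \<Rightarrow> 'a \<Rightarrow> real" and d r' k
    using Ck_on_subset[OF open_ball o that(2) Ck_on_slice[OF open_ball open_ball F, of "snd a p"]] that(3) by (simp add: ca)
  have S: "Ck_on k ?B (\<lambda>s. \<sigma> s a p v v')" for k v v'
    by (rule slice[OF sm(2)]) (use sub dr in auto)
  have B: "Ck_on k ?B (\<lambda>s. pullback s a p v v')" for k v v'
    by (rule slice[OF sm(5)]) (use sub dr in auto)
  have HC: "Ck_on 2 ?B (\<lambda>s. H_fam s p)" by (rule slice[OF d1(3)]) (use sub d1 in auto)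
  have DC: "Ck_on 2 ?B (\<lambda>s. ratio_fam s p)" by (rule slice[OF d2(3)]) (use sub d2 in auto)
  have wa: "w s p \<in> fst a" if "s \<in> ?B" for s using inU[OF sub(1)[OF that], of "snd a p"] dr(2) by (simp add: ca)
  have pf: "pos_form (\<sigma> s a p)" if "s \<in> ?B" for s by (rule metric_pos_form[OF sigma(1)[OF sub(5)[OF that]] oa a(2)])
  define q1 where "q1 s = hopf_re (\<sigma> s a p) (pullback s a p)" for s
  define q2 where "q2 s = hopf_im (\<sigma> s a p) (pullback s a p)" for s
  \<comment> \<open>Obtained by solving
    \<open>H L (\<sigma> 1 1)\<^sup>2 = q1\<^sup>2 + q2\<^sup>2\<close> for \<open>L\<close>; the
    H-density is 1 at \<open>s = 0\<close>, and the radius \<open>d3\<close> keeps it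
    positive.\<close>
  define K where "K s = ratio_fam s p / (H_fam s p * (\<sigma> s a p 1 1)\<^sup>2)" for s
  have vol: "Ck_on k ?B (\<lambda>s. gram_vol (\<sigma> s a p))" for k
    unfolding gram_vol_def by (intro Ck_on_sqrt Ck_on_diff Ck_on_mult Ck_on_power o S pos_form_det(1) pf)
  have ne: "gram_vol (\<sigma> s a p) \<noteq> 0" "\<sigma> s a p 1 1 * \<sigma> s a p \<i> \<i> - (\<sigma> s a p 1 \<i>)\<^sup>2 \<noteq> 0"
      "\<sigma> s a p 1 1 \<noteq> 0" "H_fam s p \<noteq> 0" if "s \<in> ?B" for s
    using gram_vol_pos[OF pf[OF that]] pos_form_det[OF pf[OF that]] d3(2)[rule_format, OF sub(4)[OF that], of p] by simp_all
  have q1: "Ck_on k ?B q1" for k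
    unfolding q1_def hopf_re_def
    by (intro Ck_on_divide Ck_on_add Ck_on_diff Ck_on_mult Ck_on_power Ck_on_const o S B) (use ne in auto)
  have q2: "Ck_on k ?B q2" for k
    unfolding q2_def hopf_im_def
    by (intro Ck_on_divide Ck_on_diff Ck_on_mult Ck_on_const o S B vol) (use ne in auto)
  have KC: "Ck_on 2 ?B K"
    unfolding K_def by (intro Ck_on_divide Ck_on_mult Ck_on_power o HC DC S) (use ne in auto)
  have LK: "L_area s p = ((q1 s)\<^sup>2 + (q2 s)\<^sup>2) * K s" if s: "s \<in> ?B" for s
    unfolding q1_def q2_def fam_formulas(4)[OF sub(5)[OF s] a wa[OF s], symmetric] K_def L_area_def
    using ne(3,4)[OF s] by simp
  have Q: "hopf_differential \<A> (\<sigma> s) \<rho> (w s) e p (trans_deriv a e p 1) = Complex (q1 s) (q2 s)" if s: "s \<in> ?B" for s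
    unfolding q1_def q2_def by (rule fam_formulas(3)[OF sub(5)[OF s] a wa[OF s] oe e(2)])
  have B0: "pullback 0 a p = \<rho> a p" by (intro ext) (simp add: pullback_def w_deriv_0[OF a] w0)
  have 0: "0 \<in> ?B" using \<delta> by simp
  \<comment> \<open>At \<open>s = 0\<close> the pulled back metric is the domain metric itself,
    which has no (2,0)-part.\<close>
  have z: "q1 0 = 0" "q2 0 = 0"
    using ne(2)[OF 0] unfolding q1_def q2_def hopf_re_def hopf_im_def B0 sigma0
    by (simp_all add: field_simps power2_eq_square)
  define v where "v = trans_deriv a e p 1"
  define Dq1 Dq2 where "Dq1 = frechet_derivative q1 (at 0)" and "Dq2 = frechet_derivative q2 (at 0)"
  note D1 = Ck_on_SucE(1)[OF o q1[of "Suc 0"] 0, folded Dq1_def] and D2 = Ck_on_SucE(1)[OF o q2[of "Suc 0"] 0, folded Dq2_def]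
  \<comment> \<open>\<open>\<iota>\<close> is the inclusion of one of the two parameter axes. Along
    it the real derivatives of \<open>q1\<close> and \<open>q2\<close> are matched with the complex
    derivative of the Hopf differential by uniqueness of derivatives.\<close>
  have axis: "Complex (Dq1 (\<iota> t)) (Dq2 (\<iota> t)) = t * (c * v\<^sup>2)"
    if c: "((\<lambda>t. hopf_differential \<A> (\<sigma> (\<iota> t)) \<rho> (w (\<iota> t)) e p v) has_field_derivative c * v\<^sup>2) (at 0)"
      and \<iota>: "bounded_linear \<iota>" for \<iota> :: "complex \<Rightarrow> complex \<times> complex" and c t
  proof -
    have \<iota>0: "\<iota> 0 = 0" using bounded_linear.linear[OF \<iota>] linear_0 by blast
    have d\<iota>: "(\<iota> has_derivative \<iota>) (at 0)" by (rule bounded_linear_imp_has_derivative[OF \<iota>])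
    have "(q1 \<circ> \<iota> has_derivative Dq1 \<circ> \<iota>) (at 0)" "(q2 \<circ> \<iota> has_derivative Dq2 \<circ> \<iota>) (at 0)"
      using diff_chain_at[OF d\<iota>, of q1 Dq1] diff_chain_at[OF d\<iota>, of q2 Dq2] D1 D2 \<iota>0 by auto
    then have "((\<lambda>t. of_real (q1 (\<iota> t)) + \<i> * of_real (q2 (\<iota> t))) has_derivative (\<lambda>t. of_real (Dq1 (\<iota> t)) + \<i> * of_real (Dq2 (\<iota> t)))) (at 0)"
      by (intro has_derivative_add has_derivative_mult_right has_derivative_of_real) (simp_all add: o_def)
    then have 1: "((\<lambda>t. Complex (q1 (\<iota> t)) (q2 (\<iota> t))) has_derivative (\<lambda>t. Complex (Dq1 (\<iota> t)) (Dq2 (\<iota> t)))) (at 0)"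
      by (simp add: Complex_eq)
    have oi: "open (\<iota> -` ?B)"
      by (rule open_vimage[OF o linear_continuous_on[OF \<iota>]])
    have "0 \<in> \<iota> -` ?B" using \<iota>0 \<delta> by simp
    from has_derivative_transform_within_open[OF 1 oi this]
    have 2: "((\<lambda>t. hopf_differential \<A> (\<sigma> (\<iota> t)) \<rho> (w (\<iota> t)) e p v) has_derivative (\<lambda>t. Complex (Dq1 (\<iota> t)) (Dq2 (\<iota> t)))) (at 0)"
      using Q unfolding v_def by simp
    have 3: "((\<lambda>t. hopf_differential \<A> (\<sigma> (\<iota> t)) \<rho> (w (\<iota> t)) e p v) has_derivative (\<lambda>t. c * v\<^sup>2 * t)) (at 0)"
      using c by (simp add: has_field_derivative_def)
    have "(\<lambda>t. Complex (Dq1 (\<iota> t)) (Dq2 (\<iota> t))) = (\<lambda>t. c * v\<^sup>2 * t)"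
      by (rule has_derivative_unique[OF 2 3])
    from fun_cong[OF this, of t] show ?thesis by (simp add: mult.commute)
  qed
  have "((\<lambda>t. hopf_differential \<A> (\<sigma> (t, 0)) \<rho> (w (t, 0)) e p v) has_field_derivative \<phi>\<^sub>a e p * v\<^sup>2) (at 0)"
    using \<phi> e unfolding infinitesimal_differential_def by blast
  from axis[of "\<lambda>t. (t, 0)" _ x, OF this]
  have X: "Complex (Dq1 (x, 0)) (Dq2 (x, 0)) = x * (\<phi>\<^sub>a e p * v\<^sup>2)"
    by (simp add: bounded_linear_Pair bounded_linear_ident bounded_linear_zero)
  have "((\<lambda>t. hopf_differential \<A> (\<sigma> (0, t)) \<rho> (w (0, t)) e p v) has_field_derivative \<phi>\<^sub>b e p * v\<^sup>2) (at 0)"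
    using \<psi> e unfolding infinitesimal_differential_def by blast
  from axis[of "\<lambda>t. (0, t)" _ y, OF this]
  have Y: "Complex (Dq1 (0, y)) (Dq2 (0, y)) = y * (\<phi>\<^sub>b e p * v\<^sup>2)"
    by (simp add: bounded_linear_Pair bounded_linear_ident bounded_linear_zero)
  have "((\<lambda>s. fam_deriv L_area (0, y) s p) has_derivative (\<lambda>u. 2 * K 0 * (Dq1 (0, y) * Dq1 u + Dq2 (0, y) * Dq2 u))) (at 0)"
    unfolding fam_deriv_def Dq1_def Dq2_def
    by (rule square_second_derivative[OF \<delta> q1 q2 KC z LK])
  from fun_cong[OF frechet_derivative_at[OF this], of "(x, 0)"]
  have "fam_deriv (fam_deriv L_area (0, y)) (x, 0) 0 p = 2 * K 0 * (Dq1 (0, y) * Dq1 (x, 0) + Dq2 (0, y) * Dq2 (x, 0))"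
    unfolding fam_deriv_def[of "fam_deriv L_area (0, y)"] by simp
  also have "Dq1 (0, y) * Dq1 (x, 0) + Dq2 (0, y) * Dq2 (x, 0) = Re (Complex (Dq1 (x, 0)) (Dq2 (x, 0)) * cnj (Complex (Dq1 (0, y)) (Dq2 (0, y))))"
    by simp
  also have "\<dots> = Re (x * cnj y * (\<phi>\<^sub>a e p * cnj (\<phi>\<^sub>b e p)) * of_real ((cmod v)\<^sup>2 * (cmod v)\<^sup>2))"
  proof -
    have "complex_of_real ((cmod v)\<^sup>2 * (cmod v)\<^sup>2) = (v * cnj v) * (v * cnj v)"
      by (simp only: of_real_mult complex_norm_square)
    then show ?thesis
      unfolding X Y by (intro arg_cong[of _ _ Re]) (simp add: power2_eq_square)
  qed
  \<comment> \<open>Both densities entering \<open>K\<close> are 1 at the base parameter apart from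
    the metric coefficient, and in \<open>e\<close> the vector of coordinate \<open>1\<close> in
    \<open>a\<close> is \<open>v\<close>.\<close>
  also have "K 0 = 1 / (conformal_factor \<rho> e p * (cmod v)\<^sup>2)\<^sup>2"
  proof -
    have "\<rho> a p 1 1 = conformal_factor \<rho> e p * (v \<bullet> v)"
      unfolding metric_transform[OF rho(1) oa a(2) oe e(2)] v_def
      by (rule conformal_factor_gram_vol(2)[OF e metric_pos_form[OF rho(1) oe e(2)]])
    then show ?thesis unfolding K_def fam_at_0 by (simp add: sigma0 power2_norm_eq_inner)
  qed
  also have "2 * (1 / (conformal_factor \<rho> e p * (cmod v)\<^sup>2)\<^sup>2) * Re (x * cnj y * (\<phi>\<^sub>a e p * cnj (\<phi>\<^sub>b e p)) * of_real ((cmod v)\<^sup>2 * (cmod v)\<^sup>2))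
      = 2 * Re (x * cnj y * (\<phi>\<^sub>a e p * cnj (\<phi>\<^sub>b e p) / of_real (conformal_factor \<rho> e p) ^ 2))"
  proof -
    have v: "v \<noteq> 0"
    proof
      assume "v = 0"
      then have "trans_deriv e a p 0 = 1" using trans_deriv_inverse[OF oa a(2) oe e(2), of 1] by (simp add: v_def)
      then show False using linear_0[OF trans_deriv_linear[OF oe e(2) oa a(2)]] by simp
    qed
    have f: "conformal_factor \<rho> e p \<noteq> 0"
      using conformal_factor_gram_vol(3)[OF e metric_pos_form[OF rho(1) oe e(2)]] by simp
    have R: "Re (u * of_real c) = Re u * c" "Re (u / of_real c) = Re u / c" for u c
      by (simp_all add: Re_divide_of_real)
    show ?thesis
      unfolding times_divide_eq_right of_real_power[symmetric] R using v f
      by (simp add: field_simps power2_eq_square)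
  qed
  finally show ?thesis .
qed

text \<open>The energy is a constant plus \<open>2 * G\<close>, and the integrated second derivative
  of \<open>G\<close> in the directions \<open>(x, 0)\<close> and \<open>(0, y)\<close> is
  \<open>2 * Re (x * cnj y * I)\<close>, that is \<open>x * cnj y * I\<close> plus its conjugate.
  The mixed Wirtinger operator keeps the coefficient of \<open>x * cnj y\<close>, so
  \<open>G\<close> contributes \<open>I\<close> and the energy \<open>2 * I\<close>.\<close>

theorem second_variation:
  assumes \<phi>: "infinitesimal_differential \<A> \<rho> (\<lambda>t. hopf_differential \<A> (\<sigma> (t, 0)) \<rho> (w (t, 0))) \<phi>\<^sub>a"
    and \<psi>: "infinitesimal_differential \<A> \<rho> (\<lambda>t. hopf_differential \<A> (\<sigma> (0, t)) \<rho> (w (0, t))) \<phi>\<^sub>b"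
  shows "has_mixed_wirtinger_derivative (\<lambda>s. of_real (energy \<A> (\<sigma> s) \<rho> (w s)))
           (2 * bergman_inner \<A> \<rho> \<phi>\<^sub>a \<phi>\<^sub>b)"
proof -
  define \<Phi> where "\<Phi> p = (let c = chart_at (conformal_charts \<A> \<rho>) p in
        \<phi>\<^sub>a c p * cnj (\<phi>\<^sub>b c p) / of_real (conformal_factor \<rho> c p) ^ 2)" for p
  define G where "G s = (\<integral>p. L_area s p \<partial>mu)" for s
  define G1 where "G1 v s = (\<integral>p. fam_deriv L_area v s p \<partial>mu)" for v s
  have f2: "fam_deriv (fam_deriv L_area (0, y)) (x, 0) 0 p = 2 * Re (x * cnj y * \<Phi> p)" for x y p
  proof -
    have "chart_at (conformal_charts \<A> \<rho>) p \<in> conformal_charts \<A> \<rho> \<and> p \<in> fst (chart_at (conformal_charts \<A> \<rho>) p)"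
      using rho(2)[of p] chart_at_in[of _ "conformal_charts \<A> \<rho>" p] by metis
    with L_area_second_derivative[OF \<phi> \<psi>] show ?thesis by (simp add: \<Phi>_def Let_def)
  qed
  obtain d1 where d1: "d1 > 0" "\<And>s. s \<in> ball 0 d1 \<Longrightarrow> (G has_derivative (\<lambda>v. G1 v s)) (at s)"
    unfolding G_def G1_def using Ck_fam_integral_has_derivative[OF L_area_smooth mu(3,2)] by blast
  have G1d: "(G1 (0, y) has_derivative (\<lambda>u. \<integral>p. fam_deriv (fam_deriv L_area (0, y)) u 0 p \<partial>mu)) (at 0)" for y
  proof -
    obtain d where "d > 0" "\<forall>s\<in>ball 0 d. ((\<lambda>s. \<integral>p. fam_deriv L_area (0, y) s p \<partial>mu) has_derivative
        (\<lambda>u. \<integral>p. fam_deriv (fam_deriv L_area (0, y)) u s p \<partial>mu)) (at s)"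
      using Ck_fam_integral_has_derivative[OF Ck_fam_deriv[OF L_area_smooth[of "Suc (Suc 0)"]] mu(3,2)] by blast
    then show ?thesis unfolding G1_def by simp
  qed
  have f2c: "continuous_on UNIV (\<lambda>p. fam_deriv (fam_deriv L_area (0, y)) u 0 p)" for y u
  proof -
    obtain d where "d > 0" "\<forall>s\<in>ball 0 d. continuous_on UNIV (fam_deriv (fam_deriv L_area (0, y)) u s)"
      using Ck_fam_slice_continuous[OF Ck_fam_deriv[OF Ck_fam_deriv[OF L_area_smooth[of "Suc (Suc 0)"]]]] by blast
    then show ?thesis by simp
  qed
  \<comment> \<open>\<open>\<Phi>\<close> is written with a chart chosen at each point, so its
    continuity is not visible. It is recovered from second derivatives of \<open>L_area\<close>: for
    \<open>x = 1\<close> the choices \<open>y = 1\<close> and \<open>y = \<i>\<close> give twice the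
    real and twice the imaginary part of \<open>\<Phi>\<close>.\<close>
  have "continuous_on UNIV (\<lambda>p. Complex (fam_deriv (fam_deriv L_area (0, 1)) (1, 0) 0 p / 2) (fam_deriv (fam_deriv L_area (0, \<i>)) (1, 0) 0 p / 2))"
    unfolding Complex_eq by (intro continuous_intros f2c) auto
  moreover have "Complex (fam_deriv (fam_deriv L_area (0, 1)) (1, 0) 0 p / 2) (fam_deriv (fam_deriv L_area (0, \<i>)) (1, 0) 0 p / 2) = \<Phi> p" for p
    by (simp add: f2 complex_eq_iff)
  ultimately have \<Phi>i: "integrable mu \<Phi>"
    using integrable_continuous_compact[OF compact_surface mu(3,2), of \<Phi>] by simp
  have berg: "bergman_inner \<A> \<rho> \<phi>\<^sub>a \<phi>\<^sub>b = (\<integral>p. \<Phi> p \<partial>mu)"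
    by (simp add: bergman_inner_def \<Phi>_def)
  define I where "I = (\<integral>p. \<Phi> p \<partial>mu)"
  have int2: "(\<integral>p. fam_deriv (fam_deriv L_area (0, y)) (x, 0) 0 p \<partial>mu) = 2 * Re (x * cnj y * I)" for x y
  proof -
    have "(\<integral>p. fam_deriv (fam_deriv L_area (0, y)) (x, 0) 0 p \<partial>mu) = 2 * (\<integral>p. Re (x * cnj y * \<Phi> p) \<partial>mu)"
      by (simp only: f2 integral_mult_right_zero)
    also have "(\<integral>p. Re (x * cnj y * \<Phi> p) \<partial>mu) = Re (\<integral>p. x * cnj y * \<Phi> p \<partial>mu)"
      using \<Phi>i by (intro integral_Re) simp
    also have "(\<integral>p. x * cnj y * \<Phi> p \<partial>mu) = x * cnj y * I"
      unfolding I_def by simp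
    finally show ?thesis .
  qed
  let ?E = "\<lambda>s. complex_of_real (energy \<A> (\<sigma> s) \<rho> (w s))"
  obtain d2 where d2: "d2 > 0" "\<And>s. s \<in> ball 0 d2 \<Longrightarrow> energy \<A> (\<sigma> s) \<rho> (w s) = measure mu UNIV + 2 * G s"
    unfolding G_def using energy_identity by blast
  define d where "d = min d1 d2"
  have d: "d > 0" using d1 d2 by (simp add: d_def)
  have Ev: "((\<lambda>v. ?E (u, v)) has_derivative (\<lambda>h. of_real (2 * G1 (0, h) (u, 0)))) (at 0)" if u: "u \<in> ball 0 d" for u
  proof -
    have ub: "(u, 0) \<in> ball (0 :: complex \<times> complex) d1" using u by (simp add: d_def norm_Pair)
    have "((\<lambda>v. (u, v)) has_derivative (\<lambda>h. (0, h))) (at 0)"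
      by (auto intro!: derivative_eq_intros)
    from diff_chain_at[OF this d1(2)[OF ub]]
    have "((\<lambda>v. G (u, v)) has_derivative (\<lambda>h. G1 (0, h) (u, 0))) (at 0)" by (simp add: o_def)
    then have 1: "((\<lambda>v. complex_of_real (measure mu UNIV + 2 * G (u, v))) has_derivative (\<lambda>h. of_real (2 * G1 (0, h) (u, 0)))) (at 0)"
      by (auto intro!: derivative_eq_intros)
    have cont: "continuous_on UNIV (\<lambda>v::complex. (u, v))" by (intro continuous_intros)
    have o: "open ((\<lambda>v. (u, v)) -` ball (0 :: complex \<times> complex) d2)"
      by (rule open_vimage[OF open_ball cont])
    have m: "0 \<in> (\<lambda>v. (u, v)) -` ball (0 :: complex \<times> complex) d2" using u by (simp add: d_def norm_Pair)
    show ?thesis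
      by (rule has_derivative_transform_within_open[OF 1 o m]) (use d2(2) in auto)
  qed
  \<comment> \<open>The factor 2 in front of \<open>G\<close> cancels the 1/2 in
    \<open>pd_zbar\<close>.\<close>
  have pdzb: "pd_zbar (\<lambda>v. ?E (u, v)) 0 = of_real (G1 (0, 1) (u, 0)) + \<i> * of_real (G1 (0, \<i>) (u, 0))" if u: "u \<in> ball 0 d" for u
    unfolding pd_zbar_def frechet_derivative_at[OF Ev[OF u], symmetric] by (simp add: field_simps)
  have slice: "((\<lambda>u. G1 (0, y) (u, 0)) has_derivative (\<lambda>x. 2 * Re (x * cnj y * I))) (at 0)" for y
  proof -
    have 1: "((\<lambda>u. (u, 0)) has_derivative (\<lambda>x. (x, 0))) (at (0 :: complex))"
      by (auto intro!: derivative_eq_intros)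
    have 2: "(G1 (0, y) has_derivative (\<lambda>u. \<integral>p. fam_deriv (fam_deriv L_area (0, y)) u 0 p \<partial>mu)) (at ((\<lambda>u. (u, 0)) (0::complex)))"
      using G1d by (simp add: zero_prod_def)
    from diff_chain_at[OF 1 2] show ?thesis by (simp add: o_def int2)
  qed
  have "((\<lambda>u. of_real (G1 (0, 1) (u, 0)) + \<i> * of_real (G1 (0, \<i>) (u, 0))) has_derivative
      (\<lambda>x. of_real (2 * Re (x * cnj 1 * I)) + \<i> * of_real (2 * Re (x * cnj \<i> * I)))) (at 0)"
    by (intro has_derivative_add has_derivative_mult_right has_derivative_of_real slice)
  \<comment> \<open>Here \<open>cnj \<i> * x * I\<close> has real part equal to the imaginary part
    of \<open>x * I\<close>, so the two real parts reassemble a complex linear map.\<close>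
  moreover have "(\<lambda>x. of_real (2 * Re (x * cnj 1 * I)) + \<i> * of_real (2 * Re (x * cnj \<i> * I))) = (\<lambda>x. 2 * x * I)"
    by (auto simp: fun_eq_iff complex_eq_iff)
  ultimately have 1: "((\<lambda>u. of_real (G1 (0, 1) (u, 0)) + \<i> * of_real (G1 (0, \<i>) (u, 0))) has_derivative (\<lambda>x. 2 * x * I)) (at 0)"
    by simp
  have 0: "0 \<in> ball (0::complex) d" using d by simp
  have D: "((\<lambda>u. pd_zbar (\<lambda>v. ?E (u, v)) 0) has_derivative (\<lambda>x. 2 * x * I)) (at 0)"
    by (rule has_derivative_transform_within_open[OF 1 open_ball 0]) (simp add: pdzb)
  show ?thesis
    unfolding has_mixed_wirtinger_derivative_def
  proof (intro conjI)
    have "\<forall>\<^sub>F u in nhds 0. u \<in> ball (0::complex) d" by (rule eventually_nhds_in_open) (use d in auto)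
    then show "\<forall>\<^sub>F u in nhds 0. (\<lambda>v. ?E (u, v)) differentiable at 0"
      by (rule eventually_mono) (use Ev differentiableI in blast)
    show "(\<lambda>u. pd_zbar (\<lambda>v. ?E (u, v)) 0) differentiable at 0" using D differentiableI by blast
    show "pd_z (\<lambda>u. pd_zbar (\<lambda>v. ?E (u, v)) 0) 0 = 2 * bergman_inner \<A> \<rho> \<phi>\<^sub>a \<phi>\<^sub>b"
      unfolding pd_z_def frechet_derivative_at[OF D, symmetric] berg I_def[symmetric] by simp
  qed
qed

end

theorem theorem1p3:
  fixes \<A> :: "'a::t2_space chart set"
    and g :: nat
    and \<epsilon> :: real
    and \<rho> :: "'a metric"
    and \<sigma> :: "complex \<times> complex \<Rightarrow> 'a metric"
    and w :: "complex \<times> complex \<Rightarrow> 'a \<Rightarrow> 'a"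
    and \<phi>\<^sub>a \<phi>\<^sub>b :: "'a chart \<Rightarrow> 'a \<Rightarrow> complex"
  assumes "g \<ge> 2"
    and "closed_oriented_surface \<A> g"
    and "canonical_metric \<A> g \<rho>"
    and "\<epsilon> > 0"
    and "smooth_metric_family \<A> (ball 0 \<epsilon>) \<sigma>"
    and "\<And>s. s \<in> ball 0 \<epsilon> \<Longrightarrow> canonical_metric \<A> g (\<sigma> s)"
    and "\<sigma> 0 = \<rho>"
    and "\<And>s. s \<in> ball 0 \<epsilon> \<Longrightarrow> harmonic_map \<A> (\<sigma> s) \<rho> (w s)"
    and "\<And>s. s \<in> ball 0 \<epsilon> \<Longrightarrow> homotopic_with_canon (\<lambda>_. True) UNIV UNIV (w s) id"
    and "real_analytic_family \<A> \<rho> (ball 0 \<epsilon>) w"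
    and "w 0 = id"
    and "infinitesimal_differential \<A> \<rho> (\<lambda>t. hopf_differential \<A> (\<sigma> (t, 0)) \<rho> (w (t, 0))) \<phi>\<^sub>a"
    and "infinitesimal_differential \<A> \<rho> (\<lambda>t. hopf_differential \<A> (\<sigma> (0, t)) \<rho> (w (0, t))) \<phi>\<^sub>b"
  shows "has_mixed_wirtinger_derivative (\<lambda>s. of_real (energy \<A> (\<sigma> s) \<rho> (w s)))
           (2 * bergman_inner \<A> \<rho> \<phi>\<^sub>a \<phi>\<^sub>b)"
proof -
  interpret metric_family \<A> \<epsilon> \<rho> \<sigma> w
  proof
    show "compact (UNIV :: 'a set)" "connected (UNIV :: 'a set)" "oriented_atlas \<A>"
      using assms(2) by (simp_all add: closed_oriented_surface_def)
    show "smooth_family \<A> (ball 0 \<epsilon>) w"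
      using assms(10) by (simp add: real_analytic_family_def)
  qed (use assms(3-7,11) in \<open>simp_all add: canonical_metric_conformal[where g = g]\<close>)
  show ?thesis by (rule second_variation[OF assms(12,13)])
qed

end
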